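(* Let $n$ be a positive integer, let $(\mathcal{C},\mathbb{E},\mathfrak{s})$ be a Krull-Schmidt $n$-exangulated category, and let $\mathcal{A}$ be an $n$-extension closed subcategory of $\mathcal{C}$. Let $\mathbb{E}_{\mathcal{A}}$ be the restriction of $\mathbb{E}$ to $\mathcal{A}^{\mathrm{op}}\times\mathcal{A}$. For $\delta\in\mathbb{E}_{\mathcal{A}}(C,A)$ (with $A,C\in\mathcal{A}$) put $\mathfrak{t}(\delta)=[X_\bullet]$, where $\langle X_\bullet,\delta\rangle$ is an $\mathfrak{s}$-distinguished $n$-exangle with $X_0=A$, $X_{n+1}=C$ and $X_i\in\mathcal{A}$ for $i=1,\dots,n$, and the homotopy equivalence class is taken in $\mathbf{C}^{n+2}_{(\mathcal{A};A,C)}$. Then $(\mathcal{A},\mathbb{E}_{\mathcal{A}},\mathfrak{t})$ is an $n$-exangulated category.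
   Context: **Extensions.** Let $\mathcal{C}$ be an additive category with an additive bifunctor $\mathbb{E}:\mathcal{C}^{\mathrm{op}}\times\mathcal{C}\to\mathrm{Ab}$. Elements $\delta\in\mathbb{E}(C,A)$ are called ($\mathbb{E}$-)extensions. For $a\in\mathcal{C}(A,A')$ and $c\in\mathcal{C}(C',C)$ write $a_*\delta=\mathbb{E}(C,a)(\delta)\in\mathbb{E}(C,A')$ and $c^*\delta=\mathbb{E}(c,A)(\delta)\in\mathbb{E}(C',A)$. A morphism of extensions from $\delta\in\mathbb{E}(C,A)$ to $\delta'\in\mathbb{E}(C',A')$ is a pair $(a,c)$, $a:A\to A'$, $c:C\to C'$, with $a_*\delta=c^*\delta'$. **Complexes.** $\mathbf{C}^{n+2}_{\mathcal{C}}$ is the category of complexes $X_\bullet: X_0\xrightarrow{d_0^X}X_1\to\cdots\to X_n\xrightarrow{d_n^X}X_{n+1}$ in $\mathcal{C}$ (zero in degrees outside $\{0,\dots,n+1\}$) and chain maps $f_\bullet=(f_0,\dots,f_{n+1})$. For objects $A,C$, $\mathbf{C}^{n+2}_{(\mathcal{C};A,C)}$ is the subcategory of complexes with $X_0=A$, $X_{n+1}=C$ and chain maps with $f_0=\mathrm{id}_A$, $f_{n+1}=\mathrm{id}_C$; $[X_\bullet]$ denotes the homotopy equivalence class of $X_\bullet$ in this category, with respect to the usual chain homotopy relation. **$n$-exangles.** A pair $\langle X_\bullet,\delta\rangle$ with $X_\bullet\in\mathbf{C}^{n+2}_{\mathcal{C}}$ and $\delta\in\mathbb{E}(X_{n+1},X_0)$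 is an $n$-exangle if both sequences of functors $\mathcal{C}(-,X_0)\to\cdots\to\mathcal{C}(-,X_{n+1})\to\mathbb{E}(-,X_0)$ (last map $f\mapsto f^*\delta$) and $\mathcal{C}(X_{n+1},-)\to\cdots\to\mathcal{C}(X_0,-)\to\mathbb{E}(X_{n+1},-)$ (last map $g\mapsto g_*\delta$) are exact. **Exact realization.** $\mathfrak{s}$ assigns to each $\delta\in\mathbb{E}(C,A)$ a homotopy equivalence class $\mathfrak{s}(\delta)=[X_\bullet]$ in $\mathbf{C}^{n+2}_{(\mathcal{C};A,C)}$. It is an exact realization if: (R0) for $\mathfrak{s}(\delta)=[X_\bullet]$, $\mathfrak{s}(\rho)=[Y_\bullet]$ and any morphism of extensions $(a,c):\delta\to\rho$, there is a chain map $f_\bullet=(a,f_1,\dots,f_n,c):X_\bullet\to Y_\bullet$ (a lift of $(a,c)$); (R1) if $\mathfrak{s}(\delta)=[X_\bullet]$ then $\langle X_\bullet,\delta\rangle$ is an $n$-exangle; (R2) for every $A\in\mathcal{C}$, the zero element of $\mathbb{E}(0,A)$ is realized by $[A\xrightarrow{\mathrm{id}}A\to0\to\cdots\to0]$ and the zero element of $\mathbb{E}(A,0)$ by $[0\to\cdots\to0\to A\xrightarrow{\mathrm{id}}A]$. If $\mathfrak{s}(\delta)=[X_\bullet]$, then $\langle X_\bullet,\delta\rangle$ is called an ($\mathfrak{s}$-)distinguished $n$-exangle and $X_\bullet$ an $\mathfrak{s}$-conflation; $d_0^X$ is then an $\mathfrak{s}$-inflation and $d_n^X$ an $\mathfrak{s}$-deflation.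 **$n$-exangulated category.** A triplet $(\mathcal{C},\mathbb{E},\mathfrak{s})$ with $\mathfrak{s}$ an exact realization of $\mathbb{E}$ such that: (EA1) inflations are closed under composition, and deflations are closed under composition; (EA2) for $\rho\in\mathbb{E}(D,A)$, $c\in\mathcal{C}(C,D)$ and distinguished $n$-exangles $\langle X_\bullet,c^*\rho\rangle$ (from $A$ to $C$) and $\langle Y_\bullet,\rho\rangle$ (from $A$ to $D$), $(\mathrm{id}_A,c)$ has a lift $f_\bullet$ whose mapping cone $M^f_\bullet: X_1\to X_2\oplus Y_1\to X_3\oplus Y_2\to\cdots\to X_{n+1}\oplus Y_n\to Y_{n+1}$, with differentials $d_0=\begin{bmatrix}-d_1^X\\ f_1\end{bmatrix}$, $d_i=\begin{bmatrix}-d_{i+1}^X&0\\ f_{i+1}&d_i^Y\end{bmatrix}$ ($1\le i\le n-1$), $d_n=[f_{n+1}\ \ d_n^Y]$, gives a distinguished $n$-exangle $\langle M^f_\bullet,(d_0^X)_*\rho\rangle$; (EA2$^{\mathrm{op}}$) the dual of (EA2): for $\rho\in\mathbb{E}(C,A)$, $a\in\mathcal{C}(A,B)$ and distinguished $\langle X_\bullet,\rho\rangle$, $\langle Y_\bullet,a_*\rho\rangle$, $(a,\mathrm{id}_C)$ has a lift $f_\bullet$ whose mapping cocone $N^f_\bullet:X_0\to X_1\oplus Y_0\to\cdots\to X_n\oplus Y_{n-1}\to Y_n$, with differentials $\begin{bmatrix}-d_0^X\\ f_0\end{bmatrix}$, $\begin{bmatrix}-d_i^X&0\\ f_i&d_{i-1}^Y\end{bmatrix}$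 ($1\le i\le n-1$), $[f_n\ \ d_{n-1}^Y]$, gives a distinguished $n$-exangle $\langle N^f_\bullet,(d_n^Y)^*\rho\rangle$. **Krull-Schmidt.** An additive category in which every object is a finite direct sum of objects with local endomorphism rings. **Subcategories.** A subcategory $\mathcal{A}$ of $\mathcal{C}$ is always assumed to be full and closed under isomorphisms, direct sums and direct summands. It is $n$-extension closed if for all $A,C\in\mathcal{A}$ and every $\delta\in\mathbb{E}(C,A)$ there is a distinguished $n$-exangle $\langle X_\bullet,\delta\rangle$ with $X_0=A$, $X_{n+1}=C$ and $X_i\in\mathcal{A}$ for $i=1,\dots,n$. *)

theory Defs
  imports "HOL-Algebra.Coset" "HOL-Algebra.Ring"
begin

(* The hom-sets and the values of the extension bifunctor are abelian groups, given as
   HOL-Algebra groups.  These are written multiplicatively in the library, so the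
   multiplication of Hom C A B is addition of morphisms, its unit is the zero morphism
   and its inverse is negation. *)

record ('o, 'm) cat =
  Obj :: "'o set"
  Hom :: "'o \<Rightarrow> 'o \<Rightarrow> 'm monoid"
  cmp :: "'m \<Rightarrow> 'm \<Rightarrow> 'm"  (infixl \<open>\<cdot>\<index>\<close> 70)
  ide :: "'o \<Rightarrow> 'm"

abbreviation Mor :: "('o, 'm, 'x) cat_scheme \<Rightarrow> 'o \<Rightarrow> 'o \<Rightarrow> 'm set" where
  "Mor \<C> A B \<equiv> carrier (Hom \<C> A B)"

abbreviation zmor :: "('o, 'm, 'x) cat_scheme \<Rightarrow> 'o \<Rightarrow> 'o \<Rightarrow> 'm" where
  "zmor \<C> A B \<equiv> \<one>\<^bsub>Hom \<C> A B\<^esub>"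

abbreviation padd :: "('o, 'm, 'x) cat_scheme \<Rightarrow> 'o \<Rightarrow> 'o \<Rightarrow> 'm \<Rightarrow> 'm \<Rightarrow> 'm" where
  "padd \<C> A B f g \<equiv> f \<otimes>\<^bsub>Hom \<C> A B\<^esub> g"

abbreviation pneg :: "('o, 'm, 'x) cat_scheme \<Rightarrow> 'o \<Rightarrow> 'o \<Rightarrow> 'm \<Rightarrow> 'm" where
  "pneg \<C> A B f \<equiv> inv\<^bsub>Hom \<C> A B\<^esub> f"

locale preadditive_category =
  fixes \<C> :: "('o, 'm, 'x) cat_scheme" (structure)
  assumes Mor_disjoint:
      "\<lbrakk>A \<in> Obj \<C>; B \<in> Obj \<C>; A' \<in> Obj \<C>; B' \<in> Obj \<C>; f \<in> Mor \<C> A B; f \<in> Mor \<C> A' B'\<rbrakk>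
        \<Longrightarrow> A = A' \<and> B = B'"
    and ide_in: "A \<in> Obj \<C> \<Longrightarrow> ide \<C> A \<in> Mor \<C> A A"
    and cmp_in: "\<lbrakk>A \<in> Obj \<C>; B \<in> Obj \<C>; D \<in> Obj \<C>; f \<in> Mor \<C> A B; g \<in> Mor \<C> B D\<rbrakk>
        \<Longrightarrow> g \<cdot> f \<in> Mor \<C> A D"
    and cmp_ide_right: "\<lbrakk>A \<in> Obj \<C>; B \<in> Obj \<C>; f \<in> Mor \<C> A B\<rbrakk> \<Longrightarrow> f \<cdot> ide \<C> A = f"
    and cmp_ide_left: "\<lbrakk>A \<in> Obj \<C>; B \<in> Obj \<C>; f \<in> Mor \<C> A B\<rbrakk> \<Longrightarrow> ide \<C> B \<cdot> f = f"
    and cmp_assoc: "\<lbrakk>A \<in> Obj \<C>; B \<in> Obj \<C>; D \<in> Obj \<C>; F \<in> Obj \<C>;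
        f \<in> Mor \<C> A B; g \<in> Mor \<C> B D; h \<in> Mor \<C> D F\<rbrakk> \<Longrightarrow> h \<cdot> g \<cdot> f = h \<cdot> (g \<cdot> f)"
    and Hom_comm_group: "\<lbrakk>A \<in> Obj \<C>; B \<in> Obj \<C>\<rbrakk> \<Longrightarrow> comm_group (Hom \<C> A B)"
    and postcomp_hom: "\<lbrakk>A \<in> Obj \<C>; B \<in> Obj \<C>; D \<in> Obj \<C>; g \<in> Mor \<C> B D\<rbrakk>
        \<Longrightarrow> (\<lambda>f. g \<cdot> f) \<in> hom (Hom \<C> A B) (Hom \<C> A D)"
    and precomp_hom: "\<lbrakk>A \<in> Obj \<C>; B \<in> Obj \<C>; D \<in> Obj \<C>; f \<in> Mor \<C> A B\<rbrakk>
        \<Longrightarrow> (\<lambda>g. g \<cdot> f) \<in> hom (Hom \<C> B D) (Hom \<C> A D)"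

definition zero_object :: "('o, 'm, 'x) cat_scheme \<Rightarrow> 'o \<Rightarrow> bool" where
  "zero_object \<C> Z \<longleftrightarrow> Z \<in> Obj \<C> \<and>
    (\<forall>X\<in>Obj \<C>. (\<exists>!f. f \<in> Mor \<C> Z X) \<and> (\<exists>!f. f \<in> Mor \<C> X Z))"

definition biproduct ::
  "('o, 'm, 'x) cat_scheme \<Rightarrow> 'o \<Rightarrow> 'o \<Rightarrow> 'o \<Rightarrow> 'm \<Rightarrow> 'm \<Rightarrow> 'm \<Rightarrow> 'm \<Rightarrow> bool" where
  "biproduct \<C> X Y S i1 i2 p1 p2 \<longleftrightarrow>
    X \<in> Obj \<C> \<and> Y \<in> Obj \<C> \<and> S \<in> Obj \<C> \<and>
    i1 \<in> Mor \<C> X S \<and> i2 \<in> Mor \<C> Y S \<and> p1 \<in> Mor \<C> S X \<and> p2 \<in> Mor \<C> S Y \<and>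
    p1 \<cdot>\<^bsub>\<C>\<^esub> i1 = ide \<C> X \<and> p2 \<cdot>\<^bsub>\<C>\<^esub> i2 = ide \<C> Y \<and>
    p1 \<cdot>\<^bsub>\<C>\<^esub> i2 = zmor \<C> Y X \<and> p2 \<cdot>\<^bsub>\<C>\<^esub> i1 = zmor \<C> X Y \<and>
    padd \<C> S S (i1 \<cdot>\<^bsub>\<C>\<^esub> p1) (i2 \<cdot>\<^bsub>\<C>\<^esub> p2) = ide \<C> S"

locale additive_category = preadditive_category +
  assumes ex_zero_object: "\<exists>Z. zero_object \<C> Z"
    and ex_biproduct: "\<lbrakk>X \<in> Obj \<C>; Y \<in> Obj \<C>\<rbrakk>
        \<Longrightarrow> \<exists>S i1 i2 p1 p2. biproduct \<C> X Y S i1 i2 p1 p2"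

(* For m = 0 this says that the identity of S is the zero morphism, i.e. that S is a
   zero object. *)
definition direct_sum ::
  "('o, 'm, 'x) cat_scheme \<Rightarrow> nat \<Rightarrow> (nat \<Rightarrow> 'o) \<Rightarrow> 'o \<Rightarrow> (nat \<Rightarrow> 'm) \<Rightarrow> (nat \<Rightarrow> 'm) \<Rightarrow> bool" where
  "direct_sum \<C> m X S \<iota> \<pi> \<longleftrightarrow>
    S \<in> Obj \<C> \<and>
    (\<forall>k<m. X k \<in> Obj \<C> \<and> \<iota> k \<in> Mor \<C> (X k) S \<and> \<pi> k \<in> Mor \<C> S (X k)) \<and>
    (\<forall>k<m. \<pi> k \<cdot>\<^bsub>\<C>\<^esub> \<iota> k = ide \<C> (X k)) \<and>
    (\<forall>k<m. \<forall>l<m. k \<noteq> l \<longrightarrow> \<pi> k \<cdot>\<^bsub>\<C>\<^esub> \<iota> l = zmor \<C> (X l) (X k)) \<and>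
    finprod (Hom \<C> S S) (\<lambda>k. \<iota> k \<cdot>\<^bsub>\<C>\<^esub> \<pi> k) {..<m} = ide \<C> S"

definition isomorphic :: "('o, 'm, 'x) cat_scheme \<Rightarrow> 'o \<Rightarrow> 'o \<Rightarrow> bool" where
  "isomorphic \<C> A B \<longleftrightarrow>
    (\<exists>f\<in>Mor \<C> A B. \<exists>g\<in>Mor \<C> B A. g \<cdot>\<^bsub>\<C>\<^esub> f = ide \<C> A \<and> f \<cdot>\<^bsub>\<C>\<^esub> g = ide \<C> B)"

definition End_ring :: "('o, 'm, 'x) cat_scheme \<Rightarrow> 'o \<Rightarrow> 'm ring" where
  "End_ring \<C> X = \<lparr>carrier = Mor \<C> X X, mult = cmp \<C>, one = ide \<C> X,
     zero = zmor \<C> X X, add = padd \<C> X X\<rparr>"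

(* Not necessarily commutative: nonzero, and the sum of two non-units is a non-unit. *)
definition local_ring :: "('a, 'b) ring_scheme \<Rightarrow> bool" where
  "local_ring R \<longleftrightarrow> ring R \<and> \<one>\<^bsub>R\<^esub> \<noteq> \<zero>\<^bsub>R\<^esub> \<and>
    (\<forall>a\<in>carrier R - Units R. \<forall>b\<in>carrier R - Units R. a \<oplus>\<^bsub>R\<^esub> b \<notin> Units R)"

definition krull_schmidt :: "('o, 'm, 'x) cat_scheme \<Rightarrow> bool" where
  "krull_schmidt \<C> \<longleftrightarrow> additive_category \<C> \<and>
    (\<forall>X\<in>Obj \<C>. \<exists>m Y \<iota> \<pi>. direct_sum \<C> m Y X \<iota> \<pi> \<and> (\<forall>k<m. local_ring (End_ring \<C> (Y k))))"

(* Ext E C A is E(C,A); act E c a is E(c,a) : E(C,A) -> E(C',A') for c : C' -> C and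
   a : A -> A'. *)
record ('o, 'm, 'e) bif =
  Ext :: "'o \<Rightarrow> 'o \<Rightarrow> 'e monoid"
  act :: "'m \<Rightarrow> 'm \<Rightarrow> 'e \<Rightarrow> 'e"

definition push ::
  "('o, 'm, 'x) cat_scheme \<Rightarrow> ('o, 'm, 'e, 'y) bif_scheme \<Rightarrow> 'o \<Rightarrow> 'm \<Rightarrow> 'e \<Rightarrow> 'e" where
  "push \<C> \<E> C a \<delta> = act \<E> (ide \<C> C) a \<delta>"

definition pull ::
  "('o, 'm, 'x) cat_scheme \<Rightarrow> ('o, 'm, 'e, 'y) bif_scheme \<Rightarrow> 'o \<Rightarrow> 'm \<Rightarrow> 'e \<Rightarrow> 'e" where
  "pull \<C> \<E> A c \<delta> = act \<E> c (ide \<C> A) \<delta>"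

locale additive_bifunctor = additive_category \<C>
  for \<C> :: "('o, 'm, 'x) cat_scheme" (structure) +
  fixes \<E> :: "('o, 'm, 'e, 'y) bif_scheme"
  assumes Ext_comm_group: "\<lbrakk>C \<in> Obj \<C>; A \<in> Obj \<C>\<rbrakk> \<Longrightarrow> comm_group (Ext \<E> C A)"
    and act_hom: "\<lbrakk>C \<in> Obj \<C>; C' \<in> Obj \<C>; A \<in> Obj \<C>; A' \<in> Obj \<C>;
        c \<in> Mor \<C> C' C; a \<in> Mor \<C> A A'\<rbrakk> \<Longrightarrow> act \<E> c a \<in> hom (Ext \<E> C A) (Ext \<E> C' A')"
    and act_ide: "\<lbrakk>C \<in> Obj \<C>; A \<in> Obj \<C>; \<delta> \<in> carrier (Ext \<E> C A)\<rbrakk>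
        \<Longrightarrow> act \<E> (ide \<C> C) (ide \<C> A) \<delta> = \<delta>"
    and act_cmp: "\<lbrakk>C \<in> Obj \<C>; C' \<in> Obj \<C>; C'' \<in> Obj \<C>; A \<in> Obj \<C>; A' \<in> Obj \<C>; A'' \<in> Obj \<C>;
        c \<in> Mor \<C> C' C; c' \<in> Mor \<C> C'' C'; a \<in> Mor \<C> A A'; a' \<in> Mor \<C> A' A'';
        \<delta> \<in> carrier (Ext \<E> C A)\<rbrakk>
        \<Longrightarrow> act \<E> (c \<cdot> c') (a' \<cdot> a) \<delta> = act \<E> c' a' (act \<E> c a \<delta>)"
    and push_add: "\<lbrakk>C \<in> Obj \<C>; A \<in> Obj \<C>; A' \<in> Obj \<C>; a \<in> Mor \<C> A A'; b \<in> Mor \<C> A A';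
        \<delta> \<in> carrier (Ext \<E> C A)\<rbrakk>
        \<Longrightarrow> push \<C> \<E> C (padd \<C> A A' a b) \<delta> = push \<C> \<E> C a \<delta> \<otimes>\<^bsub>Ext \<E> C A'\<^esub> push \<C> \<E> C b \<delta>"
    and pull_add: "\<lbrakk>C \<in> Obj \<C>; C' \<in> Obj \<C>; A \<in> Obj \<C>; c \<in> Mor \<C> C' C; d \<in> Mor \<C> C' C;
        \<delta> \<in> carrier (Ext \<E> C A)\<rbrakk>
        \<Longrightarrow> pull \<C> \<E> A (padd \<C> C' C c d) \<delta> = pull \<C> \<E> A c \<delta> \<otimes>\<^bsub>Ext \<E> C' A\<^esub> pull \<C> \<E> A d \<delta>"

definition ext_morphism ::
  "('o, 'm, 'x) cat_scheme \<Rightarrow> ('o, 'm, 'e, 'y) bif_scheme \<Rightarrow>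
    'o \<Rightarrow> 'o \<Rightarrow> 'e \<Rightarrow> 'o \<Rightarrow> 'o \<Rightarrow> 'e \<Rightarrow> 'm \<Rightarrow> 'm \<Rightarrow> bool" where
  "ext_morphism \<C> \<E> C A \<delta> C' A' \<rho> a c \<longleftrightarrow>
    a \<in> Mor \<C> A A' \<and> c \<in> Mor \<C> C C' \<and> push \<C> \<E> C a \<delta> = pull \<C> \<E> A' c \<rho>"

(* A complex X_0 -> ... -> X_{n+1} uses only the objects with index at most n + 1 and the
   differentials d_i : X_i -> X_{i+1} with i at most n; all other values are irrelevant. *)
record ('o, 'm) cplx =
  ob :: "nat \<Rightarrow> 'o"
  df :: "nat \<Rightarrow> 'm"

definition complexes :: "nat \<Rightarrow> ('o, 'm, 'x) cat_scheme \<Rightarrow> ('o, 'm) cplx set" where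
  "complexes n \<C> = {X. (\<forall>i\<le>n+1. ob X i \<in> Obj \<C>) \<and>
     (\<forall>i\<le>n. df X i \<in> Mor \<C> (ob X i) (ob X (i+1))) \<and>
     (\<forall>i<n. df X (i+1) \<cdot>\<^bsub>\<C>\<^esub> df X i = zmor \<C> (ob X i) (ob X (i+2)))}"

definition complexes_from_to ::
  "nat \<Rightarrow> ('o, 'm, 'x) cat_scheme \<Rightarrow> 'o \<Rightarrow> 'o \<Rightarrow> ('o, 'm) cplx set" where
  "complexes_from_to n \<C> A C = {X \<in> complexes n \<C>. ob X 0 = A \<and> ob X (n+1) = C}"

definition chain_map ::
  "nat \<Rightarrow> ('o, 'm, 'x) cat_scheme \<Rightarrow> ('o, 'm) cplx \<Rightarrow> ('o, 'm) cplx \<Rightarrow> (nat \<Rightarrow> 'm) \<Rightarrow> bool" where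
  "chain_map n \<C> X Y f \<longleftrightarrow>
    (\<forall>i\<le>n+1. f i \<in> Mor \<C> (ob X i) (ob Y i)) \<and>
    (\<forall>i\<le>n. f (i+1) \<cdot>\<^bsub>\<C>\<^esub> df X i = df Y i \<cdot>\<^bsub>\<C>\<^esub> f i)"

(* h i : X_{i+1} -> Y_i; as X and Y vanish outside degrees 0..n+1, only one summand
   remains in each of the two end degrees. *)
definition homotopic ::
  "nat \<Rightarrow> ('o, 'm, 'x) cat_scheme \<Rightarrow> ('o, 'm) cplx \<Rightarrow> ('o, 'm) cplx \<Rightarrow>
    (nat \<Rightarrow> 'm) \<Rightarrow> (nat \<Rightarrow> 'm) \<Rightarrow> bool" where
  "homotopic n \<C> X Y f g \<longleftrightarrow> (\<exists>h.
    (\<forall>i\<le>n. h i \<in> Mor \<C> (ob X (i+1)) (ob Y i)) \<and>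
    padd \<C> (ob X 0) (ob Y 0) (f 0) (pneg \<C> (ob X 0) (ob Y 0) (g 0)) = h 0 \<cdot>\<^bsub>\<C>\<^esub> df X 0 \<and>
    (\<forall>i<n. padd \<C> (ob X (i+1)) (ob Y (i+1))
               (f (i+1)) (pneg \<C> (ob X (i+1)) (ob Y (i+1)) (g (i+1)))
         = padd \<C> (ob X (i+1)) (ob Y (i+1))
               (df Y i \<cdot>\<^bsub>\<C>\<^esub> h i) (h (i+1) \<cdot>\<^bsub>\<C>\<^esub> df X (i+1))) \<and>
    padd \<C> (ob X (n+1)) (ob Y (n+1)) (f (n+1)) (pneg \<C> (ob X (n+1)) (ob Y (n+1)) (g (n+1)))
      = df Y n \<cdot>\<^bsub>\<C>\<^esub> h n)"

definition chain_map_fixing_ends ::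
  "nat \<Rightarrow> ('o, 'm, 'x) cat_scheme \<Rightarrow> ('o, 'm) cplx \<Rightarrow> ('o, 'm) cplx \<Rightarrow> (nat \<Rightarrow> 'm) \<Rightarrow> bool" where
  "chain_map_fixing_ends n \<C> X Y f \<longleftrightarrow>
    chain_map n \<C> X Y f \<and> f 0 = ide \<C> (ob X 0) \<and> f (n+1) = ide \<C> (ob X (n+1))"

definition homotopy_class ::
  "nat \<Rightarrow> ('o, 'm, 'x) cat_scheme \<Rightarrow> ('o, 'm) cplx \<Rightarrow> ('o, 'm) cplx set" where
  "homotopy_class n \<C> X = {Y \<in> complexes_from_to n \<C> (ob X 0) (ob X (n+1)). \<exists>f g.
     chain_map_fixing_ends n \<C> X Y f \<and> chain_map_fixing_ends n \<C> Y X g \<and>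
     homotopic n \<C> X X (\<lambda>i. g i \<cdot>\<^bsub>\<C>\<^esub> f i) (\<lambda>i. ide \<C> (ob X i)) \<and>
     homotopic n \<C> Y Y (\<lambda>i. f i \<cdot>\<^bsub>\<C>\<^esub> g i) (\<lambda>i. ide \<C> (ob Y i))}"

(* Exactness of the two sequences of functors is exactness of the sequences of abelian
   groups obtained by evaluating at each object T. *)
definition n_exangle ::
  "nat \<Rightarrow> ('o, 'm, 'x) cat_scheme \<Rightarrow> ('o, 'm, 'e, 'y) bif_scheme \<Rightarrow> ('o, 'm) cplx \<Rightarrow> 'e \<Rightarrow> bool" where
  "n_exangle n \<C> \<E> X \<delta> \<longleftrightarrow>
    X \<in> complexes n \<C> \<and> \<delta> \<in> carrier (Ext \<E> (ob X (n+1)) (ob X 0)) \<and>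
    (\<forall>T\<in>Obj \<C>.
      (\<forall>i<n. kernel (Hom \<C> T (ob X (i+1))) (Hom \<C> T (ob X (i+2))) (\<lambda>f. df X (i+1) \<cdot>\<^bsub>\<C>\<^esub> f)
            = (\<lambda>f. df X i \<cdot>\<^bsub>\<C>\<^esub> f) ` Mor \<C> T (ob X i)) \<and>
      kernel (Hom \<C> T (ob X (n+1))) (Ext \<E> T (ob X 0)) (\<lambda>f. pull \<C> \<E> (ob X 0) f \<delta>)
            = (\<lambda>f. df X n \<cdot>\<^bsub>\<C>\<^esub> f) ` Mor \<C> T (ob X n)) \<and>
    (\<forall>T\<in>Obj \<C>.
      (\<forall>i<n. kernel (Hom \<C> (ob X (i+1)) T) (Hom \<C> (ob X i) T) (\<lambda>g. g \<cdot>\<^bsub>\<C>\<^esub> df X i)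
            = (\<lambda>g. g \<cdot>\<^bsub>\<C>\<^esub> df X (i+1)) ` Mor \<C> (ob X (i+2)) T) \<and>
      kernel (Hom \<C> (ob X 0) T) (Ext \<E> (ob X (n+1)) T) (\<lambda>g. push \<C> \<E> (ob X (n+1)) g \<delta>)
            = (\<lambda>g. g \<cdot>\<^bsub>\<C>\<^esub> df X 0) ` Mor \<C> (ob X 1) T)"

definition trivial_left :: "('o, 'm, 'x) cat_scheme \<Rightarrow> 'o \<Rightarrow> 'o \<Rightarrow> ('o, 'm) cplx" where
  "trivial_left \<C> A Z = \<lparr>ob = (\<lambda>i. if i \<le> 1 then A else Z),
     df = (\<lambda>i. if i = 0 then ide \<C> A else if i = 1 then zmor \<C> A Z else zmor \<C> Z Z)\<rparr>"

definition trivial_right :: "nat \<Rightarrow> ('o, 'm, 'x) cat_scheme \<Rightarrow> 'o \<Rightarrow> 'o \<Rightarrow> ('o, 'm) cplx" where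
  "trivial_right n \<C> A Z = \<lparr>ob = (\<lambda>i. if i < n then Z else A),
     df = (\<lambda>i. if i = n then ide \<C> A else if i + 1 = n then zmor \<C> Z A else zmor \<C> Z Z)\<rparr>"

(* A realization takes the two objects as explicit arguments because the groups E(C,A)
   need not be disjoint: s C A \<delta> is the class of complexes assigned to \<delta> in E(C,A). *)
type_synonym ('o, 'm, 'e) realization = "'o \<Rightarrow> 'o \<Rightarrow> 'e \<Rightarrow> ('o, 'm) cplx set"

locale exact_realization = additive_bifunctor \<C> \<E>
  for n :: nat and \<C> :: "('o, 'm, 'x) cat_scheme" (structure)
    and \<E> :: "('o, 'm, 'e, 'y) bif_scheme" +
  fixes \<ss> :: "('o, 'm, 'e) realization"
  assumes realization_class:
      "\<lbrakk>C \<in> Obj \<C>; A \<in> Obj \<C>; \<delta> \<in> carrier (Ext \<E> C A)\<rbrakk>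
        \<Longrightarrow> \<exists>X\<in>complexes_from_to n \<C> A C. \<ss> C A \<delta> = homotopy_class n \<C> X"
    and R0: "\<lbrakk>C \<in> Obj \<C>; A \<in> Obj \<C>; \<delta> \<in> carrier (Ext \<E> C A);
        C' \<in> Obj \<C>; A' \<in> Obj \<C>; \<rho> \<in> carrier (Ext \<E> C' A');
        X \<in> \<ss> C A \<delta>; Y \<in> \<ss> C' A' \<rho>; ext_morphism \<C> \<E> C A \<delta> C' A' \<rho> a c\<rbrakk>
        \<Longrightarrow> \<exists>f. chain_map n \<C> X Y f \<and> f 0 = a \<and> f (n+1) = c"
    and R1: "\<lbrakk>C \<in> Obj \<C>; A \<in> Obj \<C>; \<delta> \<in> carrier (Ext \<E> C A); X \<in> \<ss> C A \<delta>\<rbrakk>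
        \<Longrightarrow> n_exangle n \<C> \<E> X \<delta>"
    and R2_left: "\<lbrakk>A \<in> Obj \<C>; zero_object \<C> Z\<rbrakk>
        \<Longrightarrow> \<ss> Z A \<one>\<^bsub>Ext \<E> Z A\<^esub> = homotopy_class n \<C> (trivial_left \<C> A Z)"
    and R2_right: "\<lbrakk>A \<in> Obj \<C>; zero_object \<C> Z\<rbrakk>
        \<Longrightarrow> \<ss> A Z \<one>\<^bsub>Ext \<E> A Z\<^esub> = homotopy_class n \<C> (trivial_right n \<C> A Z)"

definition conflation ::
  "('o, 'm, 'x) cat_scheme \<Rightarrow> ('o, 'm, 'e, 'y) bif_scheme \<Rightarrow> ('o, 'm, 'e) realization \<Rightarrow>
    ('o, 'm) cplx \<Rightarrow> bool" where
  "conflation \<C> \<E> \<ss> X \<longleftrightarrow>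
    (\<exists>C\<in>Obj \<C>. \<exists>A\<in>Obj \<C>. \<exists>\<delta>\<in>carrier (Ext \<E> C A). X \<in> \<ss> C A \<delta>)"

definition inflation ::
  "('o, 'm, 'x) cat_scheme \<Rightarrow> ('o, 'm, 'e, 'y) bif_scheme \<Rightarrow> ('o, 'm, 'e) realization \<Rightarrow> 'm \<Rightarrow> bool" where
  "inflation \<C> \<E> \<ss> f \<longleftrightarrow> (\<exists>X. conflation \<C> \<E> \<ss> X \<and> df X 0 = f)"

definition deflation ::
  "nat \<Rightarrow> ('o, 'm, 'x) cat_scheme \<Rightarrow> ('o, 'm, 'e, 'y) bif_scheme \<Rightarrow> ('o, 'm, 'e) realization \<Rightarrow>
    'm \<Rightarrow> bool" where
  "deflation n \<C> \<E> \<ss> f \<longleftrightarrow> (\<exists>X. conflation \<C> \<E> \<ss> X \<and> df X n = f)"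

(* K is U_0 -> U_1 + V_0 -> ... -> U_n + V_{n-1} -> V_n with differentials
     [-d_0^U; g_0],   [-d_i^U, 0; g_i, d_{i-1}^V]  (0 < i < n),   [g_n, d_{n-1}^V],
   for some choice of the biproducts.  The matrix entries of a morphism between biproducts
   are its composites with the injections i1, i2 and the projections p1, p2. *)
definition cone_shaped ::
  "nat \<Rightarrow> ('o, 'm, 'x) cat_scheme \<Rightarrow> ('o, 'm) cplx \<Rightarrow> ('o, 'm) cplx \<Rightarrow> (nat \<Rightarrow> 'm) \<Rightarrow>
    ('o, 'm) cplx \<Rightarrow> bool" where
  "cone_shaped n \<C> U V g K \<longleftrightarrow> (\<exists>i1 i2 p1 p2.
    ob K 0 = ob U 0 \<and> ob K (n+1) = ob V n \<and>
    (\<forall>i\<in>{1..n}. biproduct \<C> (ob U i) (ob V (i-1)) (ob K i) (i1 i) (i2 i) (p1 i) (p2 i)) \<and>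
    (\<forall>i\<le>n. df K i \<in> Mor \<C> (ob K i) (ob K (i+1))) \<and>
    p1 1 \<cdot>\<^bsub>\<C>\<^esub> df K 0 = pneg \<C> (ob U 0) (ob U 1) (df U 0) \<and>
    p2 1 \<cdot>\<^bsub>\<C>\<^esub> df K 0 = g 0 \<and>
    (\<forall>i\<in>{1..<n}.
      p1 (i+1) \<cdot>\<^bsub>\<C>\<^esub> df K i \<cdot>\<^bsub>\<C>\<^esub> i1 i = pneg \<C> (ob U i) (ob U (i+1)) (df U i) \<and>
      p1 (i+1) \<cdot>\<^bsub>\<C>\<^esub> df K i \<cdot>\<^bsub>\<C>\<^esub> i2 i = zmor \<C> (ob V (i-1)) (ob U (i+1)) \<and>
      p2 (i+1) \<cdot>\<^bsub>\<C>\<^esub> df K i \<cdot>\<^bsub>\<C>\<^esub> i1 i = g i \<and>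
      p2 (i+1) \<cdot>\<^bsub>\<C>\<^esub> df K i \<cdot>\<^bsub>\<C>\<^esub> i2 i = df V (i-1)) \<and>
    df K n \<cdot>\<^bsub>\<C>\<^esub> i1 n = g n \<and>
    df K n \<cdot>\<^bsub>\<C>\<^esub> i2 n = df V (n-1))"

definition shift :: "('o, 'm) cplx \<Rightarrow> ('o, 'm) cplx" where
  "shift X = \<lparr>ob = (\<lambda>i. ob X (i+1)), df = (\<lambda>i. df X (i+1))\<rparr>"

(* X_1 -> X_2 + Y_1 -> ... -> X_{n+1} + Y_n -> Y_{n+1} *)
definition mapping_cone ::
  "nat \<Rightarrow> ('o, 'm, 'x) cat_scheme \<Rightarrow> ('o, 'm) cplx \<Rightarrow> ('o, 'm) cplx \<Rightarrow> (nat \<Rightarrow> 'm) \<Rightarrow>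
    ('o, 'm) cplx \<Rightarrow> bool" where
  "mapping_cone n \<C> X Y f M \<longleftrightarrow> cone_shaped n \<C> (shift X) (shift Y) (\<lambda>i. f (i+1)) M"

(* X_0 -> X_1 + Y_0 -> ... -> X_n + Y_{n-1} -> Y_n *)
definition mapping_cocone ::
  "nat \<Rightarrow> ('o, 'm, 'x) cat_scheme \<Rightarrow> ('o, 'm) cplx \<Rightarrow> ('o, 'm) cplx \<Rightarrow> (nat \<Rightarrow> 'm) \<Rightarrow>
    ('o, 'm) cplx \<Rightarrow> bool" where
  "mapping_cocone n \<C> X Y f N \<longleftrightarrow> cone_shaped n \<C> X Y f N"

(* The cone is determined only up to the choice of biproducts; EA2 and EA2_op refer to
   every choice.  As s takes whole homotopy classes as values, one choice would do. *)
locale n_exangulated_category = exact_realization n \<C> \<E> \<ss>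
  for n :: nat and \<C> :: "('o, 'm, 'x) cat_scheme" (structure)
    and \<E> :: "('o, 'm, 'e, 'y) bif_scheme" and \<ss> :: "('o, 'm, 'e) realization" +
  assumes EA1_inflation: "\<lbrakk>A \<in> Obj \<C>; B \<in> Obj \<C>; D \<in> Obj \<C>; f \<in> Mor \<C> A B; g \<in> Mor \<C> B D;
        inflation \<C> \<E> \<ss> f; inflation \<C> \<E> \<ss> g\<rbrakk> \<Longrightarrow> inflation \<C> \<E> \<ss> (g \<cdot> f)"
    and EA1_deflation: "\<lbrakk>A \<in> Obj \<C>; B \<in> Obj \<C>; D \<in> Obj \<C>; f \<in> Mor \<C> A B; g \<in> Mor \<C> B D;
        deflation n \<C> \<E> \<ss> f; deflation n \<C> \<E> \<ss> g\<rbrakk> \<Longrightarrow> deflation n \<C> \<E> \<ss> (g \<cdot> f)"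
    and EA2: "\<lbrakk>A \<in> Obj \<C>; C \<in> Obj \<C>; D \<in> Obj \<C>; \<rho> \<in> carrier (Ext \<E> D A); c \<in> Mor \<C> C D;
        X \<in> \<ss> C A (pull \<C> \<E> A c \<rho>); Y \<in> \<ss> D A \<rho>\<rbrakk>
        \<Longrightarrow> \<exists>f. chain_map n \<C> X Y f \<and> f 0 = ide \<C> A \<and> f (n+1) = c \<and>
              (\<forall>M. mapping_cone n \<C> X Y f M \<longrightarrow> M \<in> \<ss> D (ob X 1) (push \<C> \<E> D (df X 0) \<rho>))"
    and EA2_op: "\<lbrakk>A \<in> Obj \<C>; B \<in> Obj \<C>; C \<in> Obj \<C>; \<rho> \<in> carrier (Ext \<E> C A); a \<in> Mor \<C> A B;
        X \<in> \<ss> C A \<rho>; Y \<in> \<ss> C B (push \<C> \<E> C a \<rho>)\<rbrakk>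
        \<Longrightarrow> \<exists>f. chain_map n \<C> X Y f \<and> f 0 = a \<and> f (n+1) = ide \<C> C \<and>
              (\<forall>N. mapping_cocone n \<C> X Y f N \<longrightarrow>
                N \<in> \<ss> (ob Y n) A (pull \<C> \<E> A (df Y n) \<rho>))"

(* The empty direct sum is included, so a subcategory contains the zero objects. *)
definition additive_subcategory :: "('o, 'm, 'x) cat_scheme \<Rightarrow> 'o set \<Rightarrow> bool" where
  "additive_subcategory \<C> \<A> \<longleftrightarrow> \<A> \<subseteq> Obj \<C> \<and>
    (\<forall>A\<in>\<A>. \<forall>B\<in>Obj \<C>. isomorphic \<C> A B \<longrightarrow> B \<in> \<A>) \<and>
    (\<forall>m X S \<iota> \<pi>. direct_sum \<C> m X S \<iota> \<pi> \<and> (\<forall>k<m. X k \<in> \<A>) \<longrightarrow> S \<in> \<A>) \<and>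
    (\<forall>X Y S i1 i2 p1 p2. biproduct \<C> X Y S i1 i2 p1 p2 \<and> S \<in> \<A> \<longrightarrow> X \<in> \<A> \<and> Y \<in> \<A>)"

(* A bifunctor on C is also a bifunctor on the full subcategory: all axioms evaluate it only
   at objects and morphisms of the category in question. *)
definition full_subcategory :: "('o, 'm, 'x) cat_scheme \<Rightarrow> 'o set \<Rightarrow> ('o, 'm, 'x) cat_scheme" where
  "full_subcategory \<C> \<A> = \<C>\<lparr>Obj := \<A>\<rparr>"

definition n_extension_closed ::
  "nat \<Rightarrow> ('o, 'm, 'e, 'y) bif_scheme \<Rightarrow> ('o, 'm, 'e) realization \<Rightarrow> 'o set \<Rightarrow> bool" where
  "n_extension_closed n \<E> \<ss> \<A> \<longleftrightarrow>
    (\<forall>C\<in>\<A>. \<forall>A\<in>\<A>. \<forall>\<delta>\<in>carrier (Ext \<E> C A). \<exists>X\<in>\<ss> C A \<delta>. \<forall>i\<le>n+1. ob X i \<in> \<A>)"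

(* The definite description is meaningful only if the class does not depend on X. *)
definition restricted_realization ::
  "nat \<Rightarrow> ('o, 'm, 'x) cat_scheme \<Rightarrow> ('o, 'm, 'e) realization \<Rightarrow> 'o set \<Rightarrow>
    ('o, 'm, 'e) realization" where
  "restricted_realization n \<C> \<ss> \<A> C A \<delta> =
    (THE K. \<exists>X\<in>\<ss> C A \<delta>. (\<forall>i\<le>n+1. ob X i \<in> \<A>) \<and>
       K = homotopy_class n (full_subcategory \<C> \<A>) X)"

end

theory Submission
  imports Defs
begin

text \<open>The realization of the subcategory consists of the realizations in the ambient category all of
  whose terms lie in $\mathcal A$, so every axiom except (EA1) is inherited directly.

  For (EA1) let $f : A \to B$ and $g : B \to D$ be inflations of $\mathcal A$.  The composite $gf$ is an
  inflation of $\mathcal C$; let $\epsilon$ be realized by a complex starting with it.  The other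
  terms of this complex may lie outside $\mathcal A$, but $\epsilon$ is a
  pullback of some $\theta \in E(W, A)$ with $W$ in $\mathcal A$ and $(gf)_* \theta = 0$.  If $T$
  is a realization of $\theta$ in $\mathcal A$, then $gf$ and the inflation $A \to T_1$ factor through
  each other.  For $n \ge 2$ one may therefore exchange $T_1$ for $D$ without changing the homotopy
  class of $T$; this moves a direct summand $T_1$ out of $T_2 \oplus D$, which is possible since
  idempotents split.  For $n = 1$ the end of a realization of $gf$ is a direct summand of
  $W \oplus D$.  The statement on deflations is dual.\<close>

section \<open>Morphism calculus\<close>

text \<open>The obstacle is that (R1) gives exact sequences that stop at E(-, X_0) and at E(X_{n+1},
  -), while moving an extension into the subcategory means lifting extensions along the first
  differentials of a conflation. Two more places of exactness are therefore needed. Exactness at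
  E(-, X_0) comes from (EA2), applied to an extension whose end object is a biproduct. Exactness at
  E(-, X_1) comes from (EA1) in the ambient category together with the former; it yields the
  extension \<theta>, and its proof meets complexes whose terms need not lie in the subcategory.
  Extension closedness enters when the realization of a pushforward is chosen inside the
  subcategory: its last but one term is the main summand of W. Krull-Schmidt enters only through the
  splitting of idempotents. The splitting is obtained by an exchange argument inside the
  endomorphism ring of a single object, one local summand at a time, so that no partial direct sums
  have to be constructed.\<close>

context preadditive_category
begin

text \<open>A morphism determines its end objects, so the sum, the negative and the composability
  conditions can be stated without naming them.  This keeps the side conditions of the equations
  below within reach of the simplifier.\<close>

definition arr :: "'m \<Rightarrow> bool" where
  "arr f \<longleftrightarrow> (\<exists>A\<in>Obj \<C>. \<exists>B\<in>Obj \<C>. f \<in> Mor \<C> A B)"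

definition dom :: "'m \<Rightarrow> 'o" where
  "dom f = (THE A. A \<in> Obj \<C> \<and> (\<exists>B\<in>Obj \<C>. f \<in> Mor \<C> A B))"

definition cod :: "'m \<Rightarrow> 'o" where
  "cod f = (THE B. B \<in> Obj \<C> \<and> (\<exists>A\<in>Obj \<C>. f \<in> Mor \<C> A B))"

definition mor :: "'m \<Rightarrow> 'o \<Rightarrow> 'o \<Rightarrow> bool" where
  "mor f A B \<longleftrightarrow> A \<in> Obj \<C> \<and> B \<in> Obj \<C> \<and> arr f \<and> dom f = A \<and> cod f = B"

definition plus :: "'m \<Rightarrow> 'm \<Rightarrow> 'm" (infixl \<open>\<boxplus>\<close> 65) where
  "f \<boxplus> g = padd \<C> (dom f) (cod f) f g"

definition neg :: "'m \<Rightarrow> 'm" (\<open>\<boxminus> _\<close> [75] 75) where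
  "\<boxminus> f = pneg \<C> (dom f) (cod f) f"

lemma dom_eq: "\<lbrakk>A \<in> Obj \<C>; B \<in> Obj \<C>; f \<in> Mor \<C> A B\<rbrakk> \<Longrightarrow> dom f = A"
  unfolding dom_def using Mor_disjoint by (intro the_equality) blast+

lemma cod_eq: "\<lbrakk>A \<in> Obj \<C>; B \<in> Obj \<C>; f \<in> Mor \<C> A B\<rbrakk> \<Longrightarrow> cod f = B"
  unfolding cod_def using Mor_disjoint by (intro the_equality) blast+

lemma mor_iff: "mor f A B \<longleftrightarrow> A \<in> Obj \<C> \<and> B \<in> Obj \<C> \<and> f \<in> Mor \<C> A B"
  unfolding mor_def arr_def using dom_eq cod_eq by metis

lemma morI: "\<lbrakk>A \<in> Obj \<C>; B \<in> Obj \<C>; f \<in> Mor \<C> A B\<rbrakk> \<Longrightarrow> mor f A B"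
  by (simp add: mor_iff)

lemma mor_Mor: "mor f A B \<Longrightarrow> f \<in> Mor \<C> A B"
  by (simp add: mor_iff)

lemma arr_dom_in [simp]: "arr f \<Longrightarrow> dom f \<in> Obj \<C>"
  and arr_cod_in [simp]: "arr f \<Longrightarrow> cod f \<in> Obj \<C>"
  unfolding arr_def using dom_eq cod_eq by auto

lemma arr_mor: "arr f \<Longrightarrow> mor f (dom f) (cod f)"
  by (simp add: mor_def)

lemma arr_Mor: "arr f \<Longrightarrow> f \<in> Mor \<C> (dom f) (cod f)"
  using arr_mor mor_Mor by blast

lemma in_Mor [simp]: "\<lbrakk>arr f; dom f = A; cod f = B\<rbrakk> \<Longrightarrow> f \<in> Mor \<C> A B"
  using arr_Mor by blast

lemma padd_plus: "\<lbrakk>arr f; dom f = A; cod f = B\<rbrakk> \<Longrightarrow> padd \<C> A B f g = f \<boxplus> g"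
  by (simp add: plus_def)

lemma pneg_neg: "\<lbrakk>arr f; dom f = A; cod f = B\<rbrakk> \<Longrightarrow> pneg \<C> A B f = \<boxminus> f"
  by (simp add: neg_def)

lemma mor_cmp: "\<lbrakk>mor f A B; mor g B D\<rbrakk> \<Longrightarrow> mor (g \<cdot> f) A D"
  using cmp_in by (auto simp: mor_iff)

lemma mor_ide: "A \<in> Obj \<C> \<Longrightarrow> mor (ide \<C> A) A A"
  by (simp add: mor_iff ide_in)

lemma mor_zero: "\<lbrakk>A \<in> Obj \<C>; B \<in> Obj \<C>\<rbrakk> \<Longrightarrow> mor (zmor \<C> A B) A B"
  using Hom_comm_group[of A B] by (simp add: mor_iff comm_group_def group.is_monoid monoid.one_closed)

lemma mor_plus: "\<lbrakk>mor f A B; mor g A B\<rbrakk> \<Longrightarrow> mor (f \<boxplus> g) A B"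
  using Hom_comm_group[of A B] 
  by (metis mor_def mor_iff padd_plus comm_group.axioms(2) group.is_monoid monoid.m_closed)

lemma mor_neg: "mor f A B \<Longrightarrow> mor (\<boxminus> f) A B"
  using Hom_comm_group[of A B] 
  by (metis mor_def mor_iff pneg_neg comm_group.axioms(2) group.inv_closed)

lemma cmp_arr [simp]:
  assumes "arr f" "arr g" "cod f = dom g"
  shows "arr (g \<cdot> f)" "dom (g \<cdot> f) = dom f" "cod (g \<cdot> f) = cod g"
  using mor_cmp[of f "dom f" "cod f" g "cod g"] assms by (auto simp: mor_def)

lemma ide_arr [simp]:
  assumes "A \<in> Obj \<C>"
  shows "arr (ide \<C> A)" "dom (ide \<C> A) = A" "cod (ide \<C> A) = A"
  using mor_ide[OF assms] by (auto simp: mor_def)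

lemma zero_arr [simp]:
  assumes "A \<in> Obj \<C>" "B \<in> Obj \<C>"
  shows "arr (zmor \<C> A B)" "dom (zmor \<C> A B) = A" "cod (zmor \<C> A B) = B"
  using mor_zero[OF assms] by (auto simp: mor_def)

lemma plus_arr [simp]:
  assumes "arr f" "arr g" "dom f = dom g" "cod f = cod g"
  shows "arr (f \<boxplus> g)" "dom (f \<boxplus> g) = dom f" "cod (f \<boxplus> g) = cod f"
  using mor_plus[of f "dom f" "cod f" g] assms by (auto simp: mor_def)

lemma neg_arr [simp]:
  assumes "arr f"
  shows "arr (\<boxminus> f)" "dom (\<boxminus> f) = dom f" "cod (\<boxminus> f) = cod f"
  using mor_neg[of f "dom f" "cod f"] assms by (auto simp: mor_def)

lemma assoc [simp]: "\<lbrakk>arr f; arr g; arr h; cod f = dom g; cod g = dom h\<rbrakk> \<Longrightarrow> h \<cdot> g \<cdot> f = h \<cdot> (g \<cdot> f)"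
  by (rule cmp_assoc[of "dom f" "cod f" "cod g" "cod h"]) auto

lemma ide_right [simp]: "\<lbrakk>arr f; dom f = A\<rbrakk> \<Longrightarrow> f \<cdot> ide \<C> A = f"
  and ide_left [simp]: "\<lbrakk>arr f; cod f = A\<rbrakk> \<Longrightarrow> ide \<C> A \<cdot> f = f"
  using cmp_ide_right[of "dom f" "cod f"] cmp_ide_left[of "dom f" "cod f"] by auto

lemma group_Hom: "\<lbrakk>A \<in> Obj \<C>; B \<in> Obj \<C>\<rbrakk> \<Longrightarrow> group (Hom \<C> A B)"
  using Hom_comm_group comm_group.axioms(2) by blast

lemma plus_comm: "\<lbrakk>arr f; arr g; dom f = dom g; cod f = cod g\<rbrakk> \<Longrightarrow> f \<boxplus> g = g \<boxplus> f"
  using Hom_comm_group[of "dom f" "cod f"] unfolding plus_def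
  by (metis arr_Mor arr_cod_in arr_dom_in comm_group_def comm_monoid.m_comm)

lemma plus_assoc: "\<lbrakk>arr f; arr g; arr h; dom f = dom g; cod f = cod g; dom g = dom h; cod g = cod h\<rbrakk>
    \<Longrightarrow> f \<boxplus> g \<boxplus> h = f \<boxplus> (g \<boxplus> h)"
  using group_Hom[of "dom f" "cod f"] plus_arr[of f g]
  by (simp add: plus_def) (metis arr_Mor group.is_monoid monoid.m_assoc)

lemma plus_lcomm: "\<lbrakk>arr f; arr g; arr h; dom f = dom g; cod f = cod g; dom g = dom h; cod g = cod h\<rbrakk>
    \<Longrightarrow> f \<boxplus> (g \<boxplus> h) = g \<boxplus> (f \<boxplus> h)"
  by (metis plus_assoc plus_comm)

lemmas plus_ac = plus_comm plus_assoc plus_lcomm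

lemma plus_zero_right [simp]: "\<lbrakk>arr f; dom f = A; cod f = B\<rbrakk> \<Longrightarrow> f \<boxplus> zmor \<C> A B = f"
  using group_Hom[of A B] unfolding plus_def
  by (metis arr_Mor arr_cod_in arr_dom_in group.is_monoid monoid.r_one)

lemma plus_zero_left [simp]: "\<lbrakk>arr f; dom f = A; cod f = B\<rbrakk> \<Longrightarrow> zmor \<C> A B \<boxplus> f = f"
  using plus_comm[of "zmor \<C> A B" f] arr_dom_in[of f] arr_cod_in[of f] by simp

lemma plus_neg_right [simp]: "arr f \<Longrightarrow> f \<boxplus> \<boxminus> f = zmor \<C> (dom f) (cod f)"
  using group_Hom[of "dom f" "cod f"] unfolding plus_def neg_def
  by (simp add: arr_Mor group.r_inv)

lemma plus_neg_left [simp]: "arr f \<Longrightarrow> \<boxminus> f \<boxplus> f = zmor \<C> (dom f) (cod f)"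
  using plus_comm[of f "\<boxminus> f"] by simp

lemma plus_neg_cancel [simp]:
  assumes "arr f" "arr g" "dom f = dom g" "cod f = cod g"
  shows "f \<boxplus> (\<boxminus> f \<boxplus> g) = g" "\<boxminus> f \<boxplus> (f \<boxplus> g) = g"
  using assms by (simp_all flip: plus_assoc)

lemma plus_cancel:
  assumes "f \<boxplus> h = g \<boxplus> h" "arr f" "arr g" "arr h" "dom f = dom g" "cod f = cod g" "dom g = dom h" "cod g = cod h"
  shows "f = g"
proof -
  have "f \<boxplus> h \<boxplus> \<boxminus> h = f" "g \<boxplus> h \<boxplus> \<boxminus> h = g"
    using assms(2-) by (simp_all add: plus_assoc)
  then show ?thesis using assms(1) by metis
qed

lemma neg_unique:
  assumes "f \<boxplus> g = zmor \<C> (dom f) (cod f)" "arr f" "arr g" "dom f = dom g" "cod f = cod g"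
  shows "g = \<boxminus> f"
  by (rule plus_cancel[of _ f]) (use assms in \<open>simp_all add: plus_comm[of g f]\<close>)

lemma neg_neg [simp]: "arr f \<Longrightarrow> \<boxminus> (\<boxminus> f) = f"
  using neg_unique[of "\<boxminus> f" f] by simp

lemma neg_zero [simp]: "\<lbrakk>A \<in> Obj \<C>; B \<in> Obj \<C>\<rbrakk> \<Longrightarrow> \<boxminus> (zmor \<C> A B) = zmor \<C> A B"
  using neg_unique[of "zmor \<C> A B" "zmor \<C> A B"] by simp

lemma neg_plus [simp]:
  "\<lbrakk>arr f; arr g; dom f = dom g; cod f = cod g\<rbrakk> \<Longrightarrow> \<boxminus> (f \<boxplus> g) = \<boxminus> f \<boxplus> \<boxminus> g"
  by (rule neg_unique[symmetric]) (simp_all add: plus_ac)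

lemma cmp_plus_right [simp]:
  assumes "arr f" "arr g" "arr h" "dom f = dom g" "cod f = cod g" "cod g = dom h"
  shows "h \<cdot> (f \<boxplus> g) = h \<cdot> f \<boxplus> h \<cdot> g"
  using postcomp_hom[of "dom f" "cod f" "cod h" h] assms arr_Mor[of f] arr_Mor[of g] arr_Mor[of h]
  by (simp add: hom_def plus_def)

lemma cmp_plus_left [simp]:
  assumes "arr f" "arr g" "arr h" "dom f = dom g" "cod f = cod g" "cod h = dom g"
  shows "(f \<boxplus> g) \<cdot> h = f \<cdot> h \<boxplus> g \<cdot> h"
  using precomp_hom[of "dom h" "cod h" "cod f" h] assms arr_Mor[of f] arr_Mor[of g] arr_Mor[of h]
  by (simp add: hom_def plus_def)

lemma cmp_zero_right [simp]:
  assumes "arr h" "dom h = B" "A \<in> Obj \<C>"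
  shows "h \<cdot> zmor \<C> A B = zmor \<C> A (cod h)"
proof (rule plus_cancel)
  show "h \<cdot> zmor \<C> A B \<boxplus> h \<cdot> zmor \<C> A B = zmor \<C> A (cod h) \<boxplus> h \<cdot> zmor \<C> A B"
    using assms arr_dom_in[of h] by (subst cmp_plus_right[symmetric]) auto
qed (use assms in auto)

lemma cmp_zero_left [simp]:
  assumes "arr h" "cod h = A" "B \<in> Obj \<C>"
  shows "zmor \<C> A B \<cdot> h = zmor \<C> (dom h) B"
proof (rule plus_cancel)
  show "zmor \<C> A B \<cdot> h \<boxplus> zmor \<C> A B \<cdot> h = zmor \<C> (dom h) B \<boxplus> zmor \<C> A B \<cdot> h"
    using assms arr_cod_in[of h] by (subst cmp_plus_left[symmetric]) auto
qed (use assms in auto)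

lemma cmp_neg_right [simp]:
  assumes "arr f" "arr h" "cod f = dom h"
  shows "h \<cdot> (\<boxminus> f) = \<boxminus> (h \<cdot> f)"
proof (rule neg_unique)
  show "h \<cdot> f \<boxplus> h \<cdot> (\<boxminus> f) = zmor \<C> (dom (h \<cdot> f)) (cod (h \<cdot> f))"
    using assms cmp_plus_right[of f "\<boxminus> f" h] by simp
qed (use assms in auto)

lemma cmp_neg_left [simp]:
  assumes "arr f" "arr h" "cod f = dom h"
  shows "(\<boxminus> h) \<cdot> f = \<boxminus> (h \<cdot> f)"
proof (rule neg_unique)
  show "h \<cdot> f \<boxplus> (\<boxminus> h) \<cdot> f = zmor \<C> (dom (h \<cdot> f)) (cod (h \<cdot> f))"
    using assms cmp_plus_left[of h "\<boxminus> h" f] by simp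
qed (use assms in auto)

text \<open>Ordered rewriting does not bring a summand next to its negative, so these cancellation rules
  reach over other summands.\<close>

lemma plus_cancel_over:
  assumes "arr f" "arr g" "dom g = dom f" "cod g = cod f"
  shows "f \<boxplus> (g \<boxplus> \<boxminus> f) = g" "\<boxminus> f \<boxplus> (g \<boxplus> f) = g"
  using assms by (subst plus_lcomm; simp)+

lemma plus_cancel_over':
  assumes "arr f" "arr g" "arr h" "dom g = dom f" "cod g = cod f" "dom h = dom f" "cod h = cod f"
  shows "f \<boxplus> (g \<boxplus> (\<boxminus> f \<boxplus> h)) = g \<boxplus> h" "\<boxminus> f \<boxplus> (g \<boxplus> (f \<boxplus> h)) = g \<boxplus> h"
    "f \<boxplus> (g \<boxplus> (h \<boxplus> \<boxminus> f)) = g \<boxplus> h" "\<boxminus> f \<boxplus> (g \<boxplus> (h \<boxplus> f)) = g \<boxplus> h"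
  using assms by (subst plus_lcomm; simp add: plus_cancel_over)+

lemma plus_cancel_over'':
  assumes "arr f" "arr g" "arr h" "arr k" "dom g = dom f" "cod g = cod f" "dom h = dom f" "cod h = cod f"
    "dom k = dom f" "cod k = cod f"
  shows "f \<boxplus> (g \<boxplus> (h \<boxplus> (\<boxminus> f \<boxplus> k))) = g \<boxplus> (h \<boxplus> k)" "\<boxminus> f \<boxplus> (g \<boxplus> (h \<boxplus> (f \<boxplus> k))) = g \<boxplus> (h \<boxplus> k)"
  using assms plus_cancel_over'[of f "g \<boxplus> h" k] by (simp_all add: plus_assoc)

lemmas plus_normal = plus_ac plus_cancel_over plus_cancel_over' plus_cancel_over''

text \<open>The simp rule \<open>assoc\<close> brackets composites to the right, so an equation for
  \<open>h \<cdot> g\<close> no longer matches inside a longer composite. Applied with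
  \<open>THEN\<close>, this rule produces the variant that carries a tail.\<close>

lemma cmp_extend:
  "\<lbrakk>h \<cdot> g = k; arr f; arr g; arr h; cod f = dom g; cod g = dom h\<rbrakk> \<Longrightarrow> h \<cdot> (g \<cdot> f) = k \<cdot> f"
  by auto

lemma diff_eq_zero_iff:
  assumes "arr f" "arr g" "dom f = dom g" "cod f = cod g"
  shows "f \<boxplus> \<boxminus> g = zmor \<C> (dom f) (cod f) \<longleftrightarrow> f = g"
proof
  assume "f \<boxplus> \<boxminus> g = zmor \<C> (dom f) (cod f)"
  then have "\<boxminus> g = \<boxminus> f" by (rule neg_unique) (use assms in simp_all)
  then have "\<boxminus> (\<boxminus> g) = \<boxminus> (\<boxminus> f)" by simp
  then show "f = g" using assms by simp
qed (use assms in simp)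

end

section \<open>Splitting idempotents in Krull-Schmidt categories\<close>

context preadditive_category
begin

lemma biproduct_iff:
  "biproduct \<C> X Y S i1 i2 p1 p2 \<longleftrightarrow>
    mor i1 X S \<and> mor i2 Y S \<and> mor p1 S X \<and> mor p2 S Y \<and>
    p1 \<cdot> i1 = ide \<C> X \<and> p2 \<cdot> i2 = ide \<C> Y \<and> p1 \<cdot> i2 = zmor \<C> Y X \<and> p2 \<cdot> i1 = zmor \<C> X Y \<and>
    i1 \<cdot> p1 \<boxplus> i2 \<cdot> p2 = ide \<C> S"
proof -
  have "padd \<C> S S (i1 \<cdot> p1) (i2 \<cdot> p2) = i1 \<cdot> p1 \<boxplus> i2 \<cdot> p2"
    if "mor i1 X S" "mor i2 Y S" "mor p1 S X" "mor p2 S Y"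
    using that by (simp add: padd_plus mor_def)
  then show ?thesis unfolding biproduct_def by (auto simp: mor_iff)
qed

definition splits :: "'m \<Rightarrow> bool" where
  "splits e \<longleftrightarrow> (\<exists>K i p. mor i K (dom e) \<and> mor p (dom e) K \<and> p \<cdot> i = ide \<C> K \<and> i \<cdot> p = e)"

lemma zero_object_ide:
  assumes "zero_object \<C> Z"
  shows "Z \<in> Obj \<C>" "ide \<C> Z = zmor \<C> Z Z"
proof -
  show Z: "Z \<in> Obj \<C>" using assms by (simp add: zero_object_def)
  then have "\<exists>!f. f \<in> Mor \<C> Z Z" using assms by (simp add: zero_object_def)
  moreover have "ide \<C> Z \<in> Mor \<C> Z Z" "zmor \<C> Z Z \<in> Mor \<C> Z Z" using Z by auto
  ultimately show "ide \<C> Z = zmor \<C> Z Z" by blast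
qed

text \<open>The complement is the image of 1 - ip. The mixed composites vanish because p(jq)j is pj
  by qj = 1 and zero by jq = 1 - ip; q(jq)i is treated in the same way.\<close>

lemma complement_of_retract:
  assumes "mor i X S" "mor p S X" "p \<cdot> i = ide \<C> X" "splits (ide \<C> S \<boxplus> \<boxminus> (i \<cdot> p))"
  shows "\<exists>K j q. biproduct \<C> X K S i j p q"
proof -
  note A = assms(1,2)[unfolded mor_def]
  obtain K j q where B: "mor j K S" "mor q S K" "q \<cdot> j = ide \<C> K" and jq: "j \<cdot> q = ide \<C> S \<boxplus> \<boxminus> (i \<cdot> p)"
    using assms(4) A by (auto simp: splits_def)
  note B' = B(1,2)[unfolded mor_def]
  have "p \<cdot> (j \<cdot> q) \<cdot> j = zmor \<C> K X"
    unfolding jq using A B' assms(3)[THEN cmp_extend] by simp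
  then have pj: "p \<cdot> j = zmor \<C> K X" using A B' B(3) by simp
  have "q \<cdot> (j \<cdot> q) \<cdot> i = zmor \<C> X K"
    unfolding jq using A B' assms(3) by simp
  then have qi: "q \<cdot> i = zmor \<C> X K" using A B' B(3)[THEN cmp_extend] by simp
  have "i \<cdot> p \<boxplus> j \<cdot> q = ide \<C> S"
    unfolding jq using A by (simp add: plus_normal)
  then show ?thesis unfolding biproduct_iff using assms(1-3) B pj qi by blast
qed

end

context additive_category
begin

text \<open>Orthogonality forces pj = 0 and qi = 0, so the sum splits through the biproduct of the
  two images.\<close>

lemma splits_plus:
  assumes "mor a S S" "mor b S S" "splits a" "splits b" "a \<cdot> b = zmor \<C> S S" "b \<cdot> a = zmor \<C> S S"
  shows "splits (a \<boxplus> b)"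
proof -
  obtain K i p where A: "mor i K S" "mor p S K" "p \<cdot> i = ide \<C> K" "i \<cdot> p = a"
    using assms by (auto simp: splits_def mor_def)
  obtain L j q where B: "mor j L S" "mor q S L" "q \<cdot> j = ide \<C> L" "j \<cdot> q = b"
    using assms by (auto simp: splits_def mor_def)
  note M = A(1,2)[unfolded mor_def] B(1,2)[unfolded mor_def]
  have "p \<cdot> j = p \<cdot> (i \<cdot> p) \<cdot> (j \<cdot> q) \<cdot> j"
    using M A(3)[THEN cmp_extend] B(3) by simp
  also have "\<dots> = zmor \<C> L K" 
    using M assms(1,2) assms(5)[THEN cmp_extend] unfolding A(4) B(4) by (simp add: mor_def)
  finally have pj: "p \<cdot> j = zmor \<C> L K" .
  have "q \<cdot> i = q \<cdot> (j \<cdot> q) \<cdot> (i \<cdot> p) \<cdot> i"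
    using M B(3)[THEN cmp_extend] A(3) by simp
  also have "\<dots> = zmor \<C> K L" 
    using M assms(1,2) assms(6)[THEN cmp_extend] unfolding A(4) B(4) by (simp add: mor_def)
  finally have qi: "q \<cdot> i = zmor \<C> K L" .
  obtain T i1 i2 p1 p2 where "biproduct \<C> K L T i1 i2 p1 p2"
    using ex_biproduct M by blast
  note T = this[unfolded biproduct_iff]
  note T' = T[unfolded mor_def]
  let ?i = "i \<cdot> p1 \<boxplus> j \<cdot> p2" and ?p = "i1 \<cdot> p \<boxplus> i2 \<cdot> q"
  have "?p \<cdot> ?i = ide \<C> T"
    using M T' A(3)[THEN cmp_extend] B(3)[THEN cmp_extend] pj[THEN cmp_extend] qi[THEN cmp_extend] by simp
  moreover have "?i \<cdot> ?p = a \<boxplus> b"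
    using M T' A(4) B(4) assms(1,2)[unfolded mor_def] by (simp add: cmp_extend[of p1 i1] cmp_extend[of p2 i2] cmp_extend[of p1 i2] cmp_extend[of p2 i1])
  moreover have "mor ?i T S" "mor ?p S T" using M T' by (auto simp: mor_def)
  moreover have "dom (a \<boxplus> b) = S" using assms(1,2) by (simp add: mor_def)
  ultimately show ?thesis unfolding splits_def by metis
qed

text \<open>Here $x \le e - ip$, and $j$ and $q$ identify the corner of $e - ip$ with that of $e'$.\<close>

lemma splits_below:
  assumes M: "mor e X X" "mor e' X X" "mor \<iota> Y X" "mor \<pi> X Y" "mor i Y X" "mor p X Y" "mor w Y Y" "mor w' Y Y" "mor x X X"
    and e: "e = e' \<boxplus> \<iota> \<cdot> \<pi>" "e' \<cdot> e' = e'" "e' \<cdot> \<iota> = zmor \<C> Y X" "\<pi> \<cdot> e' = zmor \<C> X Y" "\<pi> \<cdot> \<iota> = ide \<C> Y"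
    and i: "e \<cdot> i = i" "p \<cdot> e = p" "p \<cdot> i = ide \<C> Y" "\<pi> \<cdot> i = w" "w \<cdot> w' = ide \<C> Y" "w' \<cdot> w = ide \<C> Y"
    and x: "x \<cdot> x = x" "e \<cdot> x = x" "x \<cdot> e = x" "x \<cdot> i = zmor \<C> Y X" "p \<cdot> x = zmor \<C> X Y"
    and IH: "\<And>b. \<lbrakk>mor b X X; b \<cdot> b = b; e' \<cdot> b = b; b \<cdot> e' = b\<rbrakk> \<Longrightarrow> splits b"
  shows "splits x"
proof -
  note M' = M[unfolded mor_def]
  \<comment> \<open>j is (e - ip)e'. The morphism q turns out to be e - i w' \<pi>, where i w' \<pi>
    is the idempotent with the image of i and the kernel of \<pi>; so q projects onto the image of
    e' along i. The identities jq = e - ip and qj = e' below say that j and q are mutually inverse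
    between the two corners.\<close>
  define j where "j = e' \<boxplus> \<boxminus> (i \<cdot> (p \<cdot> e'))"
  define q where "q = e' \<boxplus> \<boxminus> (e' \<cdot> (i \<cdot> (w' \<cdot> \<pi>)))"
  have mj: "mor j X X" and mq: "mor q X X" using M' by (auto simp: mor_def j_def q_def)
  note N = mj[unfolded mor_def] mq[unfolded mor_def] M'
  have "e' \<cdot> i = e \<cdot> i \<boxplus> \<boxminus> (\<iota> \<cdot> (\<pi> \<cdot> i))" unfolding e(1) using M' by (simp add: plus_normal)
  then have e'i: "e' \<cdot> i = i \<boxplus> \<boxminus> (\<iota> \<cdot> w)" by (simp add: i)
  have pe': "p \<cdot> e' = p \<boxplus> \<boxminus> (p \<cdot> (\<iota> \<cdot> \<pi>))"
  proof -
    have "p \<cdot> e' = p \<cdot> e \<boxplus> \<boxminus> (p \<cdot> (\<iota> \<cdot> \<pi>))" unfolding e(1) using M' by (simp add: plus_normal)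
    then show ?thesis by (simp add: i)
  qed
  have qe: "e' \<cdot> q = q" and je: "j \<cdot> e' = j"
    unfolding q_def j_def using M' e(2) e(2)[THEN cmp_extend] by simp_all
  have "q = e' \<boxplus> \<boxminus> ((e' \<cdot> i) \<cdot> (w' \<cdot> \<pi>))" unfolding q_def using M' by simp
  also have "\<dots> = e \<boxplus> \<boxminus> (i \<cdot> (w' \<cdot> \<pi>))"
    unfolding e'i e(1) using M' i(5)[THEN cmp_extend] by (simp add: plus_normal)
  finally have q: "q = e \<boxplus> \<boxminus> (i \<cdot> (w' \<cdot> \<pi>))" .
  have pq: "p \<cdot> q = p \<boxplus> \<boxminus> (w' \<cdot> \<pi>)"
    unfolding q using M' i(2) i(3)[THEN cmp_extend] by simp
  have "j \<cdot> q = (e' \<cdot> q) \<boxplus> \<boxminus> (i \<cdot> (p \<cdot> (e' \<cdot> q)))" 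
    unfolding j_def using N by simp
  also have "\<dots> = q \<boxplus> \<boxminus> (i \<cdot> (p \<cdot> q))" by (simp add: qe)
  also have "\<dots> = e \<boxplus> \<boxminus> (i \<cdot> p)" 
    unfolding pq unfolding q using M' by (simp add: plus_normal)
  finally have jq: "j \<cdot> q = e \<boxplus> \<boxminus> (i \<cdot> p)" .
  have jqx: "j \<cdot> (q \<cdot> x) = x"
    using jq[THEN cmp_extend, of x] N x by simp
  have xjq: "x \<cdot> (j \<cdot> q) = x"
    unfolding jq using N x(3) x(4)[THEN cmp_extend] by simp
  \<comment> \<open>x is transported to an idempotent b below e', where the induction hypothesis
    applies. A splitting of b is then carried back along j and q.\<close>
  define b where "b = q \<cdot> (x \<cdot> j)"
  have mb: "mor b X X" using N by (simp add: b_def mor_def)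
  have "b \<cdot> b = q \<cdot> ((x \<cdot> (j \<cdot> q)) \<cdot> (x \<cdot> j))" unfolding b_def using N by simp
  then have "b \<cdot> b = b" unfolding xjq b_def using N x(1)[THEN cmp_extend] by simp
  moreover have "e' \<cdot> b = b" unfolding b_def using N qe[THEN cmp_extend] by simp
  moreover have "b \<cdot> e' = b" unfolding b_def using N je by simp
  ultimately have "splits b" using IH mb by blast
  then obtain K k r where K: "mor k K X" "mor r X K" "r \<cdot> k = ide \<C> K" "k \<cdot> r = b"
    using mb by (auto simp: splits_def mor_def)
  note K' = K(1,2)[unfolded mor_def]
  have 1: "mor (j \<cdot> k) K X" "mor (r \<cdot> q) X K" using N K' by (auto simp: mor_def)
  have "(j \<cdot> k) \<cdot> (r \<cdot> q) = j \<cdot> (k \<cdot> r) \<cdot> q" using N K' by simp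
  also have "\<dots> = j \<cdot> (q \<cdot> (x \<cdot> (j \<cdot> q)))" unfolding K(4) b_def using N by simp
  also have "\<dots> = x" unfolding xjq by (rule jqx)
  finally have 2: "(j \<cdot> k) \<cdot> (r \<cdot> q) = x" .
  have "q \<cdot> j = q \<cdot> e' \<boxplus> \<boxminus> ((q \<cdot> i) \<cdot> (p \<cdot> e'))" unfolding j_def using N by simp
  also have "q \<cdot> i = zmor \<C> Y X"
    unfolding q using M' i by simp
  also have "q \<cdot> e' = e'" unfolding q_def using M' e by simp
  finally have qj: "q \<cdot> j = e'" using M' by simp
  have "b \<cdot> (e' \<cdot> b) = b" using \<open>b \<cdot> b = b\<close> \<open>e' \<cdot> b = b\<close> by simp
  then have "r \<cdot> (k \<cdot> r) \<cdot> (e' \<cdot> ((k \<cdot> r) \<cdot> k)) = r \<cdot> (k \<cdot> r) \<cdot> k"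
    unfolding K(4) using mb N K' by (simp add: mor_def) (metis assoc cmp_arr)
  then have "r \<cdot> (e' \<cdot> k) = ide \<C> K" using K(3) K(3)[THEN cmp_extend] K' N by simp
  moreover have "(r \<cdot> q) \<cdot> (j \<cdot> k) = r \<cdot> ((q \<cdot> j) \<cdot> k)" using N K' by simp
  ultimately have 3: "(r \<cdot> q) \<cdot> (j \<cdot> k) = ide \<C> K" by (simp add: qj)
  show ?thesis unfolding splits_def using 1 2 3 N by blast
qed

text \<open>The unit 1 is not a sum of two non-units. This decides which of two complementary
  idempotents contains a copy of Y.\<close>

lemma local_ring_unit:
  assumes "mor a Y Y" "mor b Y Y" "a \<boxplus> b = ide \<C> Y" "local_ring (End_ring \<C> Y)"
  shows "(\<exists>w. mor w Y Y \<and> w \<cdot> a = ide \<C> Y \<and> a \<cdot> w = ide \<C> Y) \<or> (\<exists>w. mor w Y Y \<and> w \<cdot> b = ide \<C> Y \<and> b \<cdot> w = ide \<C> Y)"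
proof -
  have Y: "Y \<in> Obj \<C>" using assms by (simp add: mor_def)
  have "ide \<C> Y \<in> Units (End_ring \<C> Y)"
    using Y by (auto simp: Units_def End_ring_def intro!: bexI[of _ "ide \<C> Y"])
  moreover have "a \<oplus>\<^bsub>End_ring \<C> Y\<^esub> b = ide \<C> Y"
    using assms(1-3) by (simp add: End_ring_def mor_def padd_plus)
  moreover have "a \<in> carrier (End_ring \<C> Y)" "b \<in> carrier (End_ring \<C> Y)"
    using assms(1,2) by (auto simp: End_ring_def mor_def)
  ultimately have "a \<in> Units (End_ring \<C> Y) \<or> b \<in> Units (End_ring \<C> Y)"
    using assms(4) unfolding local_ring_def by (metis DiffI)
  then show ?thesis using Y by (auto simp: Units_def End_ring_def mor_iff)
qed

text \<open>With e = e' + \<iota>\<pi>, the compressions of a and of e - a to the local summand Y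
  add up to 1, so one of them is invertible. Either a or e - a then contains a copy of Y, which can
  be exchanged for the summand \<iota>\<pi>; what remains is controlled by e'.\<close>

lemma splits_step:
  assumes M: "mor e' X X" "mor \<iota> Y X" "mor \<pi> X Y" "mor a X X"
    and e: "e' \<cdot> e' = e'" "e' \<cdot> \<iota> = zmor \<C> Y X" "\<pi> \<cdot> e' = zmor \<C> X Y" "\<pi> \<cdot> \<iota> = ide \<C> Y"
    and a: "a \<cdot> a = a" "(e' \<boxplus> \<iota> \<cdot> \<pi>) \<cdot> a = a" "a \<cdot> (e' \<boxplus> \<iota> \<cdot> \<pi>) = a"
    and local: "local_ring (End_ring \<C> Y)"
    and IH: "\<And>b. \<lbrakk>mor b X X; b \<cdot> b = b; e' \<cdot> b = b; b \<cdot> e' = b\<rbrakk> \<Longrightarrow> splits b"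
  shows "splits a"
proof -
  define e where e_def: "e = e' \<boxplus> \<iota> \<cdot> \<pi>"
  note M' = M[unfolded mor_def]
  have me: "mor e X X" using M' by (simp add: e_def mor_def)
  have ee: "e \<cdot> e = e" unfolding e_def using M' e e(2)[THEN cmp_extend] e(4)[THEN cmp_extend] by simp
  have e\<iota>: "e \<cdot> \<iota> = \<iota>" and \<pi>e: "\<pi> \<cdot> e = \<pi>" unfolding e_def using M' e e(4)[THEN cmp_extend] by simp_all
  note a' = a[folded e_def]
  note N = M' me[unfolded mor_def]
  define a1 where "a1 = e \<boxplus> \<boxminus> a"
  have ma1: "mor a1 X X" using N by (simp add: a1_def mor_def)
  have a1: "a1 \<cdot> a1 = a1" "e \<cdot> a1 = a1" "a1 \<cdot> e = a1" "a1 \<cdot> a = zmor \<C> X X" "a \<cdot> a1 = zmor \<C> X X"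
    unfolding a1_def using N a' ee by (simp_all add: plus_normal)
  have "\<pi> \<cdot> (a \<cdot> \<iota>) \<boxplus> \<pi> \<cdot> (a1 \<cdot> \<iota>) = ide \<C> Y"
    unfolding a1_def using N e\<iota> e by (simp add: plus_normal)
  then consider (1) w where "mor w Y Y" "w \<cdot> (\<pi> \<cdot> (a \<cdot> \<iota>)) = ide \<C> Y" "(\<pi> \<cdot> (a \<cdot> \<iota>)) \<cdot> w = ide \<C> Y"
    | (2) w where "mor w Y Y" "w \<cdot> (\<pi> \<cdot> (a1 \<cdot> \<iota>)) = ide \<C> Y" "(\<pi> \<cdot> (a1 \<cdot> \<iota>)) \<cdot> w = ide \<C> Y"
    using local_ring_unit[of "\<pi> \<cdot> (a \<cdot> \<iota>)" Y "\<pi> \<cdot> (a1 \<cdot> \<iota>)"] local N ma1 by (auto simp: mor_def)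
  then show ?thesis
  proof cases
    \<comment> \<open>The copy of Y lies in a. Splitting it off leaves x = a - ip, which is
      orthogonal to ip and handled by \<open>splits_below\<close>; the two splittings are then
      added.\<close>
    case 1
    note N' = N 1(1)[unfolded mor_def]
    have pi: "(w \<cdot> (\<pi> \<cdot> a)) \<cdot> (a \<cdot> \<iota>) = ide \<C> Y"
      using N' 1(2) a'(1)[THEN cmp_extend] by simp
    let ?i = "a \<cdot> \<iota>" and ?p = "w \<cdot> (\<pi> \<cdot> a)"
    have mm: "mor ?i Y X" "mor ?p X Y" "mor (?i \<cdot> ?p) X X" using N' by (simp_all add: mor_def)
    have pi': "w \<cdot> (\<pi> \<cdot> (a \<cdot> (a \<cdot> \<iota>))) = ide \<C> Y" using pi N' by simp
    have pi'': "w \<cdot> (\<pi> \<cdot> (a \<cdot> \<iota>)) = ide \<C> Y" using pi N' a'(1)[THEN cmp_extend] by simp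
    have pix: "w \<cdot> (\<pi> \<cdot> (a \<cdot> (\<iota> \<cdot> x))) = x" if "mor x X Y" for x
      using arg_cong[OF pi'', of "\<lambda>y. y \<cdot> x"] that N' by (simp add: mor_def)
    define x where "x = a \<boxplus> \<boxminus> (?i \<cdot> ?p)"
    have mx: "mor x X X" using N' by (simp add: x_def mor_def)
    have 3: "x \<cdot> x = x" "e \<cdot> x = x" "x \<cdot> e = x" "x \<cdot> ?i = zmor \<C> Y X" "?p \<cdot> x = zmor \<C> X Y"
      unfolding x_def using N' a' a'[THEN cmp_extend] pi pi' pi'' pix by (simp_all add: plus_normal mor_def)
    have "splits x"
      by (rule splits_below[where e=e and e'=e' and i="?i" and p="?p" and w="\<pi> \<cdot> (a \<cdot> \<iota>)" and w'=w and \<pi>=\<pi> and \<iota>=\<iota> and Y=Y and X=X])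
        (use me M mm 1 N' e a' a'[THEN cmp_extend] pi 3 IH mx in \<open>simp_all add: mor_def flip: e_def\<close>)
    moreover have dom_ip: "dom (?i \<cdot> ?p) = X" using mm(3) by (simp add: mor_def)
    moreover have "splits (?i \<cdot> ?p)"
      unfolding splits_def dom_ip
      using mm pi by blast
    moreover have "(?i \<cdot> ?p) \<cdot> x = zmor \<C> X X" "x \<cdot> (?i \<cdot> ?p) = zmor \<C> X X" 
      using mm mx 3(4)[THEN cmp_extend] 3(5) by (auto simp: mor_def)
    ultimately have "splits (x \<boxplus> ?i \<cdot> ?p)" using splits_plus mm(3) mx by blast
    moreover have "x \<boxplus> ?i \<cdot> ?p = a" unfolding x_def using N' by (simp add: plus_normal)
    ultimately show ?thesis by simp
  next
    \<comment> \<open>The copy of Y lies in e - a, hence a itself is orthogonal to ip and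
      \<open>splits_below\<close> applies to a directly.\<close>
    case 2
    note N' = N 2(1)[unfolded mor_def] ma1[unfolded mor_def]
    have pi: "(w \<cdot> (\<pi> \<cdot> a1)) \<cdot> (a1 \<cdot> \<iota>) = ide \<C> Y"
      using N' 2(2) a1(1)[THEN cmp_extend] by simp
    let ?i = "a1 \<cdot> \<iota>" and ?p = "w \<cdot> (\<pi> \<cdot> a1)"
    have mm: "mor ?i Y X" "mor ?p X Y" using N' by (simp_all add: mor_def)
    show ?thesis
      by (rule splits_below[where e=e and e'=e' and i="?i" and p="?p" and w="\<pi> \<cdot> (a1 \<cdot> \<iota>)" and w'=w and \<pi>=\<pi> and \<iota>=\<iota> and Y=Y and X=X])
        (use me M mm 2 N' e a' a1 a1[THEN cmp_extend] pi IH in \<open>simp_all add: mor_def flip: e_def\<close>)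
  qed
qed


lemma cmp_finprod:
  fixes k :: nat
  assumes "\<And>l. l < k \<Longrightarrow> mor (f l) X X" "mor g Y X" "\<And>l. l < k \<Longrightarrow> f l \<cdot> g = zmor \<C> Y X"
  shows "finprod (Hom \<C> X X) f {..<k} \<cdot> g = zmor \<C> Y X"
proof -
  interpret comm_group "Hom \<C> X X" using assms(2) Hom_comm_group by (auto simp: mor_def)
  show ?thesis using assms
  proof (induction k)
    case 0
    then show ?case by (simp add: mor_def)
  next
    case (Suc k)
    have f: "f \<in> {..<k} \<rightarrow> Mor \<C> X X" "f k \<in> Mor \<C> X X" using Suc.prems(1) by (auto simp: mor_iff)
    have "mor (finprod (Hom \<C> X X) f {..<k}) X X" using f finprod_closed assms(2) by (simp add: mor_iff)
    moreover have "finprod (Hom \<C> X X) f {..<Suc k} = f k \<boxplus> finprod (Hom \<C> X X) f {..<k}"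
      using f Suc.prems(1)[of k] by (simp add: lessThan_Suc mor_def padd_plus)
    ultimately show ?case using Suc by (simp add: mor_def)
  qed
qed

lemma finprod_cmp:
  fixes k :: nat
  assumes "\<And>l. l < k \<Longrightarrow> mor (f l) X X" "mor g X Y" "\<And>l. l < k \<Longrightarrow> g \<cdot> f l = zmor \<C> X Y"
  shows "g \<cdot> finprod (Hom \<C> X X) f {..<k} = zmor \<C> X Y"
proof -
  interpret comm_group "Hom \<C> X X" using assms(2) Hom_comm_group by (auto simp: mor_def)
  show ?thesis using assms
  proof (induction k)
    case 0
    then show ?case by (simp add: mor_def)
  next
    case (Suc k)
    have f: "f \<in> {..<k} \<rightarrow> Mor \<C> X X" "f k \<in> Mor \<C> X X" using Suc.prems(1) by (auto simp: mor_iff)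
    have "mor (finprod (Hom \<C> X X) f {..<k}) X X" using f finprod_closed assms(2) by (simp add: mor_iff)
    moreover have "finprod (Hom \<C> X X) f {..<Suc k} = f k \<boxplus> finprod (Hom \<C> X X) f {..<k}"
      using f Suc.prems(1)[of k] by (simp add: lessThan_Suc mor_def padd_plus)
    ultimately show ?case using Suc by (simp add: mor_def)
  qed
qed

lemma krull_schmidt_splits:
  assumes "krull_schmidt \<C>" "mor a X X" "a \<cdot> a = a"
  shows "splits a"
proof -
  have X: "X \<in> Obj \<C>" using assms by (simp add: mor_def)
  obtain m Y \<iota> \<pi> where ds: "direct_sum \<C> m Y X \<iota> \<pi>" and local: "\<And>k. k < m \<Longrightarrow> local_ring (End_ring \<C> (Y k))"
    using assms(1) X unfolding krull_schmidt_def by blast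
  define f where "f = (\<lambda>k. \<iota> k \<cdot> \<pi> k)"
  define e where "e k = finprod (Hom \<C> X X) f {..<k}" for k
  have M: "mor (\<iota> k) (Y k) X" "mor (\<pi> k) X (Y k)" "\<pi> k \<cdot> \<iota> k = ide \<C> (Y k)" if "k < m" for k
    using ds that X by (auto simp: direct_sum_def mor_iff)
  have orth: "\<pi> k \<cdot> \<iota> l = zmor \<C> (Y l) (Y k)" if "k < m" "l < m" "k \<noteq> l" for k l
    using ds that by (auto simp: direct_sum_def)
  interpret comm_group "Hom \<C> X X" using X Hom_comm_group by auto
  have mf: "mor (f k) X X" if "k < m" for k using M[OF that] by (auto simp: f_def mor_def)
  have me: "mor (e k) X X" if "k \<le> m" for k
    unfolding e_def using mf that X by (auto simp: mor_iff intro!: finprod_closed)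
  have e_Suc: "e (Suc k) = e k \<boxplus> \<iota> k \<cdot> \<pi> k" if "k < m" for k
  proof -
    have "e (Suc k) = f k \<boxplus> e k" 
      unfolding e_def using mf that mf[OF that, unfolded mor_def]
      by (subst lessThan_Suc, subst finprod_insert) (auto simp: mor_iff padd_plus)
    then show ?thesis using mf[OF that] me[of k] that plus_comm[of "f k" "e k"] by (simp add: mor_def f_def)
  qed
  have e\<iota>: "e k \<cdot> \<iota> k = zmor \<C> (Y k) X" if "k < m" for k
  proof -
    have "f l \<cdot> \<iota> k = zmor \<C> (Y k) X" if "l < k" for l
      using M[of l] M[of k] orth[of l k] that \<open>k < m\<close> by (simp add: f_def mor_def)
    then show ?thesis unfolding e_def using that mf M by (intro cmp_finprod) auto
  qed
  have \<pi>e: "\<pi> k \<cdot> e k = zmor \<C> X (Y k)" if "k < m" for k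
  proof -
    have "\<pi> k \<cdot> f l = zmor \<C> X (Y k)" if "l < k" for l
      using M[of l] M[of k] orth[of k l, THEN cmp_extend, of "\<pi> l"] that \<open>k < m\<close> by (simp add: f_def mor_def)
    then show ?thesis unfolding e_def using that mf M by (intro finprod_cmp) auto
  qed
  \<comment> \<open>Idempotents below \<open>e k\<close> stand for endomorphisms of the sum of the
    first k summands, although that sum is never formed as an object. At k = m the condition of
    lying below \<open>e k\<close> is void because \<open>e m\<close> is the identity.\<close>
  have "(e k \<cdot> e k = e k) \<and> (\<forall>a. mor a X X \<longrightarrow> a \<cdot> a = a \<longrightarrow> e k \<cdot> a = a \<longrightarrow> a \<cdot> e k = a \<longrightarrow> splits a)" if "k \<le> m" for k
    using that
  proof (induction k)
    case 0
    have e0: "e 0 = zmor \<C> X X" by (simp add: e_def)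
    obtain Z where Z: "zero_object \<C> Z" using ex_zero_object by blast
    note Z' = zero_object_ide[OF Z]
    have "splits (zmor \<C> X X)" unfolding splits_def
      using X Z' by (intro exI[of _ Z] exI[of _ "zmor \<C> Z X"] exI[of _ "zmor \<C> X Z"]) (simp add: mor_def)
    moreover have "a = zmor \<C> X X" if "mor a X X" "e 0 \<cdot> a = a" for a
      using that e0 by (simp add: mor_def)
    ultimately show ?case using X e0 by auto
  next
    case (Suc k)
    then have k: "k < m" by simp
    note IH = Suc.IH[OF less_imp_le[OF k]]
    note N = me[OF less_imp_le[OF k]] M[OF k] e\<iota>[OF k] \<pi>e[OF k]
    have "e (Suc k) \<cdot> e (Suc k) = e (Suc k)" unfolding e_Suc[OF k]
      using N N(4,5,6)[THEN cmp_extend] IH by (simp add: mor_def)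
    moreover have "splits a" if "mor a X X" "a \<cdot> a = a" "e (Suc k) \<cdot> a = a" "a \<cdot> e (Suc k) = a" for a
      by (rule splits_step[of "e k" X "\<iota> k" "Y k" "\<pi> k"])
        (use N IH local[OF k] that in \<open>simp_all flip: e_Suc[OF k]\<close>)
    ultimately show ?case by blast
  qed
  from this[of m] have "splits a" if "e m = ide \<C> X"
    using that assms(2,3) by (simp add: mor_def)
  moreover have "e m = ide \<C> X" using ds by (simp add: e_def f_def direct_sum_def)
  ultimately show ?thesis by blast
qed

end

section \<open>Extensions and homotopy equivalence\<close>

context additive_bifunctor
begin

definition is_ext :: "'o \<Rightarrow> 'o \<Rightarrow> 'e \<Rightarrow> bool" where
  "is_ext C A \<delta> \<longleftrightarrow> C \<in> Obj \<C> \<and> A \<in> Obj \<C> \<and> \<delta> \<in> carrier (Ext \<E> C A)"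

lemma push_ext: "\<lbrakk>is_ext C A \<delta>; mor a A B\<rbrakk> \<Longrightarrow> is_ext C B (push \<C> \<E> C a \<delta>)"
  using act_hom[of C C A B "ide \<C> C" a] by (auto simp: is_ext_def push_def mor_iff ide_in hom_def)

lemma pull_ext: "\<lbrakk>is_ext C A \<delta>; mor c D C\<rbrakk> \<Longrightarrow> is_ext D A (pull \<C> \<E> A c \<delta>)"
  using act_hom[of C D A A c "ide \<C> A"] by (auto simp: is_ext_def pull_def mor_iff ide_in hom_def)

lemma push_ide: "is_ext C A \<delta> \<Longrightarrow> push \<C> \<E> C (ide \<C> A) \<delta> = \<delta>"
  and pull_ide: "is_ext C A \<delta> \<Longrightarrow> pull \<C> \<E> A (ide \<C> C) \<delta> = \<delta>"
  by (simp_all add: is_ext_def push_def pull_def act_ide)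

lemma push_push:
  assumes "is_ext C A \<delta>" "mor a A B" "mor b B D"
  shows "push \<C> \<E> C b (push \<C> \<E> C a \<delta>) = push \<C> \<E> C (b \<cdot> a) \<delta>"
  using assms act_cmp[of C C C A B D "ide \<C> C" "ide \<C> C" a b \<delta>]
  by (simp add: is_ext_def push_def mor_def)

lemma pull_pull:
  assumes "is_ext C A \<delta>" "mor c D C" "mor d F D"
  shows "pull \<C> \<E> A d (pull \<C> \<E> A c \<delta>) = pull \<C> \<E> A (c \<cdot> d) \<delta>"
  using assms act_cmp[of C D F A A A c d "ide \<C> A" "ide \<C> A" \<delta>]
  by (simp add: is_ext_def pull_def mor_def)

lemma push_pull:
  assumes "is_ext C A \<delta>" "mor c D C" "mor a A B"
  shows "push \<C> \<E> D a (pull \<C> \<E> A c \<delta>) = pull \<C> \<E> B c (push \<C> \<E> C a \<delta>)"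
  using assms act_cmp[of C D D A A B c "ide \<C> D" "ide \<C> A" a \<delta>]
    act_cmp[of C C D A B B "ide \<C> C" c a "ide \<C> B" \<delta>]
  by (simp add: is_ext_def push_def pull_def mor_def)

lemma group_Ext: "is_ext C A \<delta> \<Longrightarrow> comm_group (Ext \<E> C A)"
  by (simp add: is_ext_def Ext_comm_group)

lemma ext_one: "\<lbrakk>C \<in> Obj \<C>; A \<in> Obj \<C>\<rbrakk> \<Longrightarrow> is_ext C A \<one>\<^bsub>Ext \<E> C A\<^esub>"
  using Ext_comm_group[of C A] by (simp add: is_ext_def comm_group_def group.is_monoid monoid.one_closed)

lemma ext_mult: "\<lbrakk>is_ext C A \<delta>; is_ext C A \<epsilon>\<rbrakk> \<Longrightarrow> is_ext C A (\<delta> \<otimes>\<^bsub>Ext \<E> C A\<^esub> \<epsilon>)"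
  using Ext_comm_group[of C A] by (simp add: is_ext_def comm_group_def group.is_monoid monoid.m_closed)

lemma ext_inv: "is_ext C A \<delta> \<Longrightarrow> is_ext C A (inv\<^bsub>Ext \<E> C A\<^esub> \<delta>)"
  using Ext_comm_group[of C A] by (simp add: is_ext_def comm_group_def group.inv_closed)

lemma push_hom: "\<lbrakk>C \<in> Obj \<C>; mor a A B\<rbrakk> \<Longrightarrow> group_hom (Ext \<E> C A) (Ext \<E> C B) (push \<C> \<E> C a)"
  using act_hom[of C C A B "ide \<C> C" a] Ext_comm_group[of C A] Ext_comm_group[of C B]
  by (simp add: push_def[abs_def] mor_iff ide_in group_hom_def group_hom_axioms_def comm_group_def)

lemma pull_hom: "\<lbrakk>A \<in> Obj \<C>; mor c D C\<rbrakk> \<Longrightarrow> group_hom (Ext \<E> C A) (Ext \<E> D A) (pull \<C> \<E> A c)"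
  using act_hom[of C D A A c "ide \<C> A"] Ext_comm_group[of C A] Ext_comm_group[of D A]
  by (simp add: pull_def[abs_def] mor_iff ide_in group_hom_def group_hom_axioms_def comm_group_def)

lemma push_one: "\<lbrakk>C \<in> Obj \<C>; mor a A B\<rbrakk> \<Longrightarrow> push \<C> \<E> C a \<one>\<^bsub>Ext \<E> C A\<^esub> = \<one>\<^bsub>Ext \<E> C B\<^esub>"
  using push_hom group_hom.hom_one by blast

lemma pull_one: "\<lbrakk>A \<in> Obj \<C>; mor c D C\<rbrakk> \<Longrightarrow> pull \<C> \<E> A c \<one>\<^bsub>Ext \<E> C A\<^esub> = \<one>\<^bsub>Ext \<E> D A\<^esub>"
  using pull_hom group_hom.hom_one by blast

lemma push_mult:
  "\<lbrakk>is_ext C A \<delta>; is_ext C A \<epsilon>; mor a A B\<rbrakk>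
    \<Longrightarrow> push \<C> \<E> C a (\<delta> \<otimes>\<^bsub>Ext \<E> C A\<^esub> \<epsilon>) = push \<C> \<E> C a \<delta> \<otimes>\<^bsub>Ext \<E> C B\<^esub> push \<C> \<E> C a \<epsilon>"
  using push_hom[of C a A B] by (simp add: is_ext_def group_hom.hom_mult)

lemma pull_mult:
  "\<lbrakk>is_ext C A \<delta>; is_ext C A \<epsilon>; mor c D C\<rbrakk>
    \<Longrightarrow> pull \<C> \<E> A c (\<delta> \<otimes>\<^bsub>Ext \<E> C A\<^esub> \<epsilon>) = pull \<C> \<E> A c \<delta> \<otimes>\<^bsub>Ext \<E> D A\<^esub> pull \<C> \<E> A c \<epsilon>"
  using pull_hom[of A c D C] by (simp add: is_ext_def group_hom.hom_mult)

lemma push_inv: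
  "\<lbrakk>is_ext C A \<delta>; mor a A B\<rbrakk> \<Longrightarrow> push \<C> \<E> C a (inv\<^bsub>Ext \<E> C A\<^esub> \<delta>) = inv\<^bsub>Ext \<E> C B\<^esub> push \<C> \<E> C a \<delta>"
  using push_hom[of C a A B] by (simp add: is_ext_def group_hom.hom_inv)

lemma push_plus:
  "\<lbrakk>is_ext C A \<delta>; mor a A B; mor b A B\<rbrakk>
    \<Longrightarrow> push \<C> \<E> C (a \<boxplus> b) \<delta> = push \<C> \<E> C a \<delta> \<otimes>\<^bsub>Ext \<E> C B\<^esub> push \<C> \<E> C b \<delta>"
  using push_add[of C A B a b \<delta>] by (simp add: is_ext_def mor_def padd_plus)

lemma pull_plus:
  "\<lbrakk>is_ext C A \<delta>; mor c D C; mor d D C\<rbrakk>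
    \<Longrightarrow> pull \<C> \<E> A (c \<boxplus> d) \<delta> = pull \<C> \<E> A c \<delta> \<otimes>\<^bsub>Ext \<E> D A\<^esub> pull \<C> \<E> A d \<delta>"
  using pull_add[of C D A c d \<delta>] by (simp add: is_ext_def mor_def padd_plus)

text \<open>Additivity in a morphism shows only that the value at the zero morphism is idempotent;
  this turns it into the zero extension.\<close>

lemma ext_idem_one:
  assumes "is_ext C A \<delta>" "\<delta> \<otimes>\<^bsub>Ext \<E> C A\<^esub> \<delta> = \<delta>"
  shows "\<delta> = \<one>\<^bsub>Ext \<E> C A\<^esub>"
  using group_Ext[OF assms(1)] assms by (metis comm_group_def group.l_cancel_one is_ext_def)

lemma push_zero:
  assumes "is_ext C A \<delta>" "B \<in> Obj \<C>"
  shows "push \<C> \<E> C (zmor \<C> A B) \<delta> = \<one>\<^bsub>Ext \<E> C B\<^esub>"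
proof -
  have z: "mor (zmor \<C> A B) A B" using assms by (simp add: mor_zero is_ext_def)
  have "zmor \<C> A B \<boxplus> zmor \<C> A B = zmor \<C> A B" using assms by (simp add: is_ext_def)
  then show ?thesis using push_plus[OF assms(1) z z] ext_idem_one push_ext[OF assms(1) z] by metis
qed

lemma pull_zero:
  assumes "is_ext C A \<delta>" "D \<in> Obj \<C>"
  shows "pull \<C> \<E> A (zmor \<C> D C) \<delta> = \<one>\<^bsub>Ext \<E> D A\<^esub>"
proof -
  have z: "mor (zmor \<C> D C) D C" using assms by (simp add: mor_zero is_ext_def)
  have "zmor \<C> D C \<boxplus> zmor \<C> D C = zmor \<C> D C" using assms by (simp add: is_ext_def)
  then show ?thesis using pull_plus[OF assms(1) z z] ext_idem_one pull_ext[OF assms(1) z] by metis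
qed

text \<open>Additivity identifies E(T + C, A) with the product of E(T, A) and E(C, A), and \<rho> is
  the pair (\<tau>, \<delta>). The last clause lets the vanishing of a pushforward be checked on the
  components.\<close>

lemma ext_cotuple:
  assumes "biproduct \<C> T C S i1 i2 p1 p2" "is_ext T A \<tau>" "is_ext C A \<delta>"
  obtains \<rho> where "is_ext S A \<rho>" "pull \<C> \<E> A i1 \<rho> = \<tau>" "pull \<C> \<E> A i2 \<rho> = \<delta>"
    "\<rho> = pull \<C> \<E> A p1 \<tau> \<otimes>\<^bsub>Ext \<E> S A\<^esub> pull \<C> \<E> A p2 \<delta>"
    "\<And>a B. \<lbrakk>mor a A B; push \<C> \<E> T a \<tau> = \<one>\<^bsub>Ext \<E> T B\<^esub>; push \<C> \<E> C a \<delta> = \<one>\<^bsub>Ext \<E> C B\<^esub>\<rbrakk>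
      \<Longrightarrow> push \<C> \<E> S a \<rho> = \<one>\<^bsub>Ext \<E> S B\<^esub>"
proof
  note B = assms(1)[unfolded biproduct_iff]
  let ?\<rho> = "pull \<C> \<E> A p1 \<tau> \<otimes>\<^bsub>Ext \<E> S A\<^esub> pull \<C> \<E> A p2 \<delta>"
  have 1: "is_ext S A (pull \<C> \<E> A p1 \<tau>)" "is_ext S A (pull \<C> \<E> A p2 \<delta>)"
    using pull_ext assms B by blast+
  show \<rho>: "is_ext S A ?\<rho>" using 1 by (rule ext_mult)
  have one: "\<delta> \<otimes>\<^bsub>Ext \<E> D F\<^esub> \<one>\<^bsub>Ext \<E> D F\<^esub> = \<delta>" "\<one>\<^bsub>Ext \<E> D F\<^esub> \<otimes>\<^bsub>Ext \<E> D F\<^esub> \<delta> = \<delta>" if "is_ext D F \<delta>" for D F \<delta>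
    using group_Ext[OF that] that by (simp_all add: is_ext_def comm_group_def group.is_monoid)
  have M: "T \<in> Obj \<C>" "C \<in> Obj \<C>" using B by (auto simp: mor_def)
  show "pull \<C> \<E> A i1 ?\<rho> = \<tau>"
    using B assms(2,3) 1 M
    by (simp add: pull_mult[of S A _ _ i1 T] pull_pull[of T A _ p1 S i1 T] pull_pull[of C A _ p2 S i1 T] pull_ide pull_zero one)
  show "pull \<C> \<E> A i2 ?\<rho> = \<delta>"
    using B assms(2,3) 1 M
    by (simp add: pull_mult[of S A _ _ i2 C] pull_pull[of T A _ p1 S i2 C] pull_pull[of C A _ p2 S i2 C] pull_ide pull_zero one)
  fix a F assume a: "mor a A F" "push \<C> \<E> T a \<tau> = \<one>\<^bsub>Ext \<E> T F\<^esub>" "push \<C> \<E> C a \<delta> = \<one>\<^bsub>Ext \<E> C F\<^esub>"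
  then have "push \<C> \<E> S a (pull \<C> \<E> A p1 \<tau>) = \<one>\<^bsub>Ext \<E> S F\<^esub>" "push \<C> \<E> S a (pull \<C> \<E> A p2 \<delta>) = \<one>\<^bsub>Ext \<E> S F\<^esub>"
    using B assms(2,3) by (simp_all add: push_pull[of T A _ p1 S a F] push_pull[of C A _ p2 S a F] pull_one mor_def)
  then show "push \<C> \<E> S a ?\<rho> = \<one>\<^bsub>Ext \<E> S F\<^esub>"
    using push_mult[OF 1 a(1)] one ext_one a(1) \<rho> by (simp add: mor_def is_ext_def)
qed simp

end

section \<open>Complexes, chain maps and homotopy equivalence\<close>

context preadditive_category
begin

text \<open>Each degree up to n + 1 is an end of some differential, so typing the differentials by
  \<open>mor\<close> already makes all terms objects.\<close>

lemma complexes_iff: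
  "X \<in> complexes n \<C> \<longleftrightarrow>
    (\<forall>i\<le>n. mor (df X i) (ob X i) (ob X (i+1))) \<and>
    (\<forall>i<n. df X (i+1) \<cdot> df X i = zmor \<C> (ob X i) (ob X (i+2)))"
proof -
  have "(\<forall>i\<le>n+1. P i) \<longleftrightarrow> (\<forall>i\<le>n. P i \<and> P (i+1))" for P
    by (metis Suc_eq_plus1 le_Suc_eq not_less_eq_eq)
  then show ?thesis unfolding complexes_def by (auto simp: mor_iff)
qed

lemma chain_map_iff:
  assumes "X \<in> complexes n \<C>" "Y \<in> complexes n \<C>"
  shows "chain_map n \<C> X Y f \<longleftrightarrow> (\<forall>i\<le>n+1. mor (f i) (ob X i) (ob Y i)) \<and>
    (\<forall>i\<le>n. f (i+1) \<cdot> df X i = df Y i \<cdot> f i)"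
  using assms unfolding chain_map_def by (auto simp: mor_iff complexes_def)

lemma homotopic_iff:
  assumes "X \<in> complexes n \<C>" "Y \<in> complexes n \<C>"
    "\<And>i. i \<le> n+1 \<Longrightarrow> mor (f i) (ob X i) (ob Y i)" "\<And>i. i \<le> n+1 \<Longrightarrow> mor (g i) (ob X i) (ob Y i)"
  shows "homotopic n \<C> X Y f g \<longleftrightarrow> (\<exists>h.
    (\<forall>i\<le>n. mor (h i) (ob X (i+1)) (ob Y i)) \<and>
    f 0 \<boxplus> \<boxminus> (g 0) = h 0 \<cdot> df X 0 \<and>
    (\<forall>i<n. f (i+1) \<boxplus> \<boxminus> (g (i+1)) = df Y i \<cdot> h i \<boxplus> h (i+1) \<cdot> df X (i+1)) \<and>
    f (n+1) \<boxplus> \<boxminus> (g (n+1)) = df Y n \<cdot> h n)"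
proof -
  have 1: "padd \<C> (ob X i) (ob Y i) (f i) (pneg \<C> (ob X i) (ob Y i) (g i)) = f i \<boxplus> \<boxminus> (g i)" if "i \<le> n+1" for i
    using assms(3,4)[OF that] by (simp add: mor_def padd_plus pneg_neg)
  have 2: "padd \<C> (ob X (i+1)) (ob Y (i+1)) (df Y i \<cdot> h i) (h (i+1) \<cdot> df X (i+1)) = df Y i \<cdot> h i \<boxplus> h (i+1) \<cdot> df X (i+1)"
    if "i < n" "\<forall>i\<le>n. mor (h i) (ob X (i+1)) (ob Y i)" for h i
    using assms(1,2)[unfolded complexes_iff] that by (simp add: mor_def padd_plus)
  have 3: "mor (h i) (ob X (i+1)) (ob Y i) \<longleftrightarrow> h i \<in> Mor \<C> (ob X (i+1)) (ob Y i)" if "i \<le> n" for h i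
    using assms(1,2) that by (simp add: mor_iff complexes_def)
  show ?thesis unfolding homotopic_def using 1 2 3 by (auto 0 3)
qed

text \<open>Half of a homotopy equivalence: only the homotopy from gf to the identity is recorded.
  The other half arises by exchanging f and g, so transitivity and duality need only one homotopy
  computation each.\<close>

definition homotopy_inverse :: "nat \<Rightarrow> ('o, 'm) cplx \<Rightarrow> ('o, 'm) cplx \<Rightarrow> (nat \<Rightarrow> 'm) \<Rightarrow> (nat \<Rightarrow> 'm) \<Rightarrow> bool" where
  "homotopy_inverse n X Y f g \<longleftrightarrow> chain_map_fixing_ends n \<C> X Y f \<and> chain_map_fixing_ends n \<C> Y X g \<and>
     homotopic n \<C> X X (\<lambda>i. g i \<cdot> f i) (\<lambda>i. ide \<C> (ob X i))"

definition homotopy_equiv :: "nat \<Rightarrow> ('o, 'm) cplx \<Rightarrow> ('o, 'm) cplx \<Rightarrow> bool" where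
  "homotopy_equiv n X Y \<longleftrightarrow> X \<in> complexes n \<C> \<and> Y \<in> complexes n \<C> \<and> ob Y 0 = ob X 0 \<and> ob Y (n+1) = ob X (n+1) \<and>
    (\<exists>f g. homotopy_inverse n X Y f g \<and> homotopy_inverse n Y X g f)"

lemma homotopy_class_iff:
  "X \<in> complexes n \<C> \<Longrightarrow> Y \<in> homotopy_class n \<C> X \<longleftrightarrow> homotopy_equiv n X Y"
  unfolding homotopy_class_def homotopy_equiv_def homotopy_inverse_def complexes_from_to_def by blast

lemma homotopy_equiv_sym: "homotopy_equiv n X Y \<Longrightarrow> homotopy_equiv n Y X"
  unfolding homotopy_equiv_def by metis

lemma homotopy_inverse_trans:
  assumes "X \<in> complexes n \<C>" "Y \<in> complexes n \<C>" "Z \<in> complexes n \<C>"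
    "ob Y 0 = ob X 0" "ob Y (n+1) = ob X (n+1)" "ob Z 0 = ob Y 0" "ob Z (n+1) = ob Y (n+1)"
    and 1: "homotopy_inverse n X Y f g" and 2: "homotopy_inverse n Y Z f' g'"
  shows "homotopy_inverse n X Z (\<lambda>i. f' i \<cdot> f i) (\<lambda>i. g i \<cdot> g' i)"
proof -
  note XYZ = assms(1-3)[unfolded complexes_iff, THEN conjunct1, rule_format, unfolded mor_def]
  have f: "\<And>i. i \<le> n+1 \<Longrightarrow> mor (f i) (ob X i) (ob Y i)" "\<And>i. i \<le> n \<Longrightarrow> f (i+1) \<cdot> df X i = df Y i \<cdot> f i"
    "f 0 = ide \<C> (ob X 0)" "f (n+1) = ide \<C> (ob X (n+1))"
    and g: "\<And>i. i \<le> n+1 \<Longrightarrow> mor (g i) (ob Y i) (ob X i)" "\<And>i. i \<le> n \<Longrightarrow> g (i+1) \<cdot> df Y i = df X i \<cdot> g i"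
    "g 0 = ide \<C> (ob Y 0)" "g (n+1) = ide \<C> (ob Y (n+1))"
    using 1 unfolding homotopy_inverse_def chain_map_fixing_ends_def 
      chain_map_iff[OF assms(1,2)] chain_map_iff[OF assms(2,1)] by auto
  have f': "\<And>i. i \<le> n+1 \<Longrightarrow> mor (f' i) (ob Y i) (ob Z i)" "\<And>i. i \<le> n \<Longrightarrow> f' (i+1) \<cdot> df Y i = df Z i \<cdot> f' i"
    "f' 0 = ide \<C> (ob Y 0)" "f' (n+1) = ide \<C> (ob Y (n+1))"
    and g': "\<And>i. i \<le> n+1 \<Longrightarrow> mor (g' i) (ob Z i) (ob Y i)" "\<And>i. i \<le> n \<Longrightarrow> g' (i+1) \<cdot> df Z i = df Y i \<cdot> g' i"
    "g' 0 = ide \<C> (ob Z 0)" "g' (n+1) = ide \<C> (ob Z (n+1))"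
    using 2 unfolding homotopy_inverse_def chain_map_fixing_ends_def 
      chain_map_iff[OF assms(2,3)] chain_map_iff[OF assms(3,2)] by auto
  note F = f(1)[unfolded mor_def] g(1)[unfolded mor_def] f'(1)[unfolded mor_def] g'(1)[unfolded mor_def]
  have X0: "ob X i \<in> Obj \<C>" "ob Y i \<in> Obj \<C>" "ob Z i \<in> Obj \<C>" if "i \<le> n+1" for i
    using assms(1-3) that by (auto simp: complexes_def)
  have comm: "f' (Suc i) \<cdot> (f (Suc i) \<cdot> df X i) = df Z i \<cdot> (f' i \<cdot> f i)" if "i \<le> n" for i
    using that f(2)[of i] f'(2)[of i, THEN cmp_extend] F[of i] F[of "Suc i"] XYZ[of i] by simp
  have comm': "g (Suc i) \<cdot> (g' (Suc i) \<cdot> df Z i) = df X i \<cdot> (g i \<cdot> g' i)" if "i \<le> n" for i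
    using that g'(2)[of i] g(2)[of i, THEN cmp_extend] F[of i] F[of "Suc i"] XYZ[of i] by simp
  have c: "chain_map_fixing_ends n \<C> X Z (\<lambda>i. f' i \<cdot> f i)" 
    unfolding chain_map_fixing_ends_def chain_map_iff[OF assms(1,3)]
    using F f(3,4) f'(3,4) comm X0 XYZ assms(4-7) by (auto simp: mor_def)
  have d: "chain_map_fixing_ends n \<C> Z X (\<lambda>i. g i \<cdot> g' i)" 
    unfolding chain_map_fixing_ends_def chain_map_iff[OF assms(3,1)]
    using F g(3,4) g'(3,4) comm' X0 XYZ assms(4-7) by (auto simp: mor_def)
  have gf: "\<And>i. i \<le> n + 1 \<Longrightarrow> mor (g i \<cdot> f i) (ob X i) (ob X i)" "\<And>i. i \<le> n + 1 \<Longrightarrow> mor (ide \<C> (ob X i)) (ob X i) (ob X i)"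
    using F X0 by (auto simp: mor_def)
  have gf': "\<And>i. i \<le> n + 1 \<Longrightarrow> mor (g' i \<cdot> f' i) (ob Y i) (ob Y i)" "\<And>i. i \<le> n + 1 \<Longrightarrow> mor (ide \<C> (ob Y i)) (ob Y i) (ob Y i)"
    using F X0 by (auto simp: mor_def)
  obtain h where h: "\<And>i. i\<le>n \<Longrightarrow> mor (h i) (ob X (i+1)) (ob X i)" 
      "g 0 \<cdot> f 0 \<boxplus> \<boxminus> (ide \<C> (ob X 0)) = h 0 \<cdot> df X 0"
      "\<And>i. i<n \<Longrightarrow> g (i+1) \<cdot> f (i+1) \<boxplus> \<boxminus> (ide \<C> (ob X (i+1))) = df X i \<cdot> h i \<boxplus> h (i+1) \<cdot> df X (i+1)"
      "g (n+1) \<cdot> f (n+1) \<boxplus> \<boxminus> (ide \<C> (ob X (n+1))) = df X n \<cdot> h n"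
    using 1 homotopic_iff[OF assms(1,1), where f="\<lambda>i. g i \<cdot> f i" and g="\<lambda>i. ide \<C> (ob X i)", OF gf]
    unfolding homotopy_inverse_def by blast
  obtain k where k: "\<And>i. i\<le>n \<Longrightarrow> mor (k i) (ob Y (i+1)) (ob Y i)" 
      "g' 0 \<cdot> f' 0 \<boxplus> \<boxminus> (ide \<C> (ob Y 0)) = k 0 \<cdot> df Y 0"
      "\<And>i. i<n \<Longrightarrow> g' (i+1) \<cdot> f' (i+1) \<boxplus> \<boxminus> (ide \<C> (ob Y (i+1))) = df Y i \<cdot> k i \<boxplus> k (i+1) \<cdot> df Y (i+1)"
      "g' (n+1) \<cdot> f' (n+1) \<boxplus> \<boxminus> (ide \<C> (ob Y (n+1))) = df Y n \<cdot> k n"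
    using 2 homotopic_iff[OF assms(2,2), where f="\<lambda>i. g' i \<cdot> f' i" and g="\<lambda>i. ide \<C> (ob Y i)", OF gf']
    unfolding homotopy_inverse_def by blast
  note HK = h(1)[unfolded mor_def] k(1)[unfolded mor_def]
  \<comment> \<open>The homotopy for the composite comes from g g' f' f - 1 = g (g' f' - 1) f + (gf
    - 1), with k serving the first summand and h the second.\<close>
  define l where "l i = g i \<cdot> (k i \<cdot> f (i+1)) \<boxplus> h i" for i
  have l: "mor (l i) (ob X (i+1)) (ob X i)" if "i \<le> n" for i
    unfolding l_def using that F[of i] F[of "i+1"] HK[of i] X0[of i] X0[of "i+1"] by (simp add: mor_def)
  have tele: "(g i \<cdot> g' i) \<cdot> (f' i \<cdot> f i) \<boxplus> \<boxminus> (ide \<C> (ob X i))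
      = g i \<cdot> ((g' i \<cdot> f' i \<boxplus> \<boxminus> (ide \<C> (ob Y i))) \<cdot> f i) \<boxplus> (g i \<cdot> f i \<boxplus> \<boxminus> (ide \<C> (ob X i)))" if "i \<le> n + 1" for i
    using that F[of i] X0[of i] by (simp add: plus_normal)
  have "homotopic n \<C> X X (\<lambda>i. (g i \<cdot> g' i) \<cdot> (f' i \<cdot> f i)) (\<lambda>i. ide \<C> (ob X i))"
  proof (subst homotopic_iff[OF assms(1,1)])
    show "\<exists>h. (\<forall>i\<le>n. mor (h i) (ob X (i+1)) (ob X i)) \<and>
      (g 0 \<cdot> g' 0) \<cdot> (f' 0 \<cdot> f 0) \<boxplus> \<boxminus> (ide \<C> (ob X 0)) = h 0 \<cdot> df X 0 \<and>
      (\<forall>i<n. (g (i+1) \<cdot> g' (i+1)) \<cdot> (f' (i+1) \<cdot> f (i+1)) \<boxplus> \<boxminus> (ide \<C> (ob X (i+1))) = df X i \<cdot> h i \<boxplus> h (i+1) \<cdot> df X (i+1)) \<and>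
      (g (n+1) \<cdot> g' (n+1)) \<cdot> (f' (n+1) \<cdot> f (n+1)) \<boxplus> \<boxminus> (ide \<C> (ob X (n+1))) = df X n \<cdot> h n"
    proof (intro exI[of _ l] conjI allI impI)
      show "(g 0 \<cdot> g' 0) \<cdot> (f' 0 \<cdot> f 0) \<boxplus> \<boxminus> (ide \<C> (ob X 0)) = l 0 \<cdot> df X 0"
        unfolding tele[OF zero_le] h(2) k(2) l_def
        using F[of 0] F[of 1] HK[of 0] X0[of 0] X0[of 1] XYZ[of 0] f(2)[of 0, symmetric] by simp
    next
      fix i assume i: "i < n"
      then have i': "i + 1 \<le> n + 1" by simp
      show "(g (i+1) \<cdot> g' (i+1)) \<cdot> (f' (i+1) \<cdot> f (i+1)) \<boxplus> \<boxminus> (ide \<C> (ob X (i+1))) = df X i \<cdot> l i \<boxplus> l (i+1) \<cdot> df X (i+1)"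
        unfolding tele[OF i'] h(3)[OF i] k(3)[OF i] l_def
        using i F[of i] F[of "Suc i"] F[of "Suc (Suc i)"] HK[of i] HK[of "Suc i"] X0[of i] X0[of "Suc i"] X0[of "Suc (Suc i)"]
          XYZ[of i] XYZ[of "Suc i"] f(2)[of "Suc i", symmetric] g(2)[of i, THEN cmp_extend] 
        by (simp add: plus_ac)
    next
      show "(g (n+1) \<cdot> g' (n+1)) \<cdot> (f' (n+1) \<cdot> f (n+1)) \<boxplus> \<boxminus> (ide \<C> (ob X (n+1))) = df X n \<cdot> l n"
        unfolding tele[OF order.refl] h(4) k(4) l_def
        using F[of n] F[of "Suc n"] HK[of n] X0[of n] X0[of "Suc n"] XYZ[of n] g(2)[of n, THEN cmp_extend] by simp
    qed (use l in simp)
  qed (use F X0 in \<open>auto simp: mor_def\<close>)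
  then show ?thesis unfolding homotopy_inverse_def using c d by blast
qed

lemma homotopy_equiv_trans:
  assumes "homotopy_equiv n X Y" "homotopy_equiv n Y Z"
  shows "homotopy_equiv n X Z"
proof -
  obtain f g f' g' where *: "homotopy_inverse n X Y f g" "homotopy_inverse n Y X g f"
      "homotopy_inverse n Y Z f' g'" "homotopy_inverse n Z Y g' f'"
    using assms unfolding homotopy_equiv_def by blast
  have "homotopy_inverse n X Z (\<lambda>i. f' i \<cdot> f i) (\<lambda>i. g i \<cdot> g' i)" "homotopy_inverse n Z X (\<lambda>i. g i \<cdot> g' i) (\<lambda>i. f' i \<cdot> f i)"
    by (rule homotopy_inverse_trans[where Y=Y]; use * assms in \<open>simp add: homotopy_equiv_def\<close>)+
  then show ?thesis using assms unfolding homotopy_equiv_def by metis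
qed

text \<open>A record may carry arbitrary values outside the range of a complex. Complexes that agree
  in the range are thus not equal, but identities make them equivalent; this gives reflexivity and
  identifies a complex with its double dual.\<close>

lemma homotopy_equiv_cong:
  assumes X: "X \<in> complexes n \<C>" and eq: "\<And>i. i \<le> n+1 \<Longrightarrow> ob Y i = ob X i" "\<And>i. i \<le> n \<Longrightarrow> df Y i = df X i"
  shows "homotopy_equiv n X Y"
proof -
  have Y: "Y \<in> complexes n \<C>"
    using X eq unfolding complexes_def by auto
  have X0: "ob X i \<in> Obj \<C>" if "i \<le> n+1" for i using X that by (auto simp: complexes_def)
  have inv: "homotopy_inverse n X Y (\<lambda>i. ide \<C> (ob X i)) (\<lambda>i. ide \<C> (ob X i))"
    if X: "X \<in> complexes n \<C>" and Y: "Y \<in> complexes n \<C>" and eq: "\<And>i. i \<le> n+1 \<Longrightarrow> ob Y i = ob X i" "\<And>i. i \<le> n \<Longrightarrow> df Y i = df X i" for X Y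
  proof -
    have X0: "ob X i \<in> Obj \<C>" if "i \<le> n+1" for i using X that by (auto simp: complexes_def)
    note XX = X[unfolded complexes_iff, THEN conjunct1, rule_format, unfolded mor_def]
    have "homotopic n \<C> X X (\<lambda>i. ide \<C> (ob X i) \<cdot> ide \<C> (ob X i)) (\<lambda>i. ide \<C> (ob X i))"
      by (subst homotopic_iff[OF X X])
        (use X0 XX in \<open>auto simp: mor_def intro!: exI[of _ "\<lambda>i. zmor \<C> (ob X (i+1)) (ob X i)"]\<close>)
    then show ?thesis
      unfolding homotopy_inverse_def chain_map_fixing_ends_def chain_map_iff[OF X Y] chain_map_iff[OF Y X]
      using X0 XX eq by (auto simp: mor_def)
  qed
  have "homotopy_inverse n X Y (\<lambda>i. ide \<C> (ob X i)) (\<lambda>i. ide \<C> (ob X i))" using inv X Y eq by blast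
  moreover have "homotopy_inverse n Y X (\<lambda>i. ide \<C> (ob X i)) (\<lambda>i. ide \<C> (ob X i))"
  proof -
    have "homotopy_inverse n Y X (\<lambda>i. ide \<C> (ob Y i)) (\<lambda>i. ide \<C> (ob Y i))" using inv X Y eq by simp
    then show ?thesis
      unfolding homotopy_inverse_def chain_map_fixing_ends_def chain_map_iff[OF X Y] chain_map_iff[OF Y X] homotopic_def
      using eq by auto
  qed
  ultimately show ?thesis unfolding homotopy_equiv_def using X Y eq by auto
qed

end

section \<open>Composites of inflations in an extension closed subcategory\<close>

text \<open>The exchange in \<open>replace_first\<close> alters terms in degrees 1 and 2 and
  differentials in degrees 0, 1 and 2, so indices from 3 on are treated uniformly.\<close>

lemma nat_cases4:
  obtains "i = 0" | "i = Suc 0" | "i = Suc (Suc 0)" | j where "i = Suc (Suc (Suc j))"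
  by (metis nat.exhaust)

section \<open>Elementwise consequences of exactness\<close>

context additive_bifunctor
begin

lemma pull_diff:
  assumes "is_ext C A \<delta>" "mor a D C" "mor b D C" "pull \<C> \<E> A a \<delta> = pull \<C> \<E> A b \<delta>"
  shows "pull \<C> \<E> A (a \<boxplus> \<boxminus> b) \<delta> = \<one>\<^bsub>Ext \<E> D A\<^esub>"
proof -
  have m: "mor (a \<boxplus> \<boxminus> b) D C" using assms(2,3) by (simp add: mor_def)
  have "a \<boxplus> \<boxminus> b \<boxplus> b = a" using assms(2,3) by (simp add: mor_def plus_assoc)
  then have "pull \<C> \<E> A (a \<boxplus> \<boxminus> b) \<delta> \<otimes>\<^bsub>Ext \<E> D A\<^esub> pull \<C> \<E> A b \<delta> = pull \<C> \<E> A b \<delta>"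
    using pull_plus[OF assms(1) m assms(3)] assms(4) by simp
  then show ?thesis
    using group_Ext pull_ext[OF assms(1) m] pull_ext[OF assms(1,3)]
    by (metis comm_group_def group.r_cancel_one is_ext_def)
qed

lemma exangle_mor:
  assumes "n_exangle n \<C> \<E> X \<delta>"
  shows "i \<le> n \<Longrightarrow> mor (df X i) (ob X i) (ob X (i+1))" "is_ext (ob X (n+1)) (ob X 0) \<delta>"
proof -
  have X: "X \<in> complexes n \<C>" using assms by (simp add: n_exangle_def)
  show "i \<le> n \<Longrightarrow> mor (df X i) (ob X i) (ob X (i+1))" using X unfolding complexes_iff by blast
  have "mor (df X n) (ob X n) (ob X (n+1))" "mor (df X 0) (ob X 0) (ob X (0+1))"
    using X unfolding complexes_iff by blast+
  then show "is_ext (ob X (n+1)) (ob X 0) \<delta>" using assms by (simp add: n_exangle_def is_ext_def mor_def)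
qed

lemma exangle_ker_first:
  assumes "1 \<le> n" "n_exangle n \<C> \<E> X \<delta>" "mor g (ob X 1) T" "g \<cdot> df X 0 = zmor \<C> (ob X 0) T"
  shows "\<exists>g'. mor g' (ob X 2) T \<and> g = g' \<cdot> df X 1"
proof -
  have M: "mor (df X 1) (ob X 1) (ob X 2)" using exangle_mor(1)[OF assms(2), of 1] assms(1) by (simp add: numeral_2_eq_2)
  have "T \<in> Obj \<C>" using assms(3) by (simp add: mor_def)
  then have "kernel (Hom \<C> (ob X (0+1)) T) (Hom \<C> (ob X 0) T) (\<lambda>g. g \<cdot> df X 0)
            = (\<lambda>g. g \<cdot> df X (0+1)) ` Mor \<C> (ob X (0+2)) T"
    using assms(1,2) unfolding n_exangle_def by auto
  moreover have "g \<in> kernel (Hom \<C> (ob X (0+1)) T) (Hom \<C> (ob X 0) T) (\<lambda>g. g \<cdot> df X 0)"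
    using assms(3,4) by (simp add: kernel_def mor_def)
  ultimately show ?thesis using \<open>T \<in> Obj \<C>\<close> M by (auto simp: mor_iff numeral_2_eq_2)
qed

lemma exangle_ker_push:
  assumes "n_exangle n \<C> \<E> X \<delta>" "mor g (ob X 0) T"
  shows "push \<C> \<E> (ob X (n+1)) g \<delta> = \<one>\<^bsub>Ext \<E> (ob X (n+1)) T\<^esub> \<longleftrightarrow> (\<exists>g'. mor g' (ob X 1) T \<and> g = g' \<cdot> df X 0)"
proof -
  have T: "T \<in> Obj \<C>" using assms(2) by (simp add: mor_def)
  then have *: "kernel (Hom \<C> (ob X 0) T) (Ext \<E> (ob X (n+1)) T) (\<lambda>g. push \<C> \<E> (ob X (n+1)) g \<delta>)
            = (\<lambda>g. g \<cdot> df X 0) ` Mor \<C> (ob X 1) T"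
    using assms(1) unfolding n_exangle_def by auto
  have "push \<C> \<E> (ob X (n+1)) g \<delta> = \<one>\<^bsub>Ext \<E> (ob X (n+1)) T\<^esub> \<longleftrightarrow>
      g \<in> kernel (Hom \<C> (ob X 0) T) (Ext \<E> (ob X (n+1)) T) (\<lambda>g. push \<C> \<E> (ob X (n+1)) g \<delta>)"
    using assms(2) by (simp add: kernel_def mor_def)
  then show ?thesis unfolding * using T exangle_mor(1)[OF assms(1), of 0] by (auto simp: mor_iff)
qed

lemma exangle_ker_pull:
  assumes "n_exangle n \<C> \<E> X \<delta>" "mor g T (ob X (n+1))"
  shows "pull \<C> \<E> (ob X 0) g \<delta> = \<one>\<^bsub>Ext \<E> T (ob X 0)\<^esub> \<longleftrightarrow> (\<exists>g'. mor g' T (ob X n) \<and> g = df X n \<cdot> g')"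
proof -
  have T: "T \<in> Obj \<C>" using assms(2) by (simp add: mor_def)
  then have *: "kernel (Hom \<C> T (ob X (n+1))) (Ext \<E> T (ob X 0)) (\<lambda>f. pull \<C> \<E> (ob X 0) f \<delta>)
            = (\<lambda>f. df X n \<cdot> f) ` Mor \<C> T (ob X n)"
    using assms(1) unfolding n_exangle_def by auto
  have "pull \<C> \<E> (ob X 0) g \<delta> = \<one>\<^bsub>Ext \<E> T (ob X 0)\<^esub> \<longleftrightarrow>
      g \<in> kernel (Hom \<C> T (ob X (n+1))) (Ext \<E> T (ob X 0)) (\<lambda>f. pull \<C> \<E> (ob X 0) f \<delta>)"
    using assms(2) by (simp add: kernel_def mor_def)
  then show ?thesis unfolding * using T exangle_mor(1)[OF assms(1), of n] by (auto simp: mor_iff)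
qed

end

text \<open>A self-dual weakening of the axioms.  (EA2) and its dual are replaced by the exactness
  conditions that they imply, because the signs in the cones are not invariant under duality.\<close>

locale realized_extensions = additive_bifunctor \<C> \<E>
  for n :: nat and \<C> :: "('o, 'm, 'x) cat_scheme" (structure)
    and \<E> :: "('o, 'm, 'e, 'y) bif_scheme" +
  fixes \<ss> :: "('o, 'm, 'e) realization"
  assumes n_pos: "1 \<le> n"
    and realized: "is_ext C A \<delta> \<Longrightarrow> \<exists>X. X \<in> \<ss> C A \<delta>"
    and realizes_complex: "\<lbrakk>is_ext C A \<delta>; X \<in> \<ss> C A \<delta>\<rbrakk> \<Longrightarrow> X \<in> complexes_from_to n \<C> A C"
    and realizes_equiv: "\<lbrakk>is_ext C A \<delta>; X \<in> \<ss> C A \<delta>; homotopy_equiv n X Y\<rbrakk> \<Longrightarrow> Y \<in> \<ss> C A \<delta>"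
    and realizes_exangle: "\<lbrakk>is_ext C A \<delta>; X \<in> \<ss> C A \<delta>\<rbrakk> \<Longrightarrow> n_exangle n \<C> \<E> X \<delta>"
    and push_exact: "\<lbrakk>is_ext C A \<delta>; X \<in> \<ss> C A \<delta>; is_ext T A \<tau>; push \<C> \<E> T (df X 0) \<tau> = \<one>\<^bsub>Ext \<E> T (ob X 1)\<^esub>\<rbrakk>
      \<Longrightarrow> \<exists>b. mor b T C \<and> \<tau> = pull \<C> \<E> A b \<delta>"
    and pull_exact: "\<lbrakk>is_ext C A \<delta>; X \<in> \<ss> C A \<delta>; is_ext C T \<tau>; pull \<C> \<E> T (df X n) \<tau> = \<one>\<^bsub>Ext \<E> (ob X n) T\<^esub>\<rbrakk>
      \<Longrightarrow> \<exists>a. mor a A T \<and> \<tau> = push \<C> \<E> C a \<delta>"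
    and inflation_cmp: "\<lbrakk>mor f A B; mor g B D; inflation \<C> \<E> \<ss> f; inflation \<C> \<E> \<ss> g\<rbrakk> \<Longrightarrow> inflation \<C> \<E> \<ss> (g \<cdot> f)"
    and deflation_cmp: "\<lbrakk>mor f A B; mor g B D; deflation n \<C> \<E> \<ss> f; deflation n \<C> \<E> \<ss> g\<rbrakk> \<Longrightarrow> deflation n \<C> \<E> \<ss> (g \<cdot> f)"
    and idempotent_splits: "\<lbrakk>mor e S S; e \<cdot> e = e\<rbrakk> \<Longrightarrow> splits e"
begin

lemma retract_biproduct:
  assumes "mor i X S" "mor p S X" "p \<cdot> i = ide \<C> X"
  shows "\<exists>K j q. biproduct \<C> X K S i j p q"
proof (rule complement_of_retract[OF assms])
  note M = assms(1,2)[unfolded mor_def]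
  have "mor (ide \<C> S \<boxplus> \<boxminus> (i \<cdot> p)) S S" using M by (simp add: mor_def)
  moreover have "(ide \<C> S \<boxplus> \<boxminus> (i \<cdot> p)) \<cdot> (ide \<C> S \<boxplus> \<boxminus> (i \<cdot> p)) = ide \<C> S \<boxplus> \<boxminus> (i \<cdot> p)"
    using M assms(3)[THEN cmp_extend] by (simp add: plus_normal)
  ultimately show "splits (ide \<C> S \<boxplus> \<boxminus> (i \<cdot> p))" by (rule idempotent_splits)
qed

lemma realizes_mor:
  assumes "is_ext C A \<delta>" "X \<in> \<ss> C A \<delta>"
  shows "ob X 0 = A" "ob X (n+1) = C"
    "mor (df X 0) A (ob X 1)" "mor (df X 1) (ob X 1) (ob X 2)" "mor (df X n) (ob X n) C"
    "df X 1 \<cdot> df X 0 = zmor \<C> A (ob X 2)"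
    "X \<in> complexes n \<C>"
proof -
  have 1: "X \<in> complexes n \<C>" "ob X 0 = A" "ob X (n+1) = C"
    using realizes_complex[OF assms] by (auto simp: complexes_from_to_def)
  show "ob X 0 = A" "ob X (n+1) = C"
    "mor (df X 0) A (ob X 1)" "mor (df X 1) (ob X 1) (ob X 2)" "mor (df X n) (ob X n) C" 
    "df X 1 \<cdot> df X 0 = zmor \<C> A (ob X 2)"
    "X \<in> complexes n \<C>"
    using 1 n_pos unfolding complexes_iff by (auto dest: spec[of _ 0] spec[of _ 1] spec[of _ n] simp: numeral_2_eq_2)
qed

lemma ker_first:
  assumes "is_ext C A \<delta>" "X \<in> \<ss> C A \<delta>" "mor g (ob X 1) T" "g \<cdot> df X 0 = zmor \<C> A T"
  shows "\<exists>g'. mor g' (ob X 2) T \<and> g = g' \<cdot> df X 1"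
  using exangle_ker_first[OF n_pos realizes_exangle[OF assms(1,2)] assms(3)] assms(4) realizes_mor(1)[OF assms(1,2)] by simp

lemma ker_push:
  assumes "is_ext C A \<delta>" "X \<in> \<ss> C A \<delta>" "mor g A T"
  shows "push \<C> \<E> C g \<delta> = \<one>\<^bsub>Ext \<E> C T\<^esub> \<longleftrightarrow> (\<exists>g'. mor g' (ob X 1) T \<and> g = g' \<cdot> df X 0)"
  using exangle_ker_push[OF realizes_exangle[OF assms(1,2)]] assms(3) realizes_mor(1,2)[OF assms(1,2)] by simp

lemma ker_pull:
  assumes "is_ext C A \<delta>" "X \<in> \<ss> C A \<delta>" "mor g T C"
  shows "pull \<C> \<E> A g \<delta> = \<one>\<^bsub>Ext \<E> T A\<^esub> \<longleftrightarrow> (\<exists>g'. mor g' T (ob X n) \<and> g = df X n \<cdot> g')"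
  using exangle_ker_pull[OF realizes_exangle[OF assms(1,2)]] assms(3) realizes_mor(1,2)[OF assms(1,2)] by simp

lemma push_first:
  assumes "is_ext C A \<delta>" "X \<in> \<ss> C A \<delta>"
  shows "push \<C> \<E> C (df X 0) \<delta> = \<one>\<^bsub>Ext \<E> C (ob X 1)\<^esub>"
  using realizes_mor(3)[OF assms] by (subst ker_push[OF assms]) (auto simp: mor_def intro!: exI[of _ "ide \<C> (ob X 1)"])

lemma pull_last:
  assumes "is_ext C A \<delta>" "X \<in> \<ss> C A \<delta>"
  shows "pull \<C> \<E> A (df X n) \<delta> = \<one>\<^bsub>Ext \<E> (ob X n) A\<^esub>"
  using realizes_mor(5)[OF assms] by (subst ker_pull[OF assms]) (auto simp: mor_def intro!: exI[of _ "ide \<C> (ob X n)"])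

lemma inflation_of: "\<lbrakk>is_ext C A \<delta>; X \<in> \<ss> C A \<delta>\<rbrakk> \<Longrightarrow> inflation \<C> \<E> \<ss> (df X 0)"
  unfolding inflation_def conflation_def is_ext_def by blast

lemma inflationE:
  assumes "inflation \<C> \<E> \<ss> f" "mor f A B"
  obtains C \<delta> X where "is_ext C A \<delta>" "X \<in> \<ss> C A \<delta>" "df X 0 = f" "ob X 1 = B"
proof -
  obtain X C A' \<delta> where X: "is_ext C A' \<delta>" "X \<in> \<ss> C A' \<delta>" "df X 0 = f"
    using assms unfolding inflation_def conflation_def is_ext_def by blast
  moreover have "A' = A" "ob X 1 = B"
    using realizes_mor(3)[OF X(1,2)] assms(2) X(3) by (auto simp: mor_def)
  ultimately show ?thesis using that by blast
qed

text \<open>With $f$ and $s$ the inflations of $X$ and $S$, let $\epsilon$ be realized by a complex starting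
  with $sf$.  The map $d$ between the end terms satisfies $f_* \epsilon = d^* \sigma$, and $\sigma$ is a
  pullback of $d^* \sigma$ because the inflation of $d^* \sigma$ factors through $s$.\<close>

lemma push_exact_second:
  assumes X: "is_ext C A \<delta>" "X \<in> \<ss> C A \<delta>" and \<sigma>: "is_ext V (ob X 1) \<sigma>"
    and zero: "push \<C> \<E> V (df X 1) \<sigma> = \<one>\<^bsub>Ext \<E> V (ob X 2)\<^esub>"
  shows "\<exists>\<theta>. is_ext V A \<theta> \<and> \<sigma> = push \<C> \<E> V (df X 0) \<theta>"
proof -
  let ?f = "df X 0" and ?B = "ob X 1"
  note XM = realizes_mor[OF X]
  obtain S where S: "S \<in> \<ss> V ?B \<sigma>" using realized[OF \<sigma>] by blast
  note SM = realizes_mor[OF \<sigma> S]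
  let ?s = "df S 0"
  obtain h where h: "mor h (ob S 1) (ob X 2)" "df X 1 = h \<cdot> ?s"
    using ker_push[OF \<sigma> S XM(4)] zero by blast
  have sf: "mor (?s \<cdot> ?f) A (ob S 1)" using SM(3) XM(3) by (simp add: mor_def)
  have "inflation \<C> \<E> \<ss> (?s \<cdot> ?f)"
    using inflation_cmp[OF XM(3) SM(3)] inflation_of X \<sigma> S by blast
  then obtain R' \<epsilon> R where R: "is_ext R' A \<epsilon>" "R \<in> \<ss> R' A \<epsilon>" and Rd: "df R 0 = ?s \<cdot> ?f" "ob R 1 = ob S 1"
    using inflationE[OF _ sf] by metis
  have f\<epsilon>: "is_ext R' ?B (push \<C> \<E> R' ?f \<epsilon>)" using R(1) XM(3) by (rule push_ext)
  have "push \<C> \<E> R' ?s (push \<C> \<E> R' ?f \<epsilon>) = \<one>\<^bsub>Ext \<E> R' (ob S 1)\<^esub>"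
    using push_push[OF R(1) XM(3) SM(3)] push_first[OF R] Rd by simp
  then obtain d where d: "mor d R' V" "push \<C> \<E> R' ?f \<epsilon> = pull \<C> \<E> ?B d \<sigma>"
    using push_exact[OF \<sigma> S f\<epsilon>] by blast
  obtain P where P: "P \<in> \<ss> R' ?B (push \<C> \<E> R' ?f \<epsilon>)" using realized[OF f\<epsilon>] by blast
  note PM = realizes_mor[OF f\<epsilon> P]
  have mpf: "mor (df P 0 \<cdot> ?f) A (ob P 1)" using PM(3) XM(3) by (simp add: mor_def)
  have "push \<C> \<E> R' (df P 0 \<cdot> ?f) \<epsilon> = \<one>\<^bsub>Ext \<E> R' (ob P 1)\<^esub>"
    using push_push[OF R(1) XM(3) PM(3)] push_first[OF f\<epsilon> P] by simp
  then obtain p where p: "mor p (ob S 1) (ob P 1)" "df P 0 \<cdot> ?f = p \<cdot> (?s \<cdot> ?f)"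
    using ker_push[OF R mpf] Rd by auto
  note M = XM(3,4)[unfolded mor_def] SM(3)[unfolded mor_def] PM(3)[unfolded mor_def] p(1)[unfolded mor_def] h(1)[unfolded mor_def]
  \<comment> \<open>The first differential of P and p s agree after composing with f. Their
    difference factors through d_1 = h s, so the first differential of P factors through s as well.
    This is where the hypothesis on \<sigma> is used.\<close>
  have m: "mor (df P 0 \<boxplus> \<boxminus> (p \<cdot> ?s)) ?B (ob P 1)" using M by (simp add: mor_def)
  have "(df P 0 \<boxplus> \<boxminus> (p \<cdot> ?s)) \<cdot> ?f = zmor \<C> A (ob P 1)" using M p(2) by simp
  then obtain z where z: "mor z (ob X 2) (ob P 1)" "df P 0 \<boxplus> \<boxminus> (p \<cdot> ?s) = z \<cdot> df X 1"
    using ker_first[OF X m] by blast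
  have "df P 0 = (df P 0 \<boxplus> \<boxminus> (p \<cdot> ?s)) \<boxplus> p \<cdot> ?s" using M by (simp add: plus_normal)
  also have "\<dots> = (z \<cdot> h \<boxplus> p) \<cdot> ?s" unfolding z(2) h(2) using M z(1)[unfolded mor_def] by simp
  finally have P0: "df P 0 = (z \<cdot> h \<boxplus> p) \<cdot> ?s" .
  have "mor (z \<cdot> h \<boxplus> p) (ob S 1) (ob P 1)" using M z(1) by (simp add: mor_def)
  then have "push \<C> \<E> V (df P 0) \<sigma> = \<one>\<^bsub>Ext \<E> V (ob P 1)\<^esub>"
    using ker_push[OF \<sigma> S PM(3)] P0 by blast
  then obtain b where b: "mor b V R'" "\<sigma> = pull \<C> \<E> ?B b (push \<C> \<E> R' ?f \<epsilon>)"
    using push_exact[OF f\<epsilon> P \<sigma>] by blast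
  then have "\<sigma> = push \<C> \<E> V ?f (pull \<C> \<E> A b \<epsilon>)" using push_pull[OF R(1) b(1) XM(3)] by simp
  then show ?thesis using pull_ext[OF R(1) b(1)] by blast
qed

end

locale extension_closed = realized_extensions +
  fixes \<A> :: "'a set"
  assumes sub_Obj: "\<A> \<subseteq> Obj \<C>"
    and sub_biproduct: "\<lbrakk>biproduct \<C> X Y S i1 i2 p1 p2; X \<in> \<A>; Y \<in> \<A>\<rbrakk> \<Longrightarrow> S \<in> \<A>"
    and sub_summand: "\<lbrakk>biproduct \<C> X Y S i1 i2 p1 p2; S \<in> \<A>\<rbrakk> \<Longrightarrow> X \<in> \<A> \<and> Y \<in> \<A>"
    and sub_extension: "\<lbrakk>C \<in> \<A>; A \<in> \<A>; is_ext C A \<delta>\<rbrakk> \<Longrightarrow> \<exists>X\<in>\<ss> C A \<delta>. \<forall>i\<le>n+1. ob X i \<in> \<A>"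
begin

lemma sub_retract: "\<lbrakk>mor i X S; mor p S X; p \<cdot> i = ide \<C> X; S \<in> \<A>\<rbrakk> \<Longrightarrow> X \<in> \<A>"
  using retract_biproduct sub_summand by blast

text \<open>The diagram chase has two stages. The pushforward of \<epsilon> along f is a pullback of
  \<rho>, and it can be matched by the pushforward of an extension \<theta> living over an object V
  of the subcategory. The resulting error in \<epsilon> dies under f, hence is a pullback of
  \<delta> along some b. The object W is V + C, carrying the pair (\<theta>, \<delta>).\<close>

lemma ext_of_composite:
  assumes X: "is_ext C A \<delta>" "X \<in> \<ss> C A \<delta>" "\<And>i. i \<le> n+1 \<Longrightarrow> ob X i \<in> \<A>"
    and Y: "is_ext F (ob X 1) \<rho>" "Y \<in> \<ss> F (ob X 1) \<rho>" "\<And>i. i \<le> n+1 \<Longrightarrow> ob Y i \<in> \<A>"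
    and Z: "is_ext Z' A \<epsilon>" "Z \<in> \<ss> Z' A \<epsilon>" "df Z 0 = df Y 0 \<cdot> df X 0" "ob Z 1 = ob Y 1"
  shows "\<exists>W \<theta> c. W \<in> \<A> \<and> is_ext W A \<theta> \<and> push \<C> \<E> W (df Y 0 \<cdot> df X 0) \<theta> = \<one>\<^bsub>Ext \<E> W (ob Y 1)\<^esub> \<and>
    mor c Z' W \<and> \<epsilon> = pull \<C> \<E> A c \<theta>"
proof -
  let ?f = "df X 0" and ?B = "ob X 1" and ?g = "df Y 0" and ?D = "ob Y 1"
  note XM = realizes_mor[OF X(1,2)]
  note YM = realizes_mor[OF Y(1,2)]
  note ZM = realizes_mor[OF Z(1,2)]
  have F: "F \<in> \<A>" and C: "C \<in> \<A>" using XM(2) YM(2) X(3)[of "n+1"] Y(3)[of "n+1"] by auto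
  \<comment> \<open>Pushing \<rho> along d_1 measures the failure of \<rho> to come from A. The last
    differential e of a realization of \<rho>' kills it, so by exactness at E(-, X_1) the pullback
    of \<rho> along e does come from A.\<close>
  define \<rho>' where "\<rho>' = push \<C> \<E> F (df X 1) \<rho>"
  have \<rho>': "is_ext F (ob X 2) \<rho>'" unfolding \<rho>'_def using Y(1) XM(4) by (rule push_ext)
  have "ob X 2 \<in> \<A>" using X(3)[of 2] n_pos by simp
  then obtain Y' where Y': "Y' \<in> \<ss> F (ob X 2) \<rho>'" "\<And>i. i \<le> n+1 \<Longrightarrow> ob Y' i \<in> \<A>"
    using sub_extension[OF F _ \<rho>'] by blast
  note YM' = realizes_mor[OF \<rho>' Y'(1)]
  let ?V = "ob Y' n" and ?e = "df Y' n"
  have V: "?V \<in> \<A>" using Y'(2)[of n] by simp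
  have \<sigma>: "is_ext ?V ?B (pull \<C> \<E> ?B ?e \<rho>)" using Y(1) YM'(5) by (rule pull_ext)
  have "push \<C> \<E> ?V (df X 1) (pull \<C> \<E> ?B ?e \<rho>) = \<one>\<^bsub>Ext \<E> ?V (ob X 2)\<^esub>"
    using push_pull[OF Y(1) YM'(5) XM(4)] pull_last[OF \<rho>' Y'(1)] by (simp add: \<rho>'_def)
  then obtain \<theta> where \<theta>: "is_ext ?V A \<theta>" "pull \<C> \<E> ?B ?e \<rho> = push \<C> \<E> ?V ?f \<theta>"
    using push_exact_second[OF X(1,2) \<sigma>] by blast
  have f\<epsilon>: "is_ext Z' ?B (push \<C> \<E> Z' ?f \<epsilon>)" using Z(1) XM(3) by (rule push_ext)
  have "push \<C> \<E> Z' ?g (push \<C> \<E> Z' ?f \<epsilon>) = \<one>\<^bsub>Ext \<E> Z' ?D\<^esub>"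
    using push_push[OF Z(1) XM(3) YM(3)] push_first[OF Z(1,2)] Z(3,4) by simp
  then obtain d where d: "mor d Z' F" "push \<C> \<E> Z' ?f \<epsilon> = pull \<C> \<E> ?B d \<rho>"
    using push_exact[OF Y(1,2) f\<epsilon>] by blast
  \<comment> \<open>Since d_1 f = 0, the map d kills \<rho>' and therefore factors through
    e.\<close>
  have "pull \<C> \<E> (ob X 2) d \<rho>' = push \<C> \<E> Z' (df X 1 \<cdot> ?f) \<epsilon>"
    using push_pull[OF Y(1) d(1) XM(4)] push_push[OF Z(1) XM(3,4)] d(2) by (simp add: \<rho>'_def)
  also have "\<dots> = \<one>\<^bsub>Ext \<E> Z' (ob X 2)\<^esub>"
    using XM(4,6) push_zero[OF Z(1)] by (simp add: mor_def)
  finally obtain c where c: "mor c Z' ?V" "d = ?e \<cdot> c"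
    using ker_pull[OF \<rho>' Y'(1) d(1)] by blast
  let ?c\<theta> = "pull \<C> \<E> A c \<theta>"
  have c\<theta>: "is_ext Z' A ?c\<theta>" using \<theta>(1) c(1) by (rule pull_ext)
  interpret group "Ext \<E> Z' A" using group_Ext[OF c\<theta>] comm_group.axioms(2) by blast
  \<comment> \<open>\<mu> is the difference between \<epsilon> and the pullback of \<theta> along c.
    Both have the same pushforward along f, so \<mu> comes from \<delta>.\<close>
  let ?\<mu> = "\<epsilon> \<otimes>\<^bsub>Ext \<E> Z' A\<^esub> inv\<^bsub>Ext \<E> Z' A\<^esub> ?c\<theta>"
  have \<mu>: "is_ext Z' A ?\<mu>" using ext_mult[OF Z(1) ext_inv[OF c\<theta>]] .
  have "push \<C> \<E> Z' ?f ?c\<theta> = push \<C> \<E> Z' ?f \<epsilon>"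
    using push_pull[OF \<theta>(1) c(1) XM(3)] \<theta>(2) pull_pull[OF Y(1) YM'(5) c(1)] d(2) c(2) by simp
  then have "push \<C> \<E> Z' ?f ?\<mu> = \<one>\<^bsub>Ext \<E> Z' ?B\<^esub>"
    using push_mult[OF Z(1) ext_inv[OF c\<theta>] XM(3)] push_inv[OF c\<theta> XM(3)] f\<epsilon> group_Ext[OF f\<epsilon>]
    by (simp add: is_ext_def comm_group_def group.r_inv)
  then obtain b where b: "mor b Z' C" "?\<mu> = pull \<C> \<E> A b \<delta>"
    using push_exact[OF X(1,2) \<mu>] by blast
  obtain W i1 i2 p1 p2 where W: "biproduct \<C> ?V C W i1 i2 p1 p2"
    using ex_biproduct V C sub_Obj by blast
  obtain \<theta>' where \<theta>': "is_ext W A \<theta>'" "pull \<C> \<E> A i1 \<theta>' = \<theta>" "pull \<C> \<E> A i2 \<theta>' = \<delta>"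
    "\<And>a B. \<lbrakk>mor a A B; push \<C> \<E> ?V a \<theta> = \<one>\<^bsub>Ext \<E> ?V B\<^esub>; push \<C> \<E> C a \<delta> = \<one>\<^bsub>Ext \<E> C B\<^esub>\<rbrakk>
      \<Longrightarrow> push \<C> \<E> W a \<theta>' = \<one>\<^bsub>Ext \<E> W B\<^esub>"
    using ext_cotuple[OF W \<theta>(1) X(1)] by metis
  note WM = W[unfolded biproduct_iff]
  have gf: "mor (?g \<cdot> ?f) A ?D" using XM(3) YM(3) by (rule mor_cmp)
  have "push \<C> \<E> ?V (?g \<cdot> ?f) \<theta> = push \<C> \<E> ?V ?g (pull \<C> \<E> ?B ?e \<rho>)"
    using push_push[OF \<theta>(1) XM(3) YM(3)] \<theta>(2) by simp
  also have "\<dots> = \<one>\<^bsub>Ext \<E> ?V ?D\<^esub>"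
    using push_pull[OF Y(1) YM'(5) YM(3)] push_first[OF Y(1,2)] pull_one[OF _ YM'(5)] YM(3) by (simp add: mor_def)
  finally have 1: "push \<C> \<E> ?V (?g \<cdot> ?f) \<theta> = \<one>\<^bsub>Ext \<E> ?V ?D\<^esub>" .
  have "push \<C> \<E> C (?g \<cdot> ?f) \<delta> = \<one>\<^bsub>Ext \<E> C ?D\<^esub>"
    using push_push[OF X(1) XM(3) YM(3)] push_first[OF X(1,2)] push_one[OF _ YM(3)] X(1) by (simp add: is_ext_def)
  then have 2: "push \<C> \<E> W (?g \<cdot> ?f) \<theta>' = \<one>\<^bsub>Ext \<E> W ?D\<^esub>" using \<theta>'(4)[OF gf 1] by blast
  let ?c = "i1 \<cdot> c \<boxplus> i2 \<cdot> b"
  have m: "mor (i1 \<cdot> c) Z' W" "mor (i2 \<cdot> b) Z' W" using WM c b by (auto simp: mor_def)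
  have "pull \<C> \<E> A ?c \<theta>' = ?c\<theta> \<otimes>\<^bsub>Ext \<E> Z' A\<^esub> ?\<mu>"
    using pull_plus[OF \<theta>'(1) m] pull_pull[OF \<theta>'(1) _ c(1), of i1] pull_pull[OF \<theta>'(1) _ b(1), of i2] WM \<theta>'(2,3) b(2) by simp
  also have "\<dots> = ?\<mu> \<otimes>\<^bsub>Ext \<E> Z' A\<^esub> ?c\<theta>"
    using group_Ext[OF c\<theta>] c\<theta> \<mu> by (simp add: comm_group_def comm_monoid.m_comm is_ext_def)
  also have "\<dots> = \<epsilon>" using c\<theta> Z(1) by (simp add: is_ext_def m_assoc)
  finally have "\<epsilon> = pull \<C> \<E> A ?c \<theta>'" by simp
  moreover have "mor ?c Z' W" using m by (rule mor_plus)
  moreover have "W \<in> \<A>" using sub_biproduct[OF W V C] .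
  ultimately show ?thesis using \<theta>'(1) 2 by blast
qed


text \<open>The term of $Q$ in degree $2$ is the complement of $T_1$ embedded into $T_2 \oplus D$.\<close>

lemma replace_first:
  assumes n: "2 \<le> n" and T: "is_ext W A \<theta>" "T \<in> \<ss> W A \<theta>" "\<And>i. i \<le> n+1 \<Longrightarrow> ob T i \<in> \<A>"
    and D: "D \<in> \<A>" and x: "mor x (ob T 1) D" and y: "mor y D (ob T 1)" "y \<cdot> (x \<cdot> df T 0) = df T 0"
  shows "\<exists>Q \<in> \<ss> W A \<theta>. df Q 0 = x \<cdot> df T 0 \<and> (\<forall>i\<le>n+1. ob Q i \<in> \<A>)"
proof -
  note TM = realizes_mor[OF T(1,2)]
  have TC: "T \<in> complexes n \<C>" by (rule TM(7))
  note TC' = TC[unfolded complexes_iff, THEN conjunct1, rule_format]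
  note TC'' = TC[unfolded complexes_iff, THEN conjunct2, rule_format]
  let ?d0 = "df T 0" and ?d1 = "df T 1" and ?d2 = "df T 2" and ?T1 = "ob T 1" and ?T2 = "ob T 2" and ?T3 = "ob T 3"
  have d0: "mor ?d0 A ?T1" and d1: "mor ?d1 ?T1 ?T2" and d2: "mor ?d2 ?T2 ?T3" and dd: "?d1 \<cdot> ?d0 = zmor \<C> A ?T2" "?d2 \<cdot> ?d1 = zmor \<C> ?T1 ?T3"
    using TM(3,4,6) TC'[of 2] TC''[of 1] n by (simp_all add: numeral_2_eq_2 numeral_3_eq_3)
  note M = d0[unfolded mor_def] d1[unfolded mor_def] d2[unfolded mor_def] x[unfolded mor_def] y(1)[unfolded mor_def]
  \<comment> \<open>yx fixes d_0, so 1 - yx kills d_0 and factors through d_1. The factor v_1 gives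
    the left inverse of the embedding below and, up to sign, the homotopy on T.\<close>
  have m: "mor (ide \<C> ?T1 \<boxplus> \<boxminus> (y \<cdot> x)) ?T1 ?T1" using M by (simp add: mor_def)
  have "(ide \<C> ?T1 \<boxplus> \<boxminus> (y \<cdot> x)) \<cdot> ?d0 = zmor \<C> A ?T1" using M y(2) by simp
  then obtain v1 where v1: "mor v1 ?T2 ?T1" "ide \<C> ?T1 \<boxplus> \<boxminus> (y \<cdot> x) = v1 \<cdot> ?d1"
    using ker_first[OF T(1,2) m] by blast
  obtain S jT jD rT rD where S: "biproduct \<C> ?T2 D S jT jD rT rD"
    using ex_biproduct M by blast
  note S' = S[unfolded biproduct_iff]
  note M = M v1(1)[unfolded mor_def] S'[unfolded mor_def]
  \<comment> \<open>The signs give vu = v_1 d_1 + yx = 1, while the relation ru = 0 becomes the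
    commuting square f_1 x = \<phi> d_1.\<close>
  define u where "u = jT \<cdot> ?d1 \<boxplus> \<boxminus> (jD \<cdot> x)"
  define v where "v = v1 \<cdot> rT \<boxplus> \<boxminus> (y \<cdot> rD)"
  have u: "mor u ?T1 S" and v: "mor v S ?T1" using M by (simp_all add: u_def v_def mor_def)
  have rTu: "rT \<cdot> u = ?d1" and rDu: "rD \<cdot> u = \<boxminus> x" and vjT: "v \<cdot> jT = v1" and vjD: "v \<cdot> jD = \<boxminus> y"
    unfolding u_def v_def using M S'[THEN conjunct2, THEN conjunct2, THEN conjunct2, THEN conjunct2]
    by (simp_all add: cmp_extend[of rT jT] cmp_extend[of rT jD] cmp_extend[of rD jT] cmp_extend[of rD jD])
  have "v \<cdot> u = v1 \<cdot> (rT \<cdot> u) \<boxplus> \<boxminus> (y \<cdot> (rD \<cdot> u))" using M u[unfolded mor_def] by (simp add: v_def)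
  also have "\<dots> = v1 \<cdot> ?d1 \<boxplus> y \<cdot> x" unfolding rTu rDu using M by simp
  also have "\<dots> = ide \<C> ?T1" unfolding v1(2)[symmetric] using M by (simp add: plus_normal)
  finally have vu: "v \<cdot> u = ide \<C> ?T1" .
  obtain K k r where K: "biproduct \<C> ?T1 K S u k v r" using retract_biproduct[OF u v vu] by blast
  have "S \<in> \<A>" using sub_biproduct[OF S] T(3)[of 2] D n by simp
  then have KA: "K \<in> \<A>" using sub_summand[OF K] by blast
  note K' = K[unfolded biproduct_iff]
  note M = M K'[unfolded mor_def]
  have kr: "k \<cdot> r = ide \<C> S \<boxplus> \<boxminus> (u \<cdot> v)"
  proof -
    have "mor (u \<cdot> v) S S" "mor (k \<cdot> r) S S" using M by (simp_all add: mor_def)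
    then have "k \<cdot> r = (u \<cdot> v \<boxplus> k \<cdot> r) \<boxplus> \<boxminus> (u \<cdot> v)" by (simp add: mor_def plus_normal)
    then show ?thesis using K' by simp
  qed
  \<comment> \<open>Composites passing through the complement K are computed with kr = 1 - uv,
    without any further knowledge of K.\<close>
  have krk: "k \<cdot> (r \<cdot> a) = a \<boxplus> \<boxminus> (u \<cdot> (v \<cdot> a))" if "arr a" "cod a = S" for a
    using kr[THEN cmp_extend, of a] M that by simp
  \<comment> \<open>\<open>f1\<close> and \<open>\<phi>\<close> are the components of r on D and
    T_2, and \<open>\<psi>\<close> is the T_2 component of k. Minus the D component of k will be the
    homotopy \<open>h\<close>.\<close>
  define f1 where "f1 = r \<cdot> jD"
  define f2 where "f2 = ?d2 \<cdot> (rT \<cdot> k)"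
  define \<phi> where "\<phi> = r \<cdot> jT"
  define \<psi> where "\<psi> = rT \<cdot> k"
  have F: "mor f1 D K" "mor f2 K ?T3" "mor \<phi> ?T2 K" "mor \<psi> K ?T2"
    using M by (simp_all add: f1_def f2_def \<phi>_def \<psi>_def mor_def)
  have "r \<cdot> (jT \<cdot> ?d1 \<boxplus> \<boxminus> (jD \<cdot> x)) = \<phi> \<cdot> ?d1 \<boxplus> \<boxminus> (f1 \<cdot> x)"
    using M by (simp add: f1_def \<phi>_def)
  then have "\<phi> \<cdot> ?d1 \<boxplus> \<boxminus> (f1 \<cdot> x) = zmor \<C> ?T1 K" using K' unfolding u_def[symmetric] by metis
  then have f1x: "f1 \<cdot> x = \<phi> \<cdot> ?d1"
    using diff_eq_zero_iff[of "\<phi> \<cdot> ?d1" "f1 \<cdot> x"] M F[unfolded mor_def] by simp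
  have \<psi>f1: "\<psi> \<cdot> f1 = ?d1 \<cdot> y"
    unfolding \<psi>_def f1_def using M u v by (simp add: krk cmp_extend[OF rTu] vjD)
  have \<psi>\<phi>: "\<psi> \<cdot> \<phi> = ide \<C> ?T2 \<boxplus> \<boxminus> (?d1 \<cdot> v1)"
    unfolding \<psi>_def \<phi>_def using M u v by (simp add: krk cmp_extend[OF rTu] vjT)
  have f2\<psi>: "f2 = ?d2 \<cdot> \<psi>" by (simp add: f2_def \<psi>_def)
  have f2\<phi>: "f2 \<cdot> \<phi> = ?d2"
    unfolding f2\<psi> using M F[unfolded mor_def] dd(2)[THEN cmp_extend] by (simp add: \<psi>\<phi>)
  have f2f1: "f2 \<cdot> f1 = zmor \<C> D ?T3"
    unfolding f2\<psi> using M F[unfolded mor_def] dd(2)[THEN cmp_extend] by (simp add: \<psi>f1)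
  define h where "h = \<boxminus> (rD \<cdot> k)"
  have h: "mor h K D" using M by (simp add: h_def mor_def)
  have hf1: "h \<cdot> f1 = x \<cdot> y \<boxplus> \<boxminus> (ide \<C> D)"
    unfolding h_def f1_def using M u v by (simp add: krk cmp_extend[OF rDu] vjD plus_normal)
  have dist: "r \<cdot> ((a \<boxplus> b) \<cdot> k) = r \<cdot> (a \<cdot> k) \<boxplus> r \<cdot> (b \<cdot> k)" if "mor a S S" "mor b S S" for a b
    using that M by (simp add: mor_def)
  have "\<phi> \<cdot> \<psi> \<boxplus> \<boxminus> (f1 \<cdot> h) = r \<cdot> ((jT \<cdot> rT) \<cdot> k) \<boxplus> r \<cdot> ((jD \<cdot> rD) \<cdot> k)"
    unfolding \<phi>_def \<psi>_def f1_def h_def using M by simp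
  also have "\<dots> = r \<cdot> ((jT \<cdot> rT \<boxplus> jD \<cdot> rD) \<cdot> k)"
    using M by (intro dist[symmetric]) (simp_all add: mor_def)
  also have "jT \<cdot> rT \<boxplus> jD \<cdot> rD = ide \<C> S" using S' by blast
  also have "r \<cdot> (ide \<C> S \<cdot> k) = ide \<C> K" using M by simp
  finally have "\<phi> \<cdot> \<psi> \<boxplus> \<boxminus> (f1 \<cdot> h) = ide \<C> K" .
  moreover have "(\<phi> \<cdot> \<psi> \<boxplus> \<boxminus> (f1 \<cdot> h)) \<boxplus> (f1 \<cdot> h \<boxplus> \<boxminus> (ide \<C> K)) = \<phi> \<cdot> \<psi> \<boxplus> \<boxminus> (ide \<C> K)"
    using M F[unfolded mor_def] h[unfolded mor_def] by (simp add: plus_normal)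
  ultimately have \<phi>\<psi>: "\<phi> \<cdot> \<psi> \<boxplus> \<boxminus> (ide \<C> K) = f1 \<cdot> h"
    using M F[unfolded mor_def] h[unfolded mor_def] by (simp add: plus_normal)
  \<comment> \<open>For n = 2 the term T_3 is already the end term. The bound 2 \<le> n makes degree
    2 interior, so replacing T_2 by K preserves both ends.\<close>
  define Q where "Q = \<lparr>ob = (ob T)(1 := D, 2 := K), df = (df T)(0 := x \<cdot> ?d0, 1 := f1, 2 := f2)\<rparr>"
  have Qob: "ob Q 0 = A" "ob Q (Suc 0) = D" "ob Q 1 = D" "ob Q 2 = K" "ob Q (Suc (Suc 0)) = K" "\<And>i. ob Q (Suc (Suc (Suc i))) = ob T (Suc (Suc (Suc i)))"
    and Qdf: "df Q 0 = x \<cdot> ?d0" "df Q (Suc 0) = f1" "df Q 2 = f2" "df Q (Suc (Suc 0)) = f2" "\<And>i. df Q (Suc (Suc (Suc i))) = df T (Suc (Suc (Suc i)))"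
    using TM(1) by (simp_all add: Q_def numeral_2_eq_2)
  note M' = M F[unfolded mor_def] h[unfolded mor_def]
  have z0: "f1 \<cdot> (x \<cdot> ?d0) = zmor \<C> A K"
    using f1x[THEN cmp_extend, of ?d0] dd(1) M' by simp
  have z2: "df T (Suc (Suc (Suc 0))) \<cdot> f2 = zmor \<C> K (ob T (Suc (Suc (Suc (Suc 0)))))" if "Suc (Suc 0) < n"
    using TC''[OF that, THEN cmp_extend, of \<psi>] TC'[of "Suc (Suc (Suc 0))"] M' that
    by (simp add: f2\<psi> mor_def numeral_2_eq_2 numeral_3_eq_3)
  have Q: "Q \<in> complexes n \<C>"
    unfolding complexes_iff
  proof (intro conjI allI impI)
    fix i assume "i \<le> n"
    then show "mor (df Q i) (ob Q i) (ob Q (i+1))"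
      by (cases i rule: nat_cases4) (use M' TC' in \<open>simp_all add: Qob Qdf mor_def numeral_3_eq_3\<close>)
  next
    fix i assume "i < n"
    then show "df Q (i+1) \<cdot> df Q i = zmor \<C> (ob Q i) (ob Q (i+2))"
      by (cases i rule: nat_cases4)
        (use M' TC' TC'' f2f1 z0 z2 in \<open>simp_all add: Qob Qdf mor_def numeral_3_eq_3\<close>)
  qed
  define \<alpha> where "\<alpha> i = (if i = 1 then x else if i = 2 then \<phi> else ide \<C> (ob T i))" for i :: nat
  define \<beta> where "\<beta> i = (if i = 1 then y else if i = 2 then \<psi> else ide \<C> (ob T i))" for i :: nat
  have \<alpha>s: "\<alpha> 0 = ide \<C> A" "\<alpha> (Suc 0) = x" "\<alpha> (Suc (Suc 0)) = \<phi>" "\<And>i. \<alpha> (Suc (Suc (Suc i))) = ide \<C> (ob T (Suc (Suc (Suc i))))"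
    and \<beta>s: "\<beta> 0 = ide \<C> A" "\<beta> (Suc 0) = y" "\<beta> (Suc (Suc 0)) = \<psi>" "\<And>i. \<beta> (Suc (Suc (Suc i))) = ide \<C> (ob T (Suc (Suc (Suc i))))"
    using TM(1) by (simp_all add: \<alpha>_def \<beta>_def)
  have To: "ob T i \<in> Obj \<C>" if "i \<le> n+1" for i using T(3)[OF that] sub_Obj by blast
  have T2: "?T2 = ob T (Suc (Suc 0))" and T3: "?T3 = ob T (Suc (Suc (Suc 0)))" and d2': "?d2 = df T (Suc (Suc 0))"
    by (simp_all add: numeral_2_eq_2 numeral_3_eq_3)
  note simps = Qob Qdf \<alpha>s \<beta>s TM(1) mor_def T2 T3 d2'
  note eqs = f1x \<psi>f1 \<psi>\<phi> f2\<phi> f2\<psi>[symmetric]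
  have n1: "n + 1 = Suc (Suc (Suc (n - 2)))" using n by simp
  have ends: "\<alpha> (n+1) = ide \<C> (ob T (n+1))" "\<beta> (n+1) = ide \<C> (ob T (n+1))" "ob Q (n+1) = ob T (n+1)"
    using n by (simp_all add: \<alpha>_def \<beta>_def Q_def)
  have \<alpha>: "chain_map_fixing_ends n \<C> T Q \<alpha>"
    unfolding chain_map_fixing_ends_def chain_map_iff[OF TC Q]
  proof (intro conjI allI impI)
    fix i assume "i \<le> n + 1"
    then show "mor (\<alpha> i) (ob T i) (ob Q i)"
      by (cases i rule: nat_cases4) (use M' To in \<open>simp_all add: simps\<close>)
  next
    fix i assume "i \<le> n"
    then show "\<alpha> (i+1) \<cdot> df T i = df Q i \<cdot> \<alpha> i"
      by (cases i rule: nat_cases4) (use M' TC' eqs in \<open>simp_all add: simps\<close>)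
  qed (unfold n1, simp_all add: simps)
  have \<beta>: "chain_map_fixing_ends n \<C> Q T \<beta>"
    unfolding chain_map_fixing_ends_def chain_map_iff[OF Q TC]
  proof (intro conjI allI impI)
    fix i assume "i \<le> n + 1"
    then show "mor (\<beta> i) (ob Q i) (ob T i)"
      by (cases i rule: nat_cases4) (use M' To in \<open>simp_all add: simps\<close>)
  next
    fix i assume "i \<le> n"
    then show "\<beta> (i+1) \<cdot> df Q i = df T i \<cdot> \<beta> i"
      by (cases i rule: nat_cases4) (use M' TC' eqs y(2) in \<open>simp_all add: simps\<close>)
  qed (unfold n1, simp_all add: simps)
  have maps: "mor (\<alpha> i) (ob T i) (ob Q i)" "mor (\<beta> i) (ob Q i) (ob T i)" if "i \<le> n+1" for i
    using \<alpha> \<beta> that unfolding chain_map_fixing_ends_def chain_map_iff[OF TC Q] chain_map_iff[OF Q TC] by auto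
  have Qo: "ob Q i \<in> Obj \<C>" if "i \<le> n+1" for i using Q that by (simp add: complexes_def)
  have mc: "mor (\<beta> i \<cdot> \<alpha> i) (ob T i) (ob T i)" "mor (\<alpha> i \<cdot> \<beta> i) (ob Q i) (ob Q i)"
    "mor (ide \<C> (ob T i)) (ob T i) (ob T i)" "mor (ide \<C> (ob Q i)) (ob Q i) (ob Q i)" if "i \<le> n+1" for i
    using maps[OF that] To[OF that] Qo[OF that] by (simp_all add: mor_def)
  have yx: "y \<cdot> x \<boxplus> \<boxminus> (ide \<C> ?T1) = (\<boxminus> v1) \<cdot> ?d1"
  proof -
    have "(\<boxminus> v1) \<cdot> ?d1 = \<boxminus> (ide \<C> ?T1 \<boxplus> \<boxminus> (y \<cdot> x))" unfolding v1(2) using M by simp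
    then show ?thesis using M by (simp add: plus_comm)
  qed
  \<comment> \<open>Both homotopies are concentrated in one place, between degrees 2 and 1; in all
    other degrees the composite chain maps are identities.\<close>
  define hT where "hT i = (if i = 1 then \<boxminus> v1 else zmor \<C> (ob T (i+1)) (ob T i))" for i :: nat
  define hQ where "hQ i = (if i = 1 then h else zmor \<C> (ob Q (i+1)) (ob Q i))" for i :: nat
  have hs: "hT 0 = zmor \<C> ?T1 A" "hT (Suc 0) = \<boxminus> v1" "\<And>i. hT (Suc (Suc i)) = zmor \<C> (ob T (Suc (Suc (Suc i)))) (ob T (Suc (Suc i)))"
    "hQ 0 = zmor \<C> D A" "hQ (Suc 0) = h" "\<And>i. hQ (Suc (Suc i)) = zmor \<C> (ob Q (Suc (Suc (Suc i)))) (ob Q (Suc (Suc i)))"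
    by (simp_all add: hT_def hQ_def Qob TM(1))
  have "homotopic n \<C> T T (\<lambda>i. \<beta> i \<cdot> \<alpha> i) (\<lambda>i. ide \<C> (ob T i))"
  proof (subst homotopic_iff[OF TC TC], goal_cases)
    case 3
    show ?case
    proof (intro exI[of _ hT] conjI allI impI)
      fix i assume "i \<le> n"
      then show "mor (hT i) (ob T (i+1)) (ob T i)"
        by (cases i rule: nat_cases4) (use M' To in \<open>simp_all add: simps hs\<close>)
    next
      fix i assume "i < n"
      then show "\<beta> (i+1) \<cdot> \<alpha> (i+1) \<boxplus> \<boxminus> (ide \<C> (ob T (i+1))) = df T i \<cdot> hT i \<boxplus> hT (i+1) \<cdot> df T (i+1)"
        by (cases i rule: nat_cases4) (use M' To TC' yx eqs in \<open>simp_all add: simps hs plus_normal\<close>)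
    next
      show "\<beta> (n+1) \<cdot> \<alpha> (n+1) \<boxplus> \<boxminus> (ide \<C> (ob T (n+1))) = df T n \<cdot> hT n"
        using n To[of "n+1"] To[of n] TC'[of n] ends by (simp add: mor_def hT_def)
    qed (use M' in \<open>simp_all add: simps hs\<close>)
  qed (use mc in auto)
  moreover have "homotopic n \<C> Q Q (\<lambda>i. \<alpha> i \<cdot> \<beta> i) (\<lambda>i. ide \<C> (ob Q i))"
  proof (subst homotopic_iff[OF Q Q], goal_cases)
    case 3
    show ?case
    proof (intro exI[of _ hQ] conjI allI impI)
      fix i assume "i \<le> n"
      then show "mor (hQ i) (ob Q (i+1)) (ob Q i)"
        by (cases i rule: nat_cases4) (use M' To in \<open>simp_all add: simps hs\<close>)
    next
      fix i assume "i < n"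
      then show "\<alpha> (i+1) \<cdot> \<beta> (i+1) \<boxplus> \<boxminus> (ide \<C> (ob Q (i+1))) = df Q i \<cdot> hQ i \<boxplus> hQ (i+1) \<cdot> df Q (i+1)"
        by (cases i rule: nat_cases4) (use M' To TC' hf1 \<phi>\<psi> eqs in \<open>simp_all add: simps hs plus_normal\<close>)
    next
      show "\<alpha> (n+1) \<cdot> \<beta> (n+1) \<boxplus> \<boxminus> (ide \<C> (ob Q (n+1))) = df Q n \<cdot> hQ n"
        using n Qo[of "n+1"] Qo[of n] Q[unfolded complexes_iff, THEN conjunct1, rule_format, of n] ends
        by (simp add: mor_def hQ_def)
    qed (use M' in \<open>simp_all add: simps hs\<close>)
  qed (use mc in auto)
  ultimately have "homotopy_equiv n T Q"
    unfolding homotopy_equiv_def homotopy_inverse_def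
    by (intro conjI exI[of _ \<alpha>] exI[of _ \<beta>]) (use TC Q \<alpha> \<beta> Qob(1) ends(3) TM(1) in simp_all)
  then have "Q \<in> \<ss> W A \<theta>" using realizes_equiv[OF T(1,2)] by blast
  moreover have "ob Q i \<in> \<A>" if "i \<le> n+1" for i
    using that by (cases i rule: nat_cases4) (use T(3)[of 0] T(3) D KA TM(1) in \<open>auto simp: Qob\<close>)
  ultimately show ?thesis using Qdf(1) by blast
qed

lemma inflation_in_sub_cmp:
  assumes X: "is_ext C A \<delta>" "X \<in> \<ss> C A \<delta>" "\<And>i. i \<le> n+1 \<Longrightarrow> ob X i \<in> \<A>"
    and Y: "is_ext F (ob X 1) \<rho>" "Y \<in> \<ss> F (ob X 1) \<rho>" "\<And>i. i \<le> n+1 \<Longrightarrow> ob Y i \<in> \<A>"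
  shows "\<exists>W \<theta> Q. is_ext W A \<theta> \<and> Q \<in> \<ss> W A \<theta> \<and> df Q 0 = df Y 0 \<cdot> df X 0 \<and> (\<forall>i\<le>n+1. ob Q i \<in> \<A>)"
proof -
  let ?gf = "df Y 0 \<cdot> df X 0"
  note XM = realizes_mor[OF X(1,2)]
  note YM = realizes_mor[OF Y(1,2)]
  have gf: "mor ?gf A (ob Y 1)" using mor_cmp XM(3) YM(3) by blast
  have A: "A \<in> \<A>" and D: "ob Y 1 \<in> \<A>" using X(3)[of 0] Y(3)[of 1] XM(1) by auto
  have "inflation \<C> \<E> \<ss> ?gf"
    using inflation_cmp XM(3) YM(3) inflation_of X Y by blast
  then obtain Z' \<epsilon> Z where Z: "is_ext Z' A \<epsilon>" "Z \<in> \<ss> Z' A \<epsilon>" "df Z 0 = ?gf" "ob Z 1 = ob Y 1"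
    using inflationE[OF _ gf] by metis
  note ZM = realizes_mor[OF Z(1,2)]
  obtain W \<theta> c where W: "W \<in> \<A>" "is_ext W A \<theta>" "push \<C> \<E> W ?gf \<theta> = \<one>\<^bsub>Ext \<E> W (ob Y 1)\<^esub>" "mor c Z' W" "\<epsilon> = pull \<C> \<E> A c \<theta>"
    using ext_of_composite[OF X Y Z] by blast
  consider "n = 1" | "2 \<le> n" using n_pos by linarith
  then show ?thesis
  proof cases
    case 1
    obtain c' where c': "mor c' W Z'" "\<theta> = pull \<C> \<E> A c' \<epsilon>"
      \<comment> \<open>Now \<epsilon> and \<theta> are pullbacks of each other, so c'c fixes
        \<epsilon> and 1 - c'c will factor through the last differential of Z.\<close>
      using push_exact[OF Z(1,2) W(2)] W(3) Z(3,4) by auto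
    note M = c'(1)[unfolded mor_def] W(4)[unfolded mor_def]
    have m: "mor (ide \<C> Z') Z' Z'" "mor (c' \<cdot> c) Z' Z'" using M by (simp_all add: mor_def)
    have "pull \<C> \<E> A (ide \<C> Z') \<epsilon> = pull \<C> \<E> A (c' \<cdot> c) \<epsilon>"
      using pull_ide[OF Z(1)] pull_pull[OF Z(1) c'(1) W(4)] W(5)[symmetric] c'(2)[symmetric] by simp
    then have "pull \<C> \<E> A (ide \<C> Z' \<boxplus> \<boxminus> (c' \<cdot> c)) \<epsilon> = \<one>\<^bsub>Ext \<E> Z' A\<^esub>"
      using pull_diff[OF Z(1) m] by simp
    moreover have mm: "mor (ide \<C> Z' \<boxplus> \<boxminus> (c' \<cdot> c)) Z' Z'" using M by (simp add: mor_def)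
    ultimately obtain l where l: "mor l Z' (ob Z n)" "ide \<C> Z' \<boxplus> \<boxminus> (c' \<cdot> c) = df Z n \<cdot> l"
      using ker_pull[OF Z(1,2) mm] by blast
    \<comment> \<open>For n = 1 the terms Z_n and Z_1 coincide, and Z_1 is the codomain of the
      second inflation. Then c'c + d_n l = 1 exhibits Z' as a retract of W + Z_n.\<close>
    have ZA: "ob Z n \<in> \<A>" using 1 Z(4) D by simp
    obtain S j1 j2 p1 p2 where S: "biproduct \<C> W (ob Z n) S j1 j2 p1 p2"
      using ex_biproduct W(1) ZA sub_Obj by blast
    note S' = S[unfolded biproduct_iff]
    note M = M l(1)[unfolded mor_def] ZM(5)[unfolded mor_def] S'[unfolded mor_def]
    have "(c' \<cdot> p1 \<boxplus> df Z n \<cdot> p2) \<cdot> (j1 \<cdot> c \<boxplus> j2 \<cdot> l) = c' \<cdot> c \<boxplus> df Z n \<cdot> l"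
      using M by (simp add: cmp_extend[of p1 j1] cmp_extend[of p1 j2] cmp_extend[of p2 j1] cmp_extend[of p2 j2])
    also have "\<dots> = ide \<C> Z'" unfolding l(2)[symmetric] using M by (simp add: plus_normal)
    finally have "(c' \<cdot> p1 \<boxplus> df Z n \<cdot> p2) \<cdot> (j1 \<cdot> c \<boxplus> j2 \<cdot> l) = ide \<C> Z'" .
    moreover have "mor (c' \<cdot> p1 \<boxplus> df Z n \<cdot> p2) S Z'" "mor (j1 \<cdot> c \<boxplus> j2 \<cdot> l) Z' S" using M by (simp_all add: mor_def)
    ultimately have "Z' \<in> \<A>" using sub_retract sub_biproduct[OF S W(1) ZA] by blast
    then have "ob Z i \<in> \<A>" if "i \<le> n+1" for i
    proof -
      have "i = 0 \<or> i = 1 \<or> i = n+1" using that 1 by linarith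
      then show ?thesis using ZM(1,2) Z(4) A D \<open>Z' \<in> \<A>\<close> by metis
    qed
    then show ?thesis using Z by blast
  next
    case 2
    obtain T where T: "T \<in> \<ss> W A \<theta>" "\<And>i. i \<le> n+1 \<Longrightarrow> ob T i \<in> \<A>"
      using sub_extension[OF W(1) A W(2)] by blast
    note TM = realizes_mor[OF W(2) T(1)]
    obtain x where x: "mor x (ob T 1) (ob Y 1)" "?gf = x \<cdot> df T 0"
      using ker_push[OF W(2) T(1) gf] W(3) by blast
    \<comment> \<open>\<epsilon> is a pullback of \<theta>, so whatever kills \<theta> kills
      \<epsilon>. Hence the first differential of T factors through gf, opposite to the
      factorization x.\<close>
    have "push \<C> \<E> Z' (df T 0) \<epsilon> = \<one>\<^bsub>Ext \<E> Z' (ob T 1)\<^esub>"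
      unfolding W(5) using push_pull[OF W(2,4) TM(3)] push_first[OF W(2) T(1)] pull_one[OF _ W(4)] TM(3) by (simp add: mor_def)
    then obtain y where y: "mor y (ob Y 1) (ob T 1)" "df T 0 = y \<cdot> ?gf"
      using ker_push[OF Z(1,2) TM(3)] Z(3,4) by auto
    have "y \<cdot> (x \<cdot> df T 0) = df T 0" using x(2) y(2) by simp
    then show ?thesis using replace_first[OF 2 W(2) T D x(1) y(1)] x(2) W(2) by metis
  qed
qed

end

section \<open>Duality\<close>

definition op_cat :: "('o, 'm, 'x) cat_scheme \<Rightarrow> ('o, 'm) cat" where
  "op_cat \<C> = \<lparr>Obj = Obj \<C>, Hom = (\<lambda>A B. Hom \<C> B A), cmp = (\<lambda>g f. cmp \<C> f g), ide = ide \<C>\<rparr>"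

definition op_bif :: "('o, 'm, 'e, 'y) bif_scheme \<Rightarrow> ('o, 'm, 'e) bif" where
  "op_bif \<E> = \<lparr>Ext = (\<lambda>C A. Ext \<E> A C), act = (\<lambda>c a. act \<E> a c)\<rparr>"

text \<open>Truncated subtraction sends every degree beyond the range to 0, so reversing twice
  restores a complex only within its range.\<close>

definition op_cplx :: "nat \<Rightarrow> ('o, 'm) cplx \<Rightarrow> ('o, 'm) cplx" where
  "op_cplx n X = \<lparr>ob = (\<lambda>i. ob X (n+1-i)), df = (\<lambda>i. df X (n-i))\<rparr>"

text \<open>A preimage rather than an image under reversal, because reversal is not an involution on
  records. That reversed members of \<open>\<ss>\<close> belong to it uses the invariance of
  \<open>\<ss>\<close> under homotopy equivalence.\<close>

definition op_real :: "nat \<Rightarrow> ('o, 'm, 'e) realization \<Rightarrow> ('o, 'm, 'e) realization" where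
  "op_real n \<ss> C A \<delta> = {X. op_cplx n X \<in> \<ss> A C \<delta>}"

lemma op_cat_simps [simp]:
  "Obj (op_cat \<C>) = Obj \<C>" "Hom (op_cat \<C>) A B = Hom \<C> B A" "cmp (op_cat \<C>) = (\<lambda>g f. cmp \<C> f g)" "ide (op_cat \<C>) = ide \<C>"
  by (simp_all add: op_cat_def)

lemma op_bif_simps [simp]: "Ext (op_bif \<E>) C A = Ext \<E> A C" "act (op_bif \<E>) c a = act \<E> a c"
  by (simp_all add: op_bif_def)

lemma op_push_pull [simp]:
  "push (op_cat \<C>) (op_bif \<E>) C a \<delta> = pull \<C> \<E> C a \<delta>"
  "pull (op_cat \<C>) (op_bif \<E>) A c \<delta> = push \<C> \<E> A c \<delta>"
  by (simp_all add: push_def pull_def)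

lemma op_cplx_simps [simp]: "ob (op_cplx n X) i = ob X (n+1-i)" "df (op_cplx n X) i = df X (n-i)"
  by (simp_all add: op_cplx_def)

lemma all_le_reverse: "(\<forall>i\<le>(n::nat). P (n - i)) \<longleftrightarrow> (\<forall>i\<le>n. P i)"
  by (metis diff_diff_cancel diff_le_self)

context preadditive_category
begin

lemma op_preadditive: "preadditive_category (op_cat \<C>)"
proof (rule preadditive_category.intro, goal_cases)
  case (1 A B A' B' f)
  then show ?case using Mor_disjoint[of B A B' A' f] by simp
next
  case (6 A B D F f g h)
  then show ?case using cmp_assoc[of F D B A h g f] by simp
qed (use ide_in cmp_in cmp_ide_right cmp_ide_left Hom_comm_group postcomp_hom precomp_hom in simp_all)

lemma op_mor [simp]: "preadditive_category.mor (op_cat \<C>) f A B \<longleftrightarrow> mor f B A"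
  unfolding preadditive_category.mor_iff[OF op_preadditive] by (auto simp: mor_iff)

lemma op_dom [simp]: "preadditive_category.dom (op_cat \<C>) f = cod f"
  by (simp add: preadditive_category.dom_def[OF op_preadditive] cod_def)

lemma op_cod [simp]: "preadditive_category.cod (op_cat \<C>) f = dom f"
  by (simp add: preadditive_category.cod_def[OF op_preadditive] dom_def)

lemma op_plus [simp]: "preadditive_category.plus (op_cat \<C>) f g = f \<boxplus> g"
  by (simp add: preadditive_category.plus_def[OF op_preadditive] plus_def)

lemma op_neg [simp]: "preadditive_category.neg (op_cat \<C>) f = \<boxminus> f"
  by (simp add: preadditive_category.neg_def[OF op_preadditive] neg_def)

lemma op_biproduct [simp]: "biproduct (op_cat \<C>) X Y S i1 i2 p1 p2 \<longleftrightarrow> biproduct \<C> X Y S p1 p2 i1 i2"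
  unfolding biproduct_iff preadditive_category.biproduct_iff[OF op_preadditive] by auto

lemma op_splits: "mor e S S \<Longrightarrow> preadditive_category.splits (op_cat \<C>) e \<longleftrightarrow> splits e"
  unfolding splits_def preadditive_category.splits_def[OF op_preadditive] by (auto simp: mor_def)

lemma op_complexes: "X \<in> complexes n (op_cat \<C>) \<longleftrightarrow> op_cplx n X \<in> complexes n \<C>"
proof -
  have 1: "(\<forall>i\<le>n. mor (df X i) (ob X (i+1)) (ob X i)) \<longleftrightarrow> (\<forall>i\<le>n. mor (df X (n-i)) (ob X (n+1-i)) (ob X (n+1-(i+1))))"
    by (subst all_le_reverse[symmetric]) (simp add: Suc_diff_le)
  have 2: "(\<forall>i<n. df X i \<cdot> df X (i+1) = zmor \<C> (ob X (i+2)) (ob X i)) \<longleftrightarrow>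
    (\<forall>i<n. df X (n-(i+1)) \<cdot> df X (n-i) = zmor \<C> (ob X (n+1-i)) (ob X (n+1-(i+2))))" (is "?L \<longleftrightarrow> ?R")
  proof
    assume L: ?L
    show ?R
    proof (intro allI impI)
      fix i assume "i < n"
      then have "n - (i+1) < n" "n - i = n - (i+1) + 1" "n+1-i = n-(i+1) + 2" "n+1-(i+2) = n-(i+1)" by auto
      then show "df X (n-(i+1)) \<cdot> df X (n-i) = zmor \<C> (ob X (n+1-i)) (ob X (n+1-(i+2)))" using L by metis
    qed
  next
    assume R: ?R
    show ?L
    proof (intro allI impI)
      fix i assume "i < n"
      then have "n-(i+1) < n" "n-(n-(i+1)+1) = i" "n-(n-(i+1)) = i+1" "n+1-(n-(i+1)) = i+2" "n+1-(n-(i+1)+2) = i" by auto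
      then show "df X i \<cdot> df X (i+1) = zmor \<C> (ob X (i+2)) (ob X i)" using R by metis
    qed
  qed
  show ?thesis
    unfolding complexes_iff preadditive_category.complexes_iff[OF op_preadditive] using 1 2 by simp
qed

lemma op_op_equiv: "X \<in> complexes n \<C> \<Longrightarrow> homotopy_equiv n X (op_cplx n (op_cplx n X))"
  by (rule homotopy_equiv_cong) auto

lemma op_chain_map:
  assumes "chain_map_fixing_ends n (op_cat \<C>) X Y f" "X \<in> complexes n (op_cat \<C>)" "Y \<in> complexes n (op_cat \<C>)"
    "ob Y 0 = ob X 0" "ob Y (n+1) = ob X (n+1)"
  shows "chain_map_fixing_ends n \<C> (op_cplx n Y) (op_cplx n X) (\<lambda>i. f (n+1-i))"
proof -
  have f: "\<And>i. i \<le> n+1 \<Longrightarrow> mor (f i) (ob Y i) (ob X i)" "\<And>i. i \<le> n \<Longrightarrow> df X i \<cdot> f (i+1) = f i \<cdot> df Y i"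
    "f 0 = ide \<C> (ob X 0)" "f (n+1) = ide \<C> (ob X (n+1))"
    using assms(1) unfolding chain_map_fixing_ends_def preadditive_category.chain_map_iff[OF op_preadditive assms(2,3)] by auto
  show ?thesis
    unfolding chain_map_fixing_ends_def chain_map_iff[OF assms(3)[unfolded op_complexes] assms(2)[unfolded op_complexes]]
  proof (intro conjI allI impI)
    fix i assume "i \<le> n"
    then have "n + 1 - (i+1) = n - i" "n + 1 - i = n - i + 1" by auto
    then show "f (n+1-(i+1)) \<cdot> df (op_cplx n Y) i = df (op_cplx n X) i \<cdot> f (n+1-i)"
      using f(2)[of "n-i"] by simp
  qed (use f assms(4,5) in auto)
qed

lemma op_homotopic:
  assumes "homotopic n (op_cat \<C>) X X f g" "X \<in> complexes n (op_cat \<C>)"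
    "\<And>i. i \<le> n+1 \<Longrightarrow> mor (f i) (ob X i) (ob X i)" "\<And>i. i \<le> n+1 \<Longrightarrow> mor (g i) (ob X i) (ob X i)"
  shows "homotopic n \<C> (op_cplx n X) (op_cplx n X) (\<lambda>i. f (n+1-i)) (\<lambda>i. g (n+1-i))"
proof -
  interpret op: preadditive_category "op_cat \<C>" by (rule op_preadditive)
  obtain h where h: "\<And>i. i\<le>n \<Longrightarrow> mor (h i) (ob X i) (ob X (i+1))"
    "f 0 \<boxplus> \<boxminus> (g 0) = df X 0 \<cdot> h 0"
    "\<And>i. i<n \<Longrightarrow> f (i+1) \<boxplus> \<boxminus> (g (i+1)) = h i \<cdot> df X i \<boxplus> df X (i+1) \<cdot> h (i+1)"
    "f (n+1) \<boxplus> \<boxminus> (g (n+1)) = h n \<cdot> df X n"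
    using assms(1) op.homotopic_iff[OF assms(2,2), of f g] assms(3,4) by auto
  have X: "\<And>i. i \<le> n \<Longrightarrow> mor (df X i) (ob X (i+1)) (ob X i)"
    using assms(2) unfolding op.complexes_iff by simp
  show ?thesis
  proof (subst homotopic_iff[OF assms(2,2)[unfolded op_complexes]], goal_cases)
    case 3
    show ?case
    proof (intro exI[of _ "\<lambda>i. h (n-i)"] conjI allI impI)
      fix i assume "i \<le> n"
      then have "n + 1 - i = n - i + 1" by simp
      then show "mor (h (n-i)) (ob (op_cplx n X) (i+1)) (ob (op_cplx n X) i)" using h(1)[of "n-i"] by simp
    next
      fix i assume i: "i < n"
      \<comment> \<open>Degree i + 1 of the reversed complex is degree j + 1 of the original. The
        two summands of the homotopy condition change places.\<close>
      define j where "j = n - i - 1"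
      have j: "n + 1 - (i+1) = j + 1" "n - i = j + 1" "n - (i+1) = j" "j < n" using i by (auto simp: j_def)
      then show "f (n+1-(i+1)) \<boxplus> \<boxminus> (g (n+1-(i+1))) = df (op_cplx n X) i \<cdot> h (n-i) \<boxplus> h (n-(i+1)) \<cdot> df (op_cplx n X) (i+1)"
        using h(3)[OF j(4)] h(1)[of j] h(1)[of "j+1"] X[of j] X[of "j+1"] by (simp add: mor_def plus_comm)
    qed (use h in auto)
  qed (use assms(3,4) in auto)
qed

lemma op_homotopy_equiv:
  assumes "preadditive_category.homotopy_equiv (op_cat \<C>) n X Y"
  shows "homotopy_equiv n (op_cplx n X) (op_cplx n Y)"
proof -
  interpret op: preadditive_category "op_cat \<C>" by (rule op_preadditive)
  \<comment> \<open>Reversal turns a map from X to Y of the opposite category into a map from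
    reversed Y to reversed X, so f and g trade roles.\<close>
  have inv: "homotopy_inverse n (op_cplx n X) (op_cplx n Y) (\<lambda>i. g (n+1-i)) (\<lambda>i. f (n+1-i))"
    if fg: "op.homotopy_inverse n X Y f g" and X: "X \<in> complexes n (op_cat \<C>)" and Y: "Y \<in> complexes n (op_cat \<C>)"
      and e: "ob Y 0 = ob X 0" "ob Y (n+1) = ob X (n+1)" for X Y f g
  proof -
    have c: "chain_map_fixing_ends n (op_cat \<C>) X Y f" "chain_map_fixing_ends n (op_cat \<C>) Y X g"
      and hom: "homotopic n (op_cat \<C>) X X (\<lambda>i. f i \<cdot> g i) (\<lambda>i. ide \<C> (ob X i))"
      using fg unfolding op.homotopy_inverse_def by auto
    have "\<And>i. i \<le> n+1 \<Longrightarrow> mor (f i) (ob Y i) (ob X i)" "\<And>i. i \<le> n+1 \<Longrightarrow> mor (g i) (ob X i) (ob Y i)"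
      using c unfolding chain_map_fixing_ends_def op.chain_map_iff[OF X Y] op.chain_map_iff[OF Y X] by auto
    then have m: "\<And>i. i \<le> n+1 \<Longrightarrow> mor (f i \<cdot> g i) (ob X i) (ob X i)" "\<And>i. i \<le> n+1 \<Longrightarrow> mor (ide \<C> (ob X i)) (ob X i) (ob X i)"
      by (auto simp: mor_def)
    then show ?thesis
      unfolding homotopy_inverse_def using op_homotopic[OF hom X m] op_chain_map[OF c(1) X Y e] op_chain_map[OF c(2) Y X] e by simp
  qed
  obtain f g where XY: "X \<in> complexes n (op_cat \<C>)" "Y \<in> complexes n (op_cat \<C>)"
    and e: "ob Y 0 = ob X 0" "ob Y (n+1) = ob X (n+1)"
    and fg: "op.homotopy_inverse n X Y f g" "op.homotopy_inverse n Y X g f"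
    using assms unfolding op.homotopy_equiv_def by blast
  have "homotopy_inverse n (op_cplx n X) (op_cplx n Y) (\<lambda>i. g (n+1-i)) (\<lambda>i. f (n+1-i))"
    "homotopy_inverse n (op_cplx n Y) (op_cplx n X) (\<lambda>i. f (n+1-i)) (\<lambda>i. g (n+1-i))"
    by (rule inv[OF fg(1) XY e], rule inv[OF fg(2) XY(2,1) e[symmetric]])
  then show ?thesis
    unfolding homotopy_equiv_def
    by (intro conjI exI[of _ "\<lambda>i. g (n+1-i)"] exI[of _ "\<lambda>i. f (n+1-i)"]) (use XY e in \<open>simp_all flip: op_complexes\<close>)
qed

end

context additive_bifunctor
begin

lemma op_additive: "additive_category (op_cat \<C>)"
proof -
  have "zero_object (op_cat \<C>) Z" if "zero_object \<C> Z" for Z using that by (auto simp: zero_object_def)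
  moreover have "\<exists>S i1 i2 p1 p2. biproduct (op_cat \<C>) X Y S i1 i2 p1 p2" if "X \<in> Obj \<C>" "Y \<in> Obj \<C>" for X Y
    using ex_biproduct[OF that] by simp blast
  ultimately show ?thesis
    using op_preadditive ex_zero_object by (auto simp: additive_category_def additive_category_axioms_def)
qed

lemma op_additive_bifunctor: "additive_bifunctor (op_cat \<C>) (op_bif \<E>)"
proof -
  interpret op: additive_category "op_cat \<C>" by (rule op_additive)
  show ?thesis
  proof (rule additive_bifunctor.intro[OF op.additive_category_axioms additive_bifunctor_axioms.intro], goal_cases)
    case (1 C A)
    then show ?case using Ext_comm_group[of A C] by simp
  next
    case (2 C C' A A' c a)
    then show ?case using act_hom[of A A' C C' a c] by simp
  next
    case (3 C A \<delta>)
    then show ?case using act_ide[of A C \<delta>] by simp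
  next
    case (4 C C' C'' A A' A'' c c' a a' \<delta>)
    then show ?case using act_cmp[of A A' A'' C C' C'' a a' c c' \<delta>] by simp
  next
    case (5 C A A' a b \<delta>)
    then show ?case using pull_add[of A A' C a b \<delta>] by simp
  next
    case (6 C C' A c d \<delta>)
    then show ?case using push_add[of A C C' c d \<delta>] by simp
  qed
qed

lemma op_is_ext [simp]: "additive_bifunctor.is_ext (op_cat \<C>) (op_bif \<E>) C A \<delta> \<longleftrightarrow> is_ext A C \<delta>"
  by (auto simp: additive_bifunctor.is_ext_def[OF op_additive_bifunctor] is_ext_def)

lemma op_exangle:
  assumes "n_exangle n \<C> \<E> (op_cplx n X) \<delta>"
  shows "n_exangle n (op_cat \<C>) (op_bif \<E>) X \<delta>"
proof -
  \<comment> \<open>Reversal exchanges the two families of sequences, and the interior position i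
    corresponds to n - 1 - i.\<close>
  have idx: "n + 1 - (n - Suc i) = i + 2" "n + 1 - (n - Suc i + 1) = i + 1" "n + 1 - (n - Suc i + 2) = i"
    "n - (n - Suc i + 1) = i" "n - (n - Suc i) = i + 1" "n - Suc i < n" if "i < n" for i using that by auto
  note a = assms[unfolded n_exangle_def]
  show ?thesis unfolding n_exangle_def op_complexes
  proof (intro conjI ballI allI impI, goal_cases)
    case (3 T i)
    then show ?case using a idx[of i] by (auto dest!: bspec[of _ _ T] spec[of _ "n - Suc i"])
  next
    case (5 T i)
    then show ?case using a idx[of i] by (auto dest!: bspec[of _ _ T] spec[of _ "n - Suc i"])
  qed (use a in simp_all)
qed

end

section \<open>Exactness of the realization\<close>

context realized_extensions
begin

lemma op_op_realizes: "\<lbrakk>is_ext C A \<delta>; X \<in> \<ss> C A \<delta>\<rbrakk> \<Longrightarrow> op_cplx n X \<in> op_real n \<ss> A C \<delta>"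
  using realizes_equiv op_op_equiv realizes_mor(7) by (simp add: op_real_def)

lemma op_inflation: "inflation (op_cat \<C>) (op_bif \<E>) (op_real n \<ss>) f \<longleftrightarrow> deflation n \<C> \<E> \<ss> f"
proof
  assume "inflation (op_cat \<C>) (op_bif \<E>) (op_real n \<ss>) f"
  then obtain X C A \<delta> where "C \<in> Obj \<C>" "A \<in> Obj \<C>" "\<delta> \<in> carrier (Ext \<E> A C)" "op_cplx n X \<in> \<ss> A C \<delta>" "df X 0 = f"
    unfolding inflation_def conflation_def op_real_def by auto
  then show "deflation n \<C> \<E> \<ss> f"
    unfolding deflation_def conflation_def by (intro exI[of _ "op_cplx n X"]) auto
next
  assume "deflation n \<C> \<E> \<ss> f"
  then obtain X C A \<delta> where X: "is_ext C A \<delta>" "X \<in> \<ss> C A \<delta>" "df X n = f"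
    unfolding deflation_def conflation_def is_ext_def by blast
  then show "inflation (op_cat \<C>) (op_bif \<E>) (op_real n \<ss>) f"
    using op_op_realizes[OF X(1,2)] unfolding inflation_def conflation_def is_ext_def
    by (intro exI[of _ "op_cplx n X"]) auto
qed

lemma op_deflation: "deflation n (op_cat \<C>) (op_bif \<E>) (op_real n \<ss>) f \<longleftrightarrow> inflation \<C> \<E> \<ss> f"
proof
  assume "deflation n (op_cat \<C>) (op_bif \<E>) (op_real n \<ss>) f"
  then obtain X C A \<delta> where "C \<in> Obj \<C>" "A \<in> Obj \<C>" "\<delta> \<in> carrier (Ext \<E> A C)" "op_cplx n X \<in> \<ss> A C \<delta>" "df X n = f"
    unfolding deflation_def conflation_def op_real_def by auto
  then show "inflation \<C> \<E> \<ss> f"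
    unfolding inflation_def conflation_def by (intro exI[of _ "op_cplx n X"]) auto
next
  assume "inflation \<C> \<E> \<ss> f"
  then obtain X C A \<delta> where X: "is_ext C A \<delta>" "X \<in> \<ss> C A \<delta>" "df X 0 = f"
    unfolding inflation_def conflation_def is_ext_def by blast
  then show "deflation n (op_cat \<C>) (op_bif \<E>) (op_real n \<ss>) f"
    using op_op_realizes[OF X(1,2)] unfolding deflation_def conflation_def is_ext_def
    by (intro exI[of _ "op_cplx n X"]) auto
qed

text \<open>Under reversal \<open>push_exact\<close> and \<open>pull_exact\<close> change places, as
  do the closure conditions for inflations and deflations; the remaining conditions correspond to
  themselves.\<close>

lemma op_realized_extensions: "realized_extensions n (op_cat \<C>) (op_bif \<E>) (op_real n \<ss>)"
proof -
  interpret op: additive_bifunctor "op_cat \<C>" "op_bif \<E>" by (rule op_additive_bifunctor)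
  show ?thesis
  proof (rule realized_extensions.intro[OF op_additive_bifunctor realized_extensions_axioms.intro], goal_cases)
    case 1
    show ?case by (rule n_pos)
  next
    case (2 C A \<delta>)
    then show ?case using realized[of A C \<delta>] op_op_realizes[of A C \<delta>] by auto
  next
    case (3 C A \<delta> X)
    then have "op_cplx n X \<in> complexes_from_to n \<C> C A" using realizes_complex[of A C \<delta>] by (simp add: op_real_def)
    then show ?case by (simp add: complexes_from_to_def op_complexes)
  next
    case (4 C A \<delta> X Y)
    then show ?case using realizes_equiv[of A C \<delta> "op_cplx n X" "op_cplx n Y"] op_homotopy_equiv by (simp add: op_real_def)
  next
    case (5 C A \<delta> X)
    then show ?case using realizes_exangle[of A C \<delta>] op_exangle by (simp add: op_real_def)
  next
    case (6 C A \<delta> X T \<tau>)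
    then show ?case using pull_exact[of A C \<delta> "op_cplx n X" T \<tau>] by (simp add: op_real_def)
  next
    case (7 C A \<delta> X T \<tau>)
    then show ?case using push_exact[of A C \<delta> "op_cplx n X" T \<tau>] by (simp add: op_real_def)
  next
    case (8 f A B g D)
    then show ?case using deflation_cmp[of g D B f A] by (simp add: op_inflation)
  next
    case (9 f A B g D)
    then show ?case using inflation_cmp[of g D B f A] by (simp add: op_deflation)
  next
    case (10 e S)
    then show ?case using idempotent_splits[of e S] op_splits[of e S] by simp
  qed
qed

end

context extension_closed
begin

lemma op_extension_closed: "extension_closed n (op_cat \<C>) (op_bif \<E>) (op_real n \<ss>) \<A>"
proof (rule extension_closed.intro[OF op_realized_extensions extension_closed_axioms.intro], goal_cases)
  case 1
  show ?case using sub_Obj by simp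
next
  case (2 X Y S i1 i2 p1 p2)
  then show ?case using sub_biproduct by auto
next
  case (3 X Y S i1 i2 p1 p2)
  then show ?case using sub_summand by auto
next
  case (4 C A \<delta>)
  then have ext: "is_ext A C \<delta>" by simp
  then obtain X where X: "X \<in> \<ss> A C \<delta>" "\<And>i. i \<le> n+1 \<Longrightarrow> ob X i \<in> \<A>" using sub_extension 4 by blast
  then have "op_cplx n X \<in> op_real n \<ss> C A \<delta>" using op_op_realizes ext by blast
  then show ?case using X(2) by (intro bexI[of _ "op_cplx n X"]) auto
qed

lemma deflation_in_sub_cmp:
  assumes X: "is_ext (ob Y n) F \<delta>" "X \<in> \<ss> (ob Y n) F \<delta>" "\<And>i. i \<le> n+1 \<Longrightarrow> ob X i \<in> \<A>"
    and Y: "is_ext D A \<rho>" "Y \<in> \<ss> D A \<rho>" "\<And>i. i \<le> n+1 \<Longrightarrow> ob Y i \<in> \<A>"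
  shows "\<exists>W \<theta> Q. is_ext D W \<theta> \<and> Q \<in> \<ss> D W \<theta> \<and> df Q n = df Y n \<cdot> df X n \<and> (\<forall>i\<le>n+1. ob Q i \<in> \<A>)"
proof -
  interpret op: extension_closed n "op_cat \<C>" "op_bif \<E>" "op_real n \<ss>" \<A> by (rule op_extension_closed)
  have "\<exists>W \<theta> Q. op.is_ext W D \<theta> \<and> Q \<in> op_real n \<ss> W D \<theta> \<and>
    df Q 0 = cmp (op_cat \<C>) (df (op_cplx n X) 0) (df (op_cplx n Y) 0) \<and> (\<forall>i\<le>n+1. ob Q i \<in> \<A>)"
    \<comment> \<open>Composition is reversed: the last differential of Y is the inner inflation of
      the opposite category, so Y takes the first place.\<close>
    by (rule op.inflation_in_sub_cmp[of A D \<rho> "op_cplx n Y" F \<delta> "op_cplx n X"])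
      (use X Y op_op_realizes in simp_all)
  then obtain W \<theta> Q where Q: "is_ext D W \<theta>" "op_cplx n Q \<in> \<ss> D W \<theta>" "df Q 0 = df Y n \<cdot> df X n" "\<And>i. i \<le> n+1 \<Longrightarrow> ob Q i \<in> \<A>"
    by (auto simp: op_real_def)
  then show ?thesis by (intro exI[of _ W] exI[of _ \<theta>] exI[of _ "op_cplx n Q"]) simp
qed

end

section \<open>Existence of mapping cones\<close>

lemma (in preadditive_category) triangular_matrix:
  assumes S: "biproduct \<C> X Y S a1 a2 p1 p2" and T: "biproduct \<C> X' Y' T b1 b2 q1 q2"
    and "mor u X X'" "mor g X Y'" "mor v Y Y'" and d: "d = b1 \<cdot> (u \<cdot> p1) \<boxplus> b2 \<cdot> (g \<cdot> p1 \<boxplus> v \<cdot> p2)"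
  shows "mor d S T" "q1 \<cdot> d \<cdot> a1 = u" "q1 \<cdot> d \<cdot> a2 = zmor \<C> Y X'" "q2 \<cdot> d \<cdot> a1 = g" "q2 \<cdot> d \<cdot> a2 = v"
proof -
  note S' = S[unfolded biproduct_iff mor_def] and T' = T[unfolded biproduct_iff mor_def]
  note M = S' T' assms(3-5)[unfolded mor_def]
  show "mor d S T" unfolding d using M by (simp add: mor_def)
  have "q1 \<cdot> d = u \<cdot> p1" "q2 \<cdot> d = g \<cdot> p1 \<boxplus> v \<cdot> p2"
    unfolding d using M by (simp_all add: cmp_extend[of q1 b1] cmp_extend[of q1 b2] cmp_extend[of q2 b1] cmp_extend[of q2 b2])
  then show "q1 \<cdot> d \<cdot> a1 = u" "q1 \<cdot> d \<cdot> a2 = zmor \<C> Y X'" "q2 \<cdot> d \<cdot> a1 = g" "q2 \<cdot> d \<cdot> a2 = v"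
    using M by simp_all
qed

text \<open>(EA2) and its dual speak about every cone of the lift, so they give information only
  once some cone is known to exist.\<close>

lemma (in additive_category) cone_exists:
  assumes n: "1 \<le> n" and U: "\<And>i. i < n \<Longrightarrow> mor (df U i) (ob U i) (ob U (i+1))"
    and V: "\<And>i. i < n \<Longrightarrow> mor (df V i) (ob V i) (ob V (i+1))"
    and g: "\<And>i. i \<le> n \<Longrightarrow> mor (g i) (ob U i) (ob V i)"
  shows "\<exists>K. cone_shaped n \<C> U V g K"
proof -
  have "\<exists>S i1 i2 p1 p2. biproduct \<C> (ob U i) (ob V (i-1)) S i1 i2 p1 p2" if "1 \<le> i" "i \<le> n" for i
    using ex_biproduct[of "ob U i" "ob V (i-1)"] g[of i] V[of "i-1"] that by (simp add: mor_def)
  then obtain S i1 i2 p1 p2 where "\<And>i. 1 \<le> i \<Longrightarrow> i \<le> n \<Longrightarrow> biproduct \<C> (ob U i) (ob V (i-1)) (S i) (i1 i) (i2 i) (p1 i) (p2 i)"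
    by metis
  note B = this and B' = this[unfolded biproduct_iff mor_def]
  have B'': "p1 i \<cdot> i1 i = ide \<C> (ob U i)" "p2 i \<cdot> i2 i = ide \<C> (ob V (i-1))"
    "p1 i \<cdot> i2 i = zmor \<C> (ob V (i-1)) (ob U i)" "p2 i \<cdot> i1 i = zmor \<C> (ob U i) (ob V (i-1))" if "1 \<le> i" "i \<le> n" for i
    using B'[OF that] by auto
  \<comment> \<open>The end terms are not biproducts, so the first differential is a column and the
    last one a row. The bound 1 \<le> n keeps these two cases apart.\<close>
  define K where "K = \<lparr>ob = (\<lambda>i. if i = 0 then ob U 0 else if i = n+1 then ob V n else S i),
    df = (\<lambda>i. if i = 0 then i1 1 \<cdot> (\<boxminus> (df U 0)) \<boxplus> i2 1 \<cdot> g 0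
      else if i = n then g n \<cdot> p1 n \<boxplus> df V (n-1) \<cdot> p2 n
      else i1 (i+1) \<cdot> (\<boxminus> (df U i) \<cdot> p1 i) \<boxplus> i2 (i+1) \<cdot> (g i \<cdot> p1 i \<boxplus> df V (i-1) \<cdot> p2 i))\<rparr>"
  note U' = U[unfolded mor_def] and V' = V[unfolded mor_def] and g' = g[unfolded mor_def]
  have d0: "mor (df K 0) (ob K 0) (ob K 1)" "p1 1 \<cdot> df K 0 = pneg \<C> (ob U 0) (ob U 1) (df U 0)" "p2 1 \<cdot> df K 0 = g 0"
    using n U'[of 0] V'[of 0] g'[of 0] B'[of 1] cmp_extend[OF B''(1), of 1 "df U 0"] cmp_extend[OF B''(4), of 1 "df U 0"]
      cmp_extend[OF B''(2), of 1 "g 0"] cmp_extend[OF B''(3), of 1 "g 0"]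
    by (simp_all add: K_def mor_def pneg_neg)
  have dn: "mor (df K n) (ob K n) (ob K (n+1))" "df K n \<cdot> i1 n = g n" "df K n \<cdot> i2 n = df V (n-1)"
    using n V'[of "n-1"] g'[of n] B'[of n] by (simp_all add: K_def mor_def)
  have di: "mor (df K i) (ob K i) (ob K (i+1))"
      "p1 (i+1) \<cdot> df K i \<cdot> i1 i = pneg \<C> (ob U i) (ob U (i+1)) (df U i)"
      "p1 (i+1) \<cdot> df K i \<cdot> i2 i = zmor \<C> (ob V (i-1)) (ob U (i+1))"
      "p2 (i+1) \<cdot> df K i \<cdot> i1 i = g i"
      "p2 (i+1) \<cdot> df K i \<cdot> i2 i = df V (i-1)" if i: "1 \<le> i" "i < n" for i
  proof -
    have b: "biproduct \<C> (ob U (i+1)) (ob V i) (S (i+1)) (i1 (i+1)) (i2 (i+1)) (p1 (i+1)) (p2 (i+1))"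
      using B[of "i+1"] i by simp
    have m: "mor (\<boxminus> (df U i)) (ob U i) (ob U (i+1))" "mor (g i) (ob U i) (ob V i)" "mor (df V (i-1)) (ob V (i-1)) (ob V i)"
      using U[OF i(2)] V[of "i-1"] g[of i] i mor_neg by auto
    have d: "df K i = i1 (i+1) \<cdot> (\<boxminus> (df U i) \<cdot> p1 i) \<boxplus> i2 (i+1) \<cdot> (g i \<cdot> p1 i \<boxplus> df V (i-1) \<cdot> p2 i)"
      using i by (simp add: K_def)
    have K: "ob K i = S i" "ob K (i+1) = S (i+1)" "pneg \<C> (ob U i) (ob U (i+1)) (df U i) = \<boxminus> (df U i)"
      using i U[OF i(2)] by (simp_all add: K_def mor_def pneg_neg)
    show "mor (df K i) (ob K i) (ob K (i+1))"
      "p1 (i+1) \<cdot> df K i \<cdot> i1 i = pneg \<C> (ob U i) (ob U (i+1)) (df U i)"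
      "p1 (i+1) \<cdot> df K i \<cdot> i2 i = zmor \<C> (ob V (i-1)) (ob U (i+1))"
      "p2 (i+1) \<cdot> df K i \<cdot> i1 i = g i"
      "p2 (i+1) \<cdot> df K i \<cdot> i2 i = df V (i-1)"
      unfolding K using triangular_matrix[OF B[OF i(1) less_imp_le[OF i(2)]] b m d] by blast+
  qed
  have "\<forall>i\<in>{1..n}. biproduct \<C> (ob U i) (ob V (i-1)) (ob K i) (i1 i) (i2 i) (p1 i) (p2 i)"
    using B by (auto simp: K_def)
  moreover have "\<forall>i\<le>n. mor (df K i) (ob K i) (ob K (i+1))"
  proof (intro allI impI)
    fix i assume "i \<le> n"
    then consider "i = 0" | "i = n" | "1 \<le> i" "i < n" by linarith
    then show "mor (df K i) (ob K i) (ob K (i+1))" using d0(1) dn(1) di(1) by cases auto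
  qed
  then have "\<forall>i\<le>n. df K i \<in> Mor \<C> (ob K i) (ob K (i+1))" using mor_Mor by blast
  moreover have "ob K 0 = ob U 0" "ob K (n+1) = ob V n" by (simp_all add: K_def)
  moreover have "\<forall>i\<in>{1..<n}.
      p1 (i+1) \<cdot> df K i \<cdot> i1 i = pneg \<C> (ob U i) (ob U (i+1)) (df U i) \<and>
      p1 (i+1) \<cdot> df K i \<cdot> i2 i = zmor \<C> (ob V (i-1)) (ob U (i+1)) \<and>
      p2 (i+1) \<cdot> df K i \<cdot> i1 i = g i \<and>
      p2 (i+1) \<cdot> df K i \<cdot> i2 i = df V (i-1)"
    using di(2-) by simp
  ultimately show ?thesis
    unfolding cone_shaped_def using d0(2,3) dn(2,3) by blast
qed

context exact_realization
begin

text \<open>The value of \<open>\<ss>\<close> is a whole equivalence class, so any of its members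
  may serve as the representative.\<close>

lemma realization_eq:
  assumes "is_ext C A \<delta>" "X \<in> \<ss> C A \<delta>"
  shows "X \<in> complexes_from_to n \<C> A C" "\<ss> C A \<delta> = {Y. homotopy_equiv n X Y}"
proof -
  obtain X0 where X0: "X0 \<in> complexes_from_to n \<C> A C" "\<ss> C A \<delta> = homotopy_class n \<C> X0"
    using realization_class assms(1) unfolding is_ext_def by blast
  then have c: "X0 \<in> complexes n \<C>" and e: "ob X0 0 = A" "ob X0 (n+1) = C" by (auto simp: complexes_from_to_def)
  have eq: "homotopy_equiv n X0 X" using assms(2) X0(2) homotopy_class_iff[OF c] by simp
  then show "X \<in> complexes_from_to n \<C> A C" using e by (simp add: homotopy_equiv_def complexes_from_to_def)
  show "\<ss> C A \<delta> = {Y. homotopy_equiv n X Y}"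
    unfolding X0(2) using homotopy_class_iff[OF c] eq homotopy_equiv_trans homotopy_equiv_sym by blast
qed

lemma realization_nonempty: "is_ext C A \<delta> \<Longrightarrow> \<exists>X. X \<in> \<ss> C A \<delta>"
proof -
  assume "is_ext C A \<delta>"
  then obtain X where "X \<in> complexes n \<C>" "\<ss> C A \<delta> = homotopy_class n \<C> X"
    using realization_class unfolding is_ext_def complexes_from_to_def by blast
  moreover from this have "homotopy_equiv n X X" by (intro homotopy_equiv_cong) auto
  ultimately show ?thesis using homotopy_class_iff by blast
qed

lemma realization_exangle: "\<lbrakk>is_ext C A \<delta>; X \<in> \<ss> C A \<delta>\<rbrakk> \<Longrightarrow> n_exangle n \<C> \<E> X \<delta>"
  using R1 unfolding is_ext_def by blast

lemma realization_ends: "\<lbrakk>is_ext C A \<delta>; X \<in> \<ss> C A \<delta>\<rbrakk> \<Longrightarrow> ob X 0 = A \<and> ob X (n+1) = C \<and> X \<in> complexes n \<C>"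
  using realization_eq(1) by (simp add: complexes_from_to_def)

end

section \<open>Exactness at the extension groups from (EA2) and its dual\<close>

context n_exangulated_category
begin

text \<open>Apply (EA2) to the extension with components $\tau$ and $\delta$: the cone realizes zero, so its
  last differential splits.\<close>

lemma push_exact_at_ext:
  assumes n: "1 \<le> n" and X: "is_ext C A \<delta>" "X \<in> \<ss> C A \<delta>" and \<tau>: "is_ext T A \<tau>"
    and zero: "push \<C> \<E> T (df X 0) \<tau> = \<one>\<^bsub>Ext \<E> T (ob X 1)\<^esub>"
  shows "\<exists>b. mor b T C \<and> \<tau> = pull \<C> \<E> A b \<delta>"
proof -
  note Xe = realization_ends[OF X]
  have XM: "mor (df X i) (ob X i) (ob X (i+1))" if "i \<le> n" for i using Xe that unfolding complexes_iff by blast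
  have d0: "mor (df X 0) A (ob X 1)" using XM[of 0] Xe by simp
  obtain D i1 i2 p1 p2 where D: "biproduct \<C> T C D i1 i2 p1 p2"
    using ex_biproduct X(1) \<tau> unfolding is_ext_def by blast
  note DM = D[unfolded biproduct_iff]
  obtain \<rho> where \<rho>: "is_ext D A \<rho>" "pull \<C> \<E> A i1 \<rho> = \<tau>" "pull \<C> \<E> A i2 \<rho> = \<delta>"
      "\<And>a B. \<lbrakk>mor a A B; push \<C> \<E> T a \<tau> = \<one>\<^bsub>Ext \<E> T B\<^esub>; push \<C> \<E> C a \<delta> = \<one>\<^bsub>Ext \<E> C B\<^esub>\<rbrakk>
      \<Longrightarrow> push \<C> \<E> D a \<rho> = \<one>\<^bsub>Ext \<E> D B\<^esub>"
    using ext_cotuple[OF D \<tau> X(1)] by metis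
  obtain Y where Y: "Y \<in> \<ss> D A \<rho>" using realization_nonempty[OF \<rho>(1)] by blast
  note Ye = realization_ends[OF \<rho>(1) Y]
  have YM: "mor (df Y i) (ob Y i) (ob Y (i+1))" if "i \<le> n" for i using Ye that unfolding complexes_iff by blast
  have obj: "A \<in> Obj \<C>" "C \<in> Obj \<C>" "D \<in> Obj \<C>" "\<rho> \<in> carrier (Ext \<E> D A)" "i2 \<in> Mor \<C> C D"
    using X(1) \<rho>(1) DM by (auto simp: is_ext_def mor_iff)
  \<comment> \<open>The component of \<rho> at i2 is \<delta>, which X realizes, so (EA2) applies
    with c = i2.\<close>
  obtain f where f: "chain_map n \<C> X Y f" "f (n+1) = i2"
    and cone: "\<And>M. mapping_cone n \<C> X Y f M \<Longrightarrow> M \<in> \<ss> D (ob X 1) (push \<C> \<E> D (df X 0) \<rho>)"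
    using EA2[OF obj, of X Y] X(2) Y \<rho>(3) by blast
  have fM: "mor (f i) (ob X i) (ob Y i)" if "i \<le> n+1" for i
    using f(1) that chain_map_iff[of X n Y f] Xe Ye by blast
  obtain M where M: "cone_shaped n \<C> (shift X) (shift Y) (\<lambda>i. f (i+1)) M"
    using cone_exists[OF n, of "shift X" "shift Y" "\<lambda>i. f (i+1)"] XM YM fM by (auto simp: shift_def)
  have "push \<C> \<E> C (df X 0) \<delta> = \<one>\<^bsub>Ext \<E> C (ob X 1)\<^esub>"
    using exangle_ker_push[OF realization_exangle[OF X], of "df X 0" "ob X 1"] Xe d0
    by (auto simp: mor_def intro!: exI[of _ "ide \<C> (ob X 1)"])
  then have "push \<C> \<E> D (df X 0) \<rho> = \<one>\<^bsub>Ext \<E> D (ob X 1)\<^esub>" using \<rho>(4)[OF d0 zero] by blast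
  then have Ms: "M \<in> \<ss> D (ob X 1) \<one>\<^bsub>Ext \<E> D (ob X 1)\<^esub>" using cone[unfolded mapping_cone_def, OF M] by simp
  have one: "is_ext D (ob X 1) \<one>\<^bsub>Ext \<E> D (ob X 1)\<^esub>" using obj(3) d0 by (simp add: ext_one mor_def)
  note Me = realization_ends[OF one Ms]
  have "mor (ide \<C> D) D (ob M (n+1))" using Me obj(3) by (simp add: mor_def)
  then obtain m where m: "mor m D (ob M n)" "ide \<C> D = df M n \<cdot> m"
    using exangle_ker_pull[OF realization_exangle[OF one Ms], of "ide \<C> D" D] pull_ide[OF one] Me by auto
  have Mn: "mor (df M n) (ob M n) D" using exangle_mor(1)[OF realization_exangle[OF one Ms], of n] Me by simp
  obtain j1 j2 q1 q2 where "biproduct \<C> (ob X (n+1)) (ob Y n) (ob M n) j1 j2 q1 q2"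
    "df M n \<cdot> j1 = i2" "df M n \<cdot> j2 = df Y n"
  proof -
    from M obtain J1 J2 Q1 Q2 where "\<forall>i\<in>{1..n}. biproduct \<C> (ob (shift X) i) (ob (shift Y) (i-1)) (ob M i) (J1 i) (J2 i) (Q1 i) (Q2 i)"
      "df M n \<cdot> J1 n = f (n+1)" "df M n \<cdot> J2 n = df (shift Y) (n-1)"
      unfolding cone_shaped_def by blast
    then show ?thesis using that[of "J1 n" "J2 n" "Q1 n" "Q2 n"] n f(2) by (simp add: shift_def)
  qed
  note j = this(1)[unfolded biproduct_iff] and dj = this(2,3)
  define b where "b = q1 \<cdot> (m \<cdot> i1)"
  define y where "y = q2 \<cdot> (m \<cdot> i1)"
  note MM = DM[unfolded mor_def] m(1)[unfolded mor_def] j[unfolded mor_def] Mn[unfolded mor_def] YM[of n, unfolded mor_def]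
  have b: "mor b T C" and y: "mor y T (ob Y n)" using MM Xe by (auto simp: mor_def b_def y_def)
  \<comment> \<open>Insert the section m and decompose M_n into its two summands. The last
    differential of the cone is the row (i2, d_n^Y), so i1 = i2 b + d_n^Y y; pulling \<rho> back
    along i1 gives \<tau>, and the second summand contributes zero.\<close>
  have "i1 = df M n \<cdot> ((j1 \<cdot> q1 \<boxplus> j2 \<cdot> q2) \<cdot> (m \<cdot> i1))"
    using MM m(2)[symmetric, THEN cmp_extend, of i1] by simp
  also have "\<dots> = df M n \<cdot> (j1 \<cdot> (q1 \<cdot> (m \<cdot> i1)) \<boxplus> j2 \<cdot> (q2 \<cdot> (m \<cdot> i1)))"
    by (subst cmp_plus_left) (use MM in simp_all)
  also have "\<dots> = i2 \<cdot> b \<boxplus> df Y n \<cdot> y"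
    unfolding b_def y_def using MM by (simp add: dj[THEN cmp_extend])
  finally have i1: "i1 = i2 \<cdot> b \<boxplus> df Y n \<cdot> y" .
  have dY: "mor (df Y n) (ob Y n) D" using YM[of n] Ye by simp
  have mm: "mor (i2 \<cdot> b) T D" "mor (df Y n \<cdot> y) T D" using mor_cmp[OF b, of i2 D] mor_cmp[OF y dY] DM by auto
  have "pull \<C> \<E> A (df Y n \<cdot> y) \<rho> = \<one>\<^bsub>Ext \<E> T A\<^esub>"
    using exangle_ker_pull[OF realization_exangle[OF \<rho>(1) Y], of "df Y n \<cdot> y" T] Ye mm(2) y by auto
  moreover have "pull \<C> \<E> A (i2 \<cdot> b) \<rho> = pull \<C> \<E> A b \<delta>"
    using pull_pull[OF \<rho>(1) _ b, of i2] DM \<rho>(3) by simp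
  ultimately have "\<tau> = pull \<C> \<E> A b \<delta> \<otimes>\<^bsub>Ext \<E> T A\<^esub> \<one>\<^bsub>Ext \<E> T A\<^esub>"
    using pull_plus[OF \<rho>(1) mm] i1 \<rho>(2) by simp
  then have "\<tau> = pull \<C> \<E> A b \<delta>"
    using group_Ext[OF \<tau>] pull_ext[OF X(1) b] by (simp add: comm_group_def group.is_monoid is_ext_def)
  then show ?thesis using b by blast
qed

text \<open>The mirror image of \<open>push_exact_at_ext\<close>, carried out with the cocone since
  the signs in the cones do not survive reversal. Only the extension with components \<tau> and
  \<delta> is taken from the opposite category.\<close>

lemma pull_exact_at_ext:
  assumes n: "1 \<le> n" and X: "is_ext C A \<delta>" "X \<in> \<ss> C A \<delta>" and \<tau>: "is_ext C T \<tau>"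
    and zero: "pull \<C> \<E> T (df X n) \<tau> = \<one>\<^bsub>Ext \<E> (ob X n) T\<^esub>"
  shows "\<exists>a. mor a A T \<and> \<tau> = push \<C> \<E> C a \<delta>"
proof -
  interpret op: additive_bifunctor "op_cat \<C>" "op_bif \<E>" by (rule op_additive_bifunctor)
  note Xe = realization_ends[OF X]
  have XM: "mor (df X i) (ob X i) (ob X (i+1))" if "i \<le> n" for i using Xe that unfolding complexes_iff by blast
  have dn: "mor (df X n) (ob X n) C" using XM[of n] Xe by simp
  obtain B p1 p2 i1 i2 where B: "biproduct \<C> T A B i1 i2 p1 p2"
    using ex_biproduct X(1) \<tau> unfolding is_ext_def by blast
  note BM = B[unfolded biproduct_iff]
  have opB: "biproduct (op_cat \<C>) T A B p1 p2 i1 i2" using B by simp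
  have "op.is_ext T C \<tau>" "op.is_ext A C \<delta>" using \<tau> X(1) by simp_all
  from op.ext_cotuple[OF opB this] obtain \<rho> where \<rho>: "is_ext C B \<rho>" "push \<C> \<E> C p1 \<rho> = \<tau>" "push \<C> \<E> C p2 \<rho> = \<delta>"
      "\<And>c D. \<lbrakk>mor c D C; pull \<C> \<E> T c \<tau> = \<one>\<^bsub>Ext \<E> D T\<^esub>; pull \<C> \<E> A c \<delta> = \<one>\<^bsub>Ext \<E> D A\<^esub>\<rbrakk>
      \<Longrightarrow> pull \<C> \<E> B c \<rho> = \<one>\<^bsub>Ext \<E> D B\<^esub>"
    by (simp, metis)
  obtain Y where Y: "Y \<in> \<ss> C B \<rho>" using realization_nonempty[OF \<rho>(1)] by blast
  note Ye = realization_ends[OF \<rho>(1) Y]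
  have YM: "mor (df Y i) (ob Y i) (ob Y (i+1))" if "i \<le> n" for i using Ye that unfolding complexes_iff by blast
  have obj: "B \<in> Obj \<C>" "A \<in> Obj \<C>" "C \<in> Obj \<C>" "\<rho> \<in> carrier (Ext \<E> C B)" "p2 \<in> Mor \<C> B A"
    using X(1) \<rho>(1) BM by (auto simp: is_ext_def mor_iff)
  obtain f where f: "chain_map n \<C> Y X f" "f 0 = p2"
    and cone: "\<And>N. mapping_cocone n \<C> Y X f N \<Longrightarrow> N \<in> \<ss> (ob X n) B (pull \<C> \<E> B (df X n) \<rho>)"
    using EA2_op[OF obj, of Y X] X(2) Y \<rho>(3) by blast
  have fM: "mor (f i) (ob Y i) (ob X i)" if "i \<le> n+1" for i
    using f(1) that chain_map_iff[of Y n X f] Xe Ye by blast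
  obtain N where N: "cone_shaped n \<C> Y X f N"
    using cone_exists[OF n, of Y X f] XM YM fM by auto
  have "pull \<C> \<E> A (df X n) \<delta> = \<one>\<^bsub>Ext \<E> (ob X n) A\<^esub>"
    using exangle_ker_pull[OF realization_exangle[OF X], of "df X n" "ob X n"] Xe dn
    by (auto simp: mor_def intro!: exI[of _ "ide \<C> (ob X n)"])
  then have "pull \<C> \<E> B (df X n) \<rho> = \<one>\<^bsub>Ext \<E> (ob X n) B\<^esub>" using \<rho>(4)[OF dn zero] by blast
  then have Ns: "N \<in> \<ss> (ob X n) B \<one>\<^bsub>Ext \<E> (ob X n) B\<^esub>" using cone[unfolded mapping_cocone_def, OF N] by simp
  have one: "is_ext (ob X n) B \<one>\<^bsub>Ext \<E> (ob X n) B\<^esub>" using obj(1) dn by (simp add: ext_one mor_def)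
  note Ne = realization_ends[OF one Ns]
  have "mor (ide \<C> B) (ob N 0) B" using Ne obj(1) by (simp add: mor_def)
  then obtain m where m: "mor m (ob N 1) B" "ide \<C> B = m \<cdot> df N 0"
    using exangle_ker_push[OF realization_exangle[OF one Ns], of "ide \<C> B" B] push_ide[OF one] Ne by auto
  have N0: "mor (df N 0) B (ob N 1)" using exangle_mor(1)[OF realization_exangle[OF one Ns], of 0] Ne by simp
  obtain j1 j2 q1 q2 where "biproduct \<C> (ob Y 1) (ob X 0) (ob N 1) j1 j2 q1 q2"
    "q1 \<cdot> df N 0 = \<boxminus> (df Y 0)" "q2 \<cdot> df N 0 = p2"
  proof -
    from N obtain J1 J2 Q1 Q2 where J: "\<forall>i\<in>{1..n}. biproduct \<C> (ob Y i) (ob X (i-1)) (ob N i) (J1 i) (J2 i) (Q1 i) (Q2 i)"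
      "Q1 1 \<cdot> df N 0 = pneg \<C> (ob Y 0) (ob Y 1) (df Y 0)" "Q2 1 \<cdot> df N 0 = f 0"
      unfolding cone_shaped_def by blast
    moreover have "biproduct \<C> (ob Y 1) (ob X (1-1)) (ob N 1) (J1 1) (J2 1) (Q1 1) (Q2 1)" 
      using bspec[OF J(1), of 1] n by simp
    ultimately show ?thesis using that[of "J1 1" "J2 1" "Q1 1" "Q2 1"] f(2) YM[of 0] by (simp add: mor_def pneg_neg)
  qed
  note j = this(1)[unfolded biproduct_iff] and dj = this(2,3)
  define a where "a = p1 \<cdot> (m \<cdot> j2)"
  define y where "y = p1 \<cdot> (m \<cdot> j1)"
  note MM = BM[unfolded mor_def] m(1)[unfolded mor_def] j[unfolded mor_def] N0[unfolded mor_def] YM[of 0, unfolded mor_def]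
  have a: "mor a A T" and y: "mor y (ob Y 1) T" using MM Xe by (auto simp: mor_def a_def y_def)
  \<comment> \<open>m is a left inverse of the first differential of the cocone, which is the column
    with entries -d_0^Y and p2. Hence p1 = -y d_0^Y + a p2, and the first summand kills
    \<rho>.\<close>
  have "p1 = p1 \<cdot> (m \<cdot> ((j1 \<cdot> q1 \<boxplus> j2 \<cdot> q2) \<cdot> df N 0))"
    using MM m(2)[symmetric] by simp
  also have "\<dots> = p1 \<cdot> (m \<cdot> (j1 \<cdot> (q1 \<cdot> df N 0) \<boxplus> j2 \<cdot> (q2 \<cdot> df N 0)))"
    by (subst cmp_plus_left) (use MM in simp_all)
  also have "\<dots> = (\<boxminus> y) \<cdot> df Y 0 \<boxplus> a \<cdot> p2"
    unfolding dj a_def y_def using MM Xe Ye by simp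
  finally have p1: "p1 = (\<boxminus> y) \<cdot> df Y 0 \<boxplus> a \<cdot> p2" .
  have dY: "mor (df Y 0) B (ob Y 1)" using YM[of 0] Ye by simp
  have ny: "mor (\<boxminus> y) (ob Y 1) T" using y by (rule mor_neg)
  have mm: "mor ((\<boxminus> y) \<cdot> df Y 0) B T" "mor (a \<cdot> p2) B T" using mor_cmp[OF dY ny] mor_cmp[OF _ a, of p2 B] BM by auto
  have "push \<C> \<E> C ((\<boxminus> y) \<cdot> df Y 0) \<rho> = \<one>\<^bsub>Ext \<E> C T\<^esub>"
    using exangle_ker_push[OF realization_exangle[OF \<rho>(1) Y], of "(\<boxminus> y) \<cdot> df Y 0" T] Ye mm(1) ny by auto
  moreover have "push \<C> \<E> C (a \<cdot> p2) \<rho> = push \<C> \<E> C a \<delta>"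
    using push_push[OF \<rho>(1) _ a, of p2] BM \<rho>(3) by simp
  ultimately have "\<tau> = \<one>\<^bsub>Ext \<E> C T\<^esub> \<otimes>\<^bsub>Ext \<E> C T\<^esub> push \<C> \<E> C a \<delta>"
    using push_plus[OF \<rho>(1) mm] p1 \<rho>(2) by simp
  then have "\<tau> = push \<C> \<E> C a \<delta>"
    using group_Ext[OF \<tau>] push_ext[OF X(1) a] by (simp add: comm_group_def group.is_monoid is_ext_def)
  then show ?thesis using a by blast
qed

lemma realized_extensions:
  assumes "1 \<le> n" "krull_schmidt \<C>"
  shows "realized_extensions n \<C> \<E> \<ss>"
proof (rule realized_extensions.intro[OF additive_bifunctor_axioms realized_extensions_axioms.intro], goal_cases)
  case 1
  show ?case by (rule assms)
next
  case (2 C A \<delta>)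
  then show ?case by (rule realization_nonempty)
next
  case (3 C A \<delta> X)
  then show ?case by (rule realization_eq)
next
  case (4 C A \<delta> X Y)
  then show ?case using realization_eq by blast
next
  case (5 C A \<delta> X)
  then show ?case by (rule realization_exangle)
next
  case (6 C A \<delta> X T \<tau>)
  then show ?case using push_exact_at_ext assms by blast
next
  case (7 C A \<delta> X T \<tau>)
  then show ?case using pull_exact_at_ext assms by blast
next
  case (8 f A B g D)
  then show ?case using EA1_inflation[of A B D f g] by (simp add: mor_iff)
next
  case (9 f A B g D)
  then show ?case using EA1_deflation[of A B D f g] by (simp add: mor_iff)
next
  case (10 e S)
  then show ?case using krull_schmidt_splits assms by blast
qed

end

section \<open>Full subcategories\<close>

lemma additive_subcategory_Obj: "additive_subcategory \<C> \<A> \<Longrightarrow> \<A> \<subseteq> Obj \<C>"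
  unfolding additive_subcategory_def by blast

lemma full_subcategory_simps [simp]:
  "Obj (full_subcategory \<C> \<A>) = \<A>" "Hom (full_subcategory \<C> \<A>) = Hom \<C>" "cmp (full_subcategory \<C> \<A>) = cmp \<C>"
  "ide (full_subcategory \<C> \<A>) = ide \<C>" 
  by (simp_all add: full_subcategory_def)

lemma full_subcategory_push [simp]:
  "push (full_subcategory \<C> \<A>) \<E> = push \<C> \<E>" "pull (full_subcategory \<C> \<A>) \<E> = pull \<C> \<E>"
  by (simp_all add: push_def pull_def fun_eq_iff)

lemma full_subcategory_cplx [simp]:
  "chain_map n (full_subcategory \<C> \<A>) = chain_map n \<C>"
  "chain_map_fixing_ends n (full_subcategory \<C> \<A>) = chain_map_fixing_ends n \<C>"
  "homotopic n (full_subcategory \<C> \<A>) = homotopic n \<C>"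
  "trivial_left (full_subcategory \<C> \<A>) = trivial_left \<C>"
  "trivial_right n (full_subcategory \<C> \<A>) = trivial_right n \<C>"
  "ext_morphism (full_subcategory \<C> \<A>) \<E> = ext_morphism \<C> \<E>"
  by (simp_all add: fun_eq_iff chain_map_def chain_map_fixing_ends_def homotopic_def trivial_left_def
    trivial_right_def ext_morphism_def)

lemma full_subcategory_biproduct:
  "\<A> \<subseteq> Obj \<C> \<Longrightarrow> biproduct (full_subcategory \<C> \<A>) X Y S i1 i2 p1 p2 \<longleftrightarrow>
    biproduct \<C> X Y S i1 i2 p1 p2 \<and> X \<in> \<A> \<and> Y \<in> \<A> \<and> S \<in> \<A>"
  by (auto simp: biproduct_def)

lemma full_subcategory_complexes:
  "\<A> \<subseteq> Obj \<C> \<Longrightarrow> X \<in> complexes n (full_subcategory \<C> \<A>) \<longleftrightarrow> X \<in> complexes n \<C> \<and> (\<forall>i\<le>n+1. ob X i \<in> \<A>)"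
  by (auto simp: complexes_def)

text \<open>By fullness, chain maps and homotopies between complexes of the subcategory are the same
  in both categories; only the choice of complexes is restricted.\<close>

lemma full_subcategory_homotopy_class:
  "\<A> \<subseteq> Obj \<C> \<Longrightarrow> homotopy_class n (full_subcategory \<C> \<A>) X = {Y \<in> homotopy_class n \<C> X. \<forall>i\<le>n+1. ob Y i \<in> \<A>}"
  by (auto simp: homotopy_class_def complexes_from_to_def full_subcategory_complexes)

lemma full_subcategory_cone_shaped:
  assumes "\<A> \<subseteq> Obj \<C>" "cone_shaped n (full_subcategory \<C> \<A>) U V g K" "ob U 0 \<in> \<A>" "ob V n \<in> \<A>"
  shows "cone_shaped n \<C> U V g K \<and> (\<forall>i\<le>n+1. ob K i \<in> \<A>)"
proof
  show "cone_shaped n \<C> U V g K"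
    using assms(2) unfolding cone_shaped_def full_subcategory_simps full_subcategory_biproduct[OF assms(1)] by blast
  show "\<forall>i\<le>n+1. ob K i \<in> \<A>"
  proof (intro allI impI)
    fix i assume "i \<le> n+1"
    then consider "i = 0" | "i = n+1" | "i \<in> {1..n}" by fastforce
    then show "ob K i \<in> \<A>"
      using assms(2-4) unfolding cone_shaped_def full_subcategory_biproduct[OF assms(1)] by cases auto
  qed
qed

text \<open>Exactness in the subcategory is tested at fewer objects T, with the same groups and
  maps.\<close>

lemma n_exangle_full_subcategory:
  assumes "\<A> \<subseteq> Obj \<C>" "n_exangle n \<C> \<E> X \<delta>" "\<And>i. i \<le> n+1 \<Longrightarrow> ob X i \<in> \<A>"
  shows "n_exangle n (full_subcategory \<C> \<A>) \<E> X \<delta>"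
  using assms unfolding n_exangle_def full_subcategory_simps full_subcategory_push full_subcategory_complexes[OF assms(1)]
  by (meson subsetD)

text \<open>Closure of a subcategory is formulated for indexed direct sums, while cones and the
  additive structure use biproducts; this links the two.\<close>

lemma (in preadditive_category) biproduct_direct_sum:
  assumes "biproduct \<C> X Y S i1 i2 p1 p2"
  shows "direct_sum \<C> 2 (\<lambda>k. if k = 0 then X else Y) S (\<lambda>k. if k = 0 then i1 else i2) (\<lambda>k. if k = 0 then p1 else p2)"
proof -
  note B = assms[unfolded biproduct_iff]
  note M = B[unfolded mor_def]
  interpret comm_group "Hom \<C> S S" using M Hom_comm_group by blast
  \<comment> \<open>\<open>lessThan_Suc\<close> inserts the larger index first, which reverses the
    summands.\<close>
  have "finprod (Hom \<C> S S) (\<lambda>k. (if k = 0 then i1 else i2) \<cdot> (if k = 0 then p1 else p2)) {..<2::nat} = i2 \<cdot> p2 \<boxplus> i1 \<cdot> p1"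
    using M by (simp add: numeral_2_eq_2 lessThan_Suc padd_plus)
  also have "\<dots> = i1 \<cdot> p1 \<boxplus> i2 \<cdot> p2" by (rule plus_comm) (use M in simp_all)
  also have "\<dots> = ide \<C> S" using B by blast
  finally show ?thesis using M by (auto simp: direct_sum_def less_2_cases_iff)
qed

lemma (in preadditive_category) biproduct_in_subcategory:
  assumes "additive_subcategory \<C> \<A>" "biproduct \<C> X Y S i1 i2 p1 p2" "X \<in> \<A>" "Y \<in> \<A>"
  shows "S \<in> \<A>"
proof -
  have "\<forall>k<2. (if k = (0::nat) then X else Y) \<in> \<A>" using assms(3,4) by simp
  then show ?thesis using biproduct_direct_sum[OF assms(2)] assms(1) unfolding additive_subcategory_def by blast
qed

context additive_category
begin

lemma zero_in_subcategory:
  assumes "additive_subcategory \<C> \<A>" "zero_object \<C> Z"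
  shows "Z \<in> \<A>"
proof -
  note Z = zero_object_ide[OF assms(2)]
  interpret comm_group "Hom \<C> Z Z" using Z Hom_comm_group by blast
  \<comment> \<open>Z is the direct sum of an empty family: the empty product is the zero morphism,
    which is the identity of Z.\<close>
  have "direct_sum \<C> 0 undefined Z undefined undefined" using Z by (simp add: direct_sum_def)
  then show ?thesis using assms(1) unfolding additive_subcategory_def by blast
qed

lemma full_subcategory_additive:
  assumes "additive_subcategory \<C> \<A>"
  shows "additive_category (full_subcategory \<C> \<A>)"
proof -
  have sub: "\<A> \<subseteq> Obj \<C>" using assms by (rule additive_subcategory_Obj)
  then have subO: "X \<in> \<A> \<Longrightarrow> X \<in> Obj \<C>" for X by blast
  have "preadditive_category (full_subcategory \<C> \<A>)"
  proof (rule preadditive_category.intro, goal_cases)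
    case (1 A B A' B' f)
    then show ?case using Mor_disjoint[of A B A' B' f] by (simp add: subO)
  next
    case (3 A B D f g)
    then show ?case using cmp_in[of A B D f g] by (simp add: subO)
  next
    case (6 A B D F f g h)
    then show ?case using cmp_assoc[of A B D F f g h] by (simp add: subO)
  next
    case (4 A B f)
    then show ?case using cmp_ide_right[of A B f] by (simp add: subO)
  next
    case (5 A B f)
    then show ?case using cmp_ide_left[of A B f] by (simp add: subO)
  qed (use ide_in Hom_comm_group postcomp_hom precomp_hom in \<open>simp_all add: subO\<close>)
  moreover have "\<exists>Z. zero_object (full_subcategory \<C> \<A>) Z"
  proof -
    obtain Z where Z: "zero_object \<C> Z" using ex_zero_object by blast
    then have "zero_object (full_subcategory \<C> \<A>) Z"
      using zero_in_subcategory[OF assms Z] unfolding zero_object_def by (simp add: subO)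
    then show ?thesis by blast
  qed
  moreover have "\<exists>S i1 i2 p1 p2. biproduct (full_subcategory \<C> \<A>) X Y S i1 i2 p1 p2" if XY: "X \<in> \<A>" "Y \<in> \<A>" for X Y
  proof -
    obtain S i1 i2 p1 p2 where S: "biproduct \<C> X Y S i1 i2 p1 p2" using ex_biproduct[OF subO[OF XY(1)] subO[OF XY(2)]] by blast
    have "S \<in> \<A>"
      using biproduct_in_subcategory[OF assms S XY] .
    then show ?thesis using S XY full_subcategory_biproduct[OF sub] by blast
  qed
  ultimately show ?thesis by (simp add: additive_category_def additive_category_axioms_def)
qed

text \<open>A zero object of the subcategory is tested only against objects of the subcategory.
  However, its identity is zero, and that forces all morphisms of the ambient category into and out
  of it to vanish. It allows (R2) to be inherited.\<close>

lemma zero_object_full_subcategory: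
  assumes "additive_subcategory \<C> \<A>" "zero_object (full_subcategory \<C> \<A>) Z"
  shows "zero_object \<C> Z"
proof -
  interpret sub: additive_category "full_subcategory \<C> \<A>" using assms(1) by (rule full_subcategory_additive)
  have Z: "Z \<in> \<A>" "ide \<C> Z = zmor \<C> Z Z" using sub.zero_object_ide[OF assms(2)] by simp_all
  then have ZO: "Z \<in> Obj \<C>" using additive_subcategory_Obj[OF assms(1)] by blast
  have "f = zmor \<C> Z X" if "X \<in> Obj \<C>" "f \<in> Mor \<C> Z X" for f X
  proof -
    have f: "mor f Z X" using that ZO by (simp add: mor_iff)
    then have "f = f \<cdot> zmor \<C> Z Z" unfolding Z(2)[symmetric] by (simp add: mor_def)
    then show ?thesis using f by (simp add: mor_def)
  qed
  moreover have "f = zmor \<C> X Z" if "X \<in> Obj \<C>" "f \<in> Mor \<C> X Z" for f X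
  proof -
    have f: "mor f X Z" using that ZO by (simp add: mor_iff)
    then have "f = zmor \<C> Z Z \<cdot> f" unfolding Z(2)[symmetric] by (simp add: mor_def)
    then show ?thesis using f by (simp add: mor_def)
  qed
  moreover have "zmor \<C> Z X \<in> Mor \<C> Z X" "zmor \<C> X Z \<in> Mor \<C> X Z" if "X \<in> Obj \<C>" for X
    using that ZO mor_zero mor_Mor by blast+
  ultimately have "\<exists>!f. f \<in> Mor \<C> Z X" "\<exists>!f. f \<in> Mor \<C> X Z" if "X \<in> Obj \<C>" for X
    using that by (metis (no_types))+
  then show ?thesis unfolding zero_object_def using ZO by blast
qed

end

lemma (in additive_bifunctor) full_subcategory_bifunctor:
  assumes "additive_subcategory \<C> \<A>"
  shows "additive_bifunctor (full_subcategory \<C> \<A>) \<E>"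
proof -
  have sub: "A \<in> \<A> \<Longrightarrow> A \<in> Obj \<C>" for A using additive_subcategory_Obj[OF assms] by blast
  show ?thesis
  proof (rule additive_bifunctor.intro[OF full_subcategory_additive[OF assms] additive_bifunctor_axioms.intro], goal_cases)
    case (1 C A)
    then show ?case using Ext_comm_group by (simp add: sub)
  next
    case (2 C C' A A' c a)
    then show ?case using act_hom by (simp add: sub)
  next
    case (3 C A \<delta>)
    then show ?case using act_ide by (simp add: sub)
  next
    case (4 C C' C'' A A' A'' c c' a a' \<delta>)
    then show ?case using act_cmp[of C C' C'' A A' A'' c c' a a' \<delta>] by (simp add: sub)
  next
    case (5 C A A' a b \<delta>)
    then show ?case using push_add by (simp add: sub)
  next
    case (6 C C' A c d \<delta>)
    then show ?case using pull_add by (simp add: sub)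
  qed
qed

text \<open>The definite description is meaningful because every admissible X gives the same set:
  the class in the subcategory consists of the members of \<open>\<ss> C A \<delta>\<close> with all
  terms in \<open>\<A>\<close>.\<close>

lemma (in exact_realization) restricted_realization_eq:
  assumes sub: "\<A> \<subseteq> Obj \<C>" and closed: "n_extension_closed n \<E> \<ss> \<A>"
    and "C \<in> \<A>" "A \<in> \<A>" "\<delta> \<in> carrier (Ext \<E> C A)"
  shows "restricted_realization n \<C> \<ss> \<A> C A \<delta> = {X \<in> \<ss> C A \<delta>. \<forall>i\<le>n+1. ob X i \<in> \<A>}"
    and "\<exists>X \<in> complexes_from_to n (full_subcategory \<C> \<A>) A C.
      restricted_realization n \<C> \<ss> \<A> C A \<delta> = homotopy_class n (full_subcategory \<C> \<A>) X"
proof -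
  have ext: "is_ext C A \<delta>" using assms by (auto simp: is_ext_def)
  have *: "homotopy_class n (full_subcategory \<C> \<A>) X = {Y \<in> \<ss> C A \<delta>. \<forall>i\<le>n+1. ob Y i \<in> \<A>}" if "X \<in> \<ss> C A \<delta>" for X
    using realization_eq(2)[OF ext that] realization_ends[OF ext that] homotopy_class_iff
    unfolding full_subcategory_homotopy_class[OF sub] by blast
  obtain X where X: "X \<in> \<ss> C A \<delta>" "\<forall>i\<le>n+1. ob X i \<in> \<A>"
    using closed assms unfolding n_extension_closed_def by blast
  show eq: "restricted_realization n \<C> \<ss> \<A> C A \<delta> = {X \<in> \<ss> C A \<delta>. \<forall>i\<le>n+1. ob X i \<in> \<A>}"
    unfolding restricted_realization_def
  proof (rule the_equality)
    show "\<exists>Y\<in>\<ss> C A \<delta>. (\<forall>i\<le>n+1. ob Y i \<in> \<A>) \<and>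
      {X \<in> \<ss> C A \<delta>. \<forall>i\<le>n+1. ob X i \<in> \<A>} = homotopy_class n (full_subcategory \<C> \<A>) Y"
      using X *[OF X(1)] by (intro bexI[of _ X]) simp_all
  qed (use * in blast)
  show "\<exists>X \<in> complexes_from_to n (full_subcategory \<C> \<A>) A C.
      restricted_realization n \<C> \<ss> \<A> C A \<delta> = homotopy_class n (full_subcategory \<C> \<A>) X"
    unfolding eq using X realization_ends[OF ext X(1)] *[OF X(1)]
    by (intro bexI[of _ X]) (simp_all add: complexes_from_to_def full_subcategory_complexes[OF sub])
qed

theorem theorem1p1:
  fixes n :: nat
    and \<C> :: "('o, 'm, 'x) cat_scheme"
    and \<E> :: "('o, 'm, 'e, 'y) bif_scheme"
    and \<ss> :: "('o, 'm, 'e) realization"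
    and \<A> :: "'o set"
  assumes "n \<ge> 1"
    and "n_exangulated_category n \<C> \<E> \<ss>"
    and "krull_schmidt \<C>"
    and "additive_subcategory \<C> \<A>"
    and "n_extension_closed n \<E> \<ss> \<A>"
  shows "n_exangulated_category n (full_subcategory \<C> \<A>) \<E> (restricted_realization n \<C> \<ss> \<A>)"
proof -
  let ?\<B> = "full_subcategory \<C> \<A>" and ?\<tt> = "restricted_realization n \<C> \<ss> \<A>"
  interpret n_exangulated_category n \<C> \<E> \<ss> by (rule assms)
  have sub: "\<A> \<subseteq> Obj \<C>" using assms(4) by (rule additive_subcategory_Obj)
  have realized: "realized_extensions n \<C> \<E> \<ss>" using realized_extensions assms(1,3) by blast
  interpret closed: extension_closed n \<C> \<E> \<ss> \<A>
  proof (rule extension_closed.intro[OF realized extension_closed_axioms.intro], goal_cases)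
    case 1
    show ?case by (rule sub)
  next
    case (2 X Y S i1 i2 p1 p2)
    then show ?case using biproduct_in_subcategory[OF assms(4)] by blast
  next
    case (3 X Y S i1 i2 p1 p2)
    then show ?case using assms(4) unfolding additive_subcategory_def by blast
  next
    case (4 C A \<delta>)
    then show ?case using assms(5) unfolding n_extension_closed_def is_ext_def by blast
  qed
  interpret sub: additive_bifunctor ?\<B> \<E> using assms(4) by (rule full_subcategory_bifunctor)
  note t_eq = restricted_realization_eq[OF sub assms(5)]
  have t_iff: "X \<in> ?\<tt> C A \<delta> \<longleftrightarrow> X \<in> \<ss> C A \<delta> \<and> (\<forall>i\<le>n+1. ob X i \<in> \<A>)"
    if "C \<in> \<A>" "A \<in> \<A>" "\<delta> \<in> carrier (Ext \<E> C A)" for C A \<delta> X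
    using t_eq(1)[OF that] by simp
  have ext: "is_ext C A \<delta>" if "C \<in> \<A>" "A \<in> \<A>" "\<delta> \<in> carrier (Ext \<E> C A)" for C A \<delta>
    using that sub by (auto simp: is_ext_def)
  have confl: "conflation ?\<B> \<E> ?\<tt> X \<longleftrightarrow>
    (\<exists>C\<in>\<A>. \<exists>A\<in>\<A>. \<exists>\<delta>. is_ext C A \<delta> \<and> X \<in> \<ss> C A \<delta> \<and> (\<forall>i\<le>n+1. ob X i \<in> \<A>))" for X
    unfolding conflation_def full_subcategory_simps using t_iff ext unfolding is_ext_def by blast
  have ends: "A \<in> \<A>" "C \<in> \<A>" if "is_ext C A \<delta>" "X \<in> \<ss> C A \<delta>" "\<forall>i\<le>n+1. ob X i \<in> \<A>" for C A \<delta> X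
    using realization_ends[OF that(1,2)] that(3) by auto
  have "exact_realization n ?\<B> \<E> ?\<tt>"
  proof (rule exact_realization.intro[OF sub.additive_bifunctor_axioms exact_realization_axioms.intro], goal_cases)
    case (1 C A \<delta>)
    then show ?case using t_eq(2) by simp
  next
    case (2 C A \<delta> C' A' \<rho> X Y a c)
    then have O: "C \<in> \<A>" "A \<in> \<A>" "C' \<in> \<A>" "A' \<in> \<A>" by simp_all
    then have "X \<in> \<ss> C A \<delta>" "Y \<in> \<ss> C' A' \<rho>" using 2 t_iff[of C A \<delta> X] t_iff[of C' A' \<rho> Y] by simp_all
    then show ?case using R0[of C A \<delta> C' A' \<rho> X Y a c] 2 subsetD[OF sub O(1)] subsetD[OF sub O(2)] subsetD[OF sub O(3)] subsetD[OF sub O(4)] by simp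
  next
    case (3 C A \<delta> X)
    then have O: "C \<in> \<A>" "A \<in> \<A>" "\<delta> \<in> carrier (Ext \<E> C A)" by simp_all
    then have X: "X \<in> \<ss> C A \<delta>" "\<And>i. i \<le> n+1 \<Longrightarrow> ob X i \<in> \<A>" using 3 t_iff[of C A \<delta> X] by simp_all
    show ?case using n_exangle_full_subcategory[OF sub realization_exangle[OF ext[OF O] X(1)] X(2)] .
  next
    case (4 A Z)
    then have Z: "zero_object \<C> Z" "Z \<in> \<A>"
      using zero_object_full_subcategory[OF assms(4)] sub.zero_object_ide(1)[of Z] by simp_all
    have A: "A \<in> \<A>" "A \<in> Obj \<C>" using 4 sub by auto
    have one: "\<one>\<^bsub>Ext \<E> Z A\<^esub> \<in> carrier (Ext \<E> Z A)" using ext_one[of Z A] Z A sub by (auto simp: is_ext_def)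
    show ?case
      using t_eq(1)[OF Z(2) A(1) one] R2_left[OF A(2) Z(1)] full_subcategory_homotopy_class[OF sub] by simp
  next
    case (5 A Z)
    then have Z: "zero_object \<C> Z" "Z \<in> \<A>"
      using zero_object_full_subcategory[OF assms(4)] sub.zero_object_ide(1)[of Z] by simp_all
    have A: "A \<in> \<A>" "A \<in> Obj \<C>" using 5 sub by auto
    have one: "\<one>\<^bsub>Ext \<E> A Z\<^esub> \<in> carrier (Ext \<E> A Z)" using ext_one[of A Z] Z A sub by (auto simp: is_ext_def)
    show ?case
      using t_eq(1)[OF A(1) Z(2) one] R2_right[OF A(2) Z(1)] full_subcategory_homotopy_class[OF sub] by simp
  qed
  then show ?thesis
  proof (rule n_exangulated_category.intro[OF _ n_exangulated_category_axioms.intro], goal_cases)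
    case (1 A B D f g)
    have fg: "mor f A B" "mor g B D" using 1 sub by (auto intro!: morI)
    from 1 obtain C A' \<delta> X where X: "is_ext C A' \<delta>" "X \<in> \<ss> C A' \<delta>" "\<forall>i\<le>n+1. ob X i \<in> \<A>" "df X 0 = f"
      unfolding inflation_def confl by blast
    from 1 obtain F B' \<rho> Y where Y: "is_ext F B' \<rho>" "Y \<in> \<ss> F B' \<rho>" "\<forall>i\<le>n+1. ob Y i \<in> \<A>" "df Y 0 = g"
      unfolding inflation_def confl by blast
    \<comment> \<open>A morphism determines its ends, so composability of f and g makes the end of
      the first differential of X the start of Y.\<close>
    have "B' = ob X 1"
      using closed.realizes_mor(3)[OF X(1,2)] closed.realizes_mor(3)[OF Y(1,2)] fg X(4) Y(4) by (auto simp: mor_def)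
    then obtain W \<theta> Q where "is_ext W A' \<theta>" "Q \<in> \<ss> W A' \<theta>" "df Q 0 = g \<cdot>\<^bsub>\<C>\<^esub> f" "\<forall>i\<le>n+1. ob Q i \<in> \<A>"
      using closed.inflation_in_sub_cmp[OF X(1,2) _ Y(1,2)[unfolded \<open>B' = ob X 1\<close>]] X(3,4) Y(3,4) by blast
    then show ?case unfolding inflation_def confl using ends by simp blast
  next
    case (2 A B D f g)
    have fg: "mor f A B" "mor g B D" using 2 sub by (auto intro!: morI)
    from 2 obtain B' F \<delta> X where X: "is_ext B' F \<delta>" "X \<in> \<ss> B' F \<delta>" "\<forall>i\<le>n+1. ob X i \<in> \<A>" "df X n = f"
      unfolding deflation_def confl by blast
    from 2 obtain D' C \<rho> Y where Y: "is_ext D' C \<rho>" "Y \<in> \<ss> D' C \<rho>" "\<forall>i\<le>n+1. ob Y i \<in> \<A>" "df Y n = g"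
      unfolding deflation_def confl by blast
    have "B' = ob Y n"
      using closed.realizes_mor(5)[OF X(1,2)] closed.realizes_mor(5)[OF Y(1,2)] fg X(4) Y(4) by (auto simp: mor_def)
    then obtain W \<theta> Q where "is_ext D' W \<theta>" "Q \<in> \<ss> D' W \<theta>" "df Q n = g \<cdot>\<^bsub>\<C>\<^esub> f" "\<forall>i\<le>n+1. ob Q i \<in> \<A>"
      using closed.deflation_in_sub_cmp[OF X(1,2)[unfolded \<open>B' = ob Y n\<close>] _ Y(1,2)] X(3,4) Y(3,4) by blast
    then show ?case unfolding deflation_def confl using ends by simp blast
  next
    case (3 A C D \<rho> c X Y)
    then have O: "A \<in> \<A>" "C \<in> \<A>" "D \<in> \<A>" "\<rho> \<in> carrier (Ext \<E> D A)" "c \<in> Mor \<C> C D" by simp_all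
    have c: "mor c C D" using O sub by (auto intro!: morI)
    have c\<rho>: "is_ext C A (pull \<C> \<E> A c \<rho>)" using pull_ext[OF ext[OF O(3,1,4)] c] .
    then have X: "X \<in> \<ss> C A (pull \<C> \<E> A c \<rho>)" "\<forall>i\<le>n+1. ob X i \<in> \<A>" and Y: "Y \<in> \<ss> D A \<rho>" "\<forall>i\<le>n+1. ob Y i \<in> \<A>"
      using 3 O t_iff[of C A "pull \<C> \<E> A c \<rho>" X] t_iff[of D A \<rho> Y] by (simp_all add: is_ext_def)
    obtain f where f: "chain_map n \<C> X Y f" "f 0 = ide \<C> A" "f (n+1) = c"
      and cone: "\<And>M. mapping_cone n \<C> X Y f M \<Longrightarrow> M \<in> \<ss> D (ob X 1) (push \<C> \<E> D (df X 0) \<rho>)"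
      using EA2[of A C D \<rho> c X Y] O X(1) Y(1) sub by blast
    have d0: "mor (df X 0) A (ob X 1)" using closed.realizes_mor(3)[OF c\<rho> X(1)] .
    have p: "is_ext D (ob X 1) (push \<C> \<E> D (df X 0) \<rho>)" using push_ext[OF ext[OF O(3,1,4)] d0] .
    \<comment> \<open>By fullness the lift from the ambient category serves here too. A cone formed
      in the subcategory is a cone of the ambient category with all terms in \<open>\<A>\<close>, so
      (EA2) places it in the restricted class.\<close>
    have "M \<in> ?\<tt> D (ob X 1) (push \<C> \<E> D (df X 0) \<rho>)" if M: "mapping_cone n ?\<B> X Y f M" for M
    proof -
      have "cone_shaped n \<C> (shift X) (shift Y) (\<lambda>i. f (i+1)) M \<and> (\<forall>i\<le>n+1. ob M i \<in> \<A>)"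
        using full_subcategory_cone_shaped[OF sub M[unfolded mapping_cone_def]] X(2) Y(2) by (simp add: shift_def)
      then show ?thesis using cone X(2) O(3) p t_iff by (auto simp: mapping_cone_def is_ext_def)
    qed
    then show ?case using f by auto
  next
    case (4 A B C \<rho> a X Y)
    then have O: "A \<in> \<A>" "B \<in> \<A>" "C \<in> \<A>" "\<rho> \<in> carrier (Ext \<E> C A)" "a \<in> Mor \<C> A B" by simp_all
    have a: "mor a A B" using O sub by (auto intro!: morI)
    have a\<rho>: "is_ext C B (push \<C> \<E> C a \<rho>)" using push_ext[OF ext[OF O(3,1,4)] a] .
    then have Y: "Y \<in> \<ss> C B (push \<C> \<E> C a \<rho>)" "\<forall>i\<le>n+1. ob Y i \<in> \<A>" and X: "X \<in> \<ss> C A \<rho>" "\<forall>i\<le>n+1. ob X i \<in> \<A>"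
      using 4 O t_iff[of C B "push \<C> \<E> C a \<rho>" Y] t_iff[of C A \<rho> X] by (simp_all add: is_ext_def)
    obtain f where f: "chain_map n \<C> X Y f" "f 0 = a" "f (n+1) = ide \<C> C"
      and cone: "\<And>N. mapping_cocone n \<C> X Y f N \<Longrightarrow> N \<in> \<ss> (ob Y n) A (pull \<C> \<E> A (df Y n) \<rho>)"
      using EA2_op[of A B C \<rho> a X Y] O X(1) Y(1) sub by blast
    have dn: "mor (df Y n) (ob Y n) C" using closed.realizes_mor(5)[OF a\<rho> Y(1)] .
    have p: "is_ext (ob Y n) A (pull \<C> \<E> A (df Y n) \<rho>)" using pull_ext[OF ext[OF O(3,1,4)] dn] .
    have "N \<in> ?\<tt> (ob Y n) A (pull \<C> \<E> A (df Y n) \<rho>)" if N: "mapping_cocone n ?\<B> X Y f N" for N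
    proof -
      have "cone_shaped n \<C> X Y f N \<and> (\<forall>i\<le>n+1. ob N i \<in> \<A>)"
        using full_subcategory_cone_shaped[OF sub N[unfolded mapping_cocone_def]] X(2) Y(2) by simp
      then show ?thesis using cone Y(2) O(1) p t_iff by (auto simp: mapping_cocone_def is_ext_def)
    qed
    then show ?case using f by auto
  qed
qed

end
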